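(* Let $M$ be an $n$-dimensional complete minimal submanifold in $\mathbb{H}^{n+m}$. If $|A|^2 \leq \frac{(n+1)^2}{4}$ at every point of $M$, then $M$ is super stable.
   Context: $\mathbb{H}^{k}$ denotes the $k$-dimensional hyperbolic space of constant sectional curvature $-1$. $M$ is an immersed minimal submanifold (mean curvature vector identically zero), equipped with the induced Riemannian metric and volume element $dv$, and complete in this metric. $|A|^2$ is the squared norm of the second fundamental form of $M$ in $\mathbb{H}^{n+m}$. $W_0^{1,2}(M)$ is the closure of the compactly supported smooth functions in the Sobolev space $W^{1,2}(M)$. An $n$-dimensional minimal submanifold $M$ in $\mathbb{H}^{n+m}$ is called super stable if for every $\varphi \in W_0^{1,2}(M)$, $$\int_M |\nabla \varphi|^2 - (|A|^2 - n)\varphi^2 \, dv \geq 0.$$ *)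

theory Defs
  imports "HOL-Analysis.Analysis"
begin

section \<open>Smooth maps between Euclidean spaces\<close>

text \<open>Used for open sets only, where these are the usual classes of k times continuously
  differentiable and of smooth maps.\<close>

primrec Ck_on :: "nat \<Rightarrow> 'a::real_normed_vector set \<Rightarrow> ('a \<Rightarrow> 'b::real_normed_vector) \<Rightarrow> bool" where
  "Ck_on 0 S h \<longleftrightarrow> continuous_on S h"
| "Ck_on (Suc k) S h \<longleftrightarrow>
     (\<forall>x\<in>S. h differentiable (at x)) \<and> (\<forall>v. Ck_on k S (\<lambda>x. frechet_derivative h (at x) v))"

definition smooth_on :: "'a::real_normed_vector set \<Rightarrow> ('a \<Rightarrow> 'b::real_normed_vector) \<Rightarrow> bool" where
  "smooth_on S h \<longleftrightarrow> (\<forall>k. Ck_on k S h)"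

definition partial :: "'n::finite \<Rightarrow> (real^'n \<Rightarrow> 'b::real_normed_vector) \<Rightarrow> real^'n \<Rightarrow> 'b" where
  "partial i h x = frechet_derivative h (at x) (axis i 1)"


section \<open>Smooth manifolds\<close>

text \<open>The manifold is the whole type \<open>'p\<close>, with the topology of its type class. It need not be
  connected.\<close>

type_synonym ('p, 'n) chart = "'p set \<times> ('p \<Rightarrow> real^'n)"

abbreviation chart_inv :: "('p, 'n) chart \<Rightarrow> real^'n \<Rightarrow> 'p" where
  "chart_inv c \<equiv> inv_into (fst c) (snd c)"

abbreviation chart_image :: "('p, 'n) chart \<Rightarrow> (real^'n) set" where
  "chart_image c \<equiv> snd c ` fst c"

definition smooth_atlas :: "('p::{t2_space,second_countable_topology}, 'n::finite) chart set \<Rightarrow> bool" where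
  "smooth_atlas \<A> \<longleftrightarrow>
     (\<Union>c\<in>\<A>. fst c) = UNIV \<and>
     (\<forall>c\<in>\<A>. open (fst c) \<and> open (chart_image c) \<and>
            homeomorphism (fst c) (chart_image c) (snd c) (chart_inv c)) \<and>
     (\<forall>c\<in>\<A>. \<forall>d\<in>\<A>. smooth_on (snd c ` (fst c \<inter> fst d)) (snd d \<circ> chart_inv c))"

text \<open>Quantities computed from \<open>chart_at \<A> p\<close> below do not depend on the chart chosen.\<close>

definition chart_at :: "('p, 'n) chart set \<Rightarrow> 'p \<Rightarrow> ('p, 'n) chart" where
  "chart_at \<A> p = (SOME c. c \<in> \<A> \<and> p \<in> fst c)"

definition smooth_function ::
  "('p, 'n::finite) chart set \<Rightarrow> ('p \<Rightarrow> 'b::real_normed_vector) \<Rightarrow> bool" where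
  "smooth_function \<A> u \<longleftrightarrow> (\<forall>c\<in>\<A>. smooth_on (chart_image c) (u \<circ> chart_inv c))"

definition compactly_supported :: "('p::topological_space \<Rightarrow> real) \<Rightarrow> bool" where
  "compactly_supported u \<longleftrightarrow> compact (closure {p. u p \<noteq> 0})"


section \<open>Hyperbolic space\<close>

text \<open>Hyperboloid model: the upper sheet of \<open>\<langle>v, v\<rangle> = -1\<close> in Minkowski space \<open>'h \<times> real\<close>, with
  metric induced by the Lorentz form. Its dimension is \<open>DIM('h)\<close> and its curvature is -1.\<close>

definition lorentz :: "'h::real_inner \<times> real \<Rightarrow> 'h \<times> real \<Rightarrow> real" where
  "lorentz v w = fst v \<bullet> fst w - snd v * snd w"

definition hyperbolic_space :: "('h::real_inner \<times> real) set" where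
  "hyperbolic_space = {v. lorentz v v = -1 \<and> snd v > 0}"

text \<open>Orthogonal projection of Minkowski space onto the tangent space of the hyperboloid at \<open>v\<close>
  (recall \<open>\<langle>v, v\<rangle> = -1\<close>). Applied to flat derivatives it gives the Levi-Civita connection of
  hyperbolic space.\<close>

definition hyp_proj :: "'h::real_inner \<times> real \<Rightarrow> 'h \<times> real \<Rightarrow> 'h \<times> real" where
  "hyp_proj v w = w + lorentz w v *\<^sub>R v"


section \<open>Immersed submanifolds of hyperbolic space\<close>

abbreviation param ::
  "('p \<Rightarrow> 'h \<times> real) \<Rightarrow> ('p, 'n) chart \<Rightarrow> real^'n \<Rightarrow> 'h \<times> real" where
  "param f c \<equiv> f \<circ> chart_inv c"

definition immersed_submanifold ::
  "('p::{t2_space,second_countable_topology}, 'n::finite) chart set \<Rightarrow>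
   ('p \<Rightarrow> 'h::euclidean_space \<times> real) \<Rightarrow> bool" where
  "immersed_submanifold \<A> f \<longleftrightarrow>
     smooth_atlas \<A> \<and> range f \<subseteq> hyperbolic_space \<and> smooth_function \<A> f \<and>
     (\<forall>c\<in>\<A>. \<forall>x\<in>chart_image c. inj (frechet_derivative (param f c) (at x)))"

definition metric ::
  "('p \<Rightarrow> 'h::euclidean_space \<times> real) \<Rightarrow> ('p, 'n::finite) chart \<Rightarrow> real^'n \<Rightarrow> real^'n^'n" where
  "metric f c x = (\<chi> i j. lorentz (partial i (param f c) x) (partial j (param f c) x))"

definition inv_metric ::
  "('p \<Rightarrow> 'h::euclidean_space \<times> real) \<Rightarrow> ('p, 'n::finite) chart \<Rightarrow> real^'n \<Rightarrow> real^'n^'n" where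
  "inv_metric f c x = matrix_inv (metric f c x)"

text \<open>Tangent vectors of the submanifold are represented by their images in Minkowski space under
  the differential of the immersion; there the induced metric is the Lorentz form.\<close>

definition tangent_space ::
  "('p, 'n::finite) chart set \<Rightarrow> ('p \<Rightarrow> 'h::euclidean_space \<times> real) \<Rightarrow> 'p \<Rightarrow> ('h \<times> real) set" where
  "tangent_space \<A> f p =
     (let c = chart_at \<A> p in range (frechet_derivative (param f c) (at (snd c p))))"

definition volume_measure ::
  "('p::{t2_space,second_countable_topology}, 'n::finite) chart set \<Rightarrow>
   ('p \<Rightarrow> 'h::euclidean_space \<times> real) \<Rightarrow> 'p measure" where
  "volume_measure \<A> f =
     (THE \<mu>. sets \<mu> = sets borel \<and>
        (\<forall>c\<in>\<A>. \<forall>B\<in>sets borel. B \<subseteq> fst c \<longrightarrow>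
           emeasure \<mu> B = (\<integral>\<^sup>+x\<in>snd c ` B. ennreal (sqrt (det (metric f c x))) \<partial>lborel)))"


subsection \<open>Completeness\<close>

definition piecewise_C1_curve ::
  "('p::topological_space, 'n::finite) chart set \<Rightarrow> (real \<Rightarrow> 'p) \<Rightarrow> bool" where
  "piecewise_C1_curve \<A> \<gamma> \<longleftrightarrow>
     continuous_on {0..1} \<gamma> \<and>
     (\<exists>S. finite S \<and>
        (\<forall>c\<in>\<A>. (snd c \<circ> \<gamma>) C1_differentiable_on (({0<..<1} - S) \<inter> \<gamma> -` fst c)))"

definition curve_length :: "('p \<Rightarrow> 'h::euclidean_space \<times> real) \<Rightarrow> (real \<Rightarrow> 'p) \<Rightarrow> ennreal" where
  "curve_length f \<gamma> =
     (\<integral>\<^sup>+t\<in>{0..1}. ennreal (sqrt (lorentz (vector_derivative (f \<circ> \<gamma>) (at t))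
                                        (vector_derivative (f \<circ> \<gamma>) (at t)))) \<partial>lborel)"

text \<open>Points in different components have distance \<open>\<infinity>\<close>.\<close>

definition riemannian_dist ::
  "('p::topological_space, 'n::finite) chart set \<Rightarrow> ('p \<Rightarrow> 'h::euclidean_space \<times> real) \<Rightarrow>
   'p \<Rightarrow> 'p \<Rightarrow> ennreal" where
  "riemannian_dist \<A> f p q =
     (INF \<gamma>\<in>{\<gamma>. piecewise_C1_curve \<A> \<gamma> \<and> \<gamma> 0 = p \<and> \<gamma> 1 = q}. curve_length f \<gamma>)"

definition complete_submanifold ::
  "('p::topological_space, 'n::finite) chart set \<Rightarrow> ('p \<Rightarrow> 'h::euclidean_space \<times> real) \<Rightarrow> bool" where
  "complete_submanifold \<A> f \<longleftrightarrow>
     (\<forall>s :: nat \<Rightarrow> 'p.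
        (\<forall>e>0. \<exists>N. \<forall>j\<ge>N. \<forall>k\<ge>N. riemannian_dist \<A> f (s j) (s k) < ennreal e) \<longrightarrow>
        (\<exists>p. (\<lambda>k. riemannian_dist \<A> f (s k) p) \<longlonglongrightarrow> 0))"


subsection \<open>Second fundamental form\<close>

text \<open>Orthogonal projection onto the complement of the tangent space of the submanifold.\<close>

definition normal_part ::
  "('p \<Rightarrow> 'h::euclidean_space \<times> real) \<Rightarrow> ('p, 'n::finite) chart \<Rightarrow> real^'n \<Rightarrow>
   'h \<times> real \<Rightarrow> 'h \<times> real" where
  "normal_part f c x w =
     w - (\<Sum>k\<in>UNIV. \<Sum>l\<in>UNIV.
            (inv_metric f c x $ k $ l * lorentz w (partial k (param f c) x)) *\<^sub>R partial l (param f c) x)"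

definition second_fundamental_form ::
  "('p \<Rightarrow> 'h::euclidean_space \<times> real) \<Rightarrow> ('p, 'n::finite) chart \<Rightarrow> real^'n \<Rightarrow>
   'n \<Rightarrow> 'n \<Rightarrow> 'h \<times> real" where
  "second_fundamental_form f c x i j =
     normal_part f c x (hyp_proj (param f c x) (partial i (partial j (param f c)) x))"

definition mean_curvature ::
  "('p, 'n::finite) chart set \<Rightarrow> ('p \<Rightarrow> 'h::euclidean_space \<times> real) \<Rightarrow> 'p \<Rightarrow> 'h \<times> real" where
  "mean_curvature \<A> f p =
     (let c = chart_at \<A> p; x = snd c p in
        (1 / real CARD('n)) *\<^sub>R
          (\<Sum>i\<in>UNIV. \<Sum>j\<in>UNIV. inv_metric f c x $ i $ j *\<^sub>R second_fundamental_form f c x i j))"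

definition sff_norm_sq ::
  "('p, 'n::finite) chart set \<Rightarrow> ('p \<Rightarrow> 'h::euclidean_space \<times> real) \<Rightarrow> 'p \<Rightarrow> real" where
  "sff_norm_sq \<A> f p =
     (let c = chart_at \<A> p; x = snd c p in
        \<Sum>i\<in>UNIV. \<Sum>j\<in>UNIV. \<Sum>k\<in>UNIV. \<Sum>l\<in>UNIV.
          inv_metric f c x $ i $ k * inv_metric f c x $ j $ l *
          lorentz (second_fundamental_form f c x i j) (second_fundamental_form f c x k l))"

definition minimal_submanifold ::
  "('p::{t2_space,second_countable_topology}, 'n::finite) chart set \<Rightarrow>
   ('p \<Rightarrow> 'h::euclidean_space \<times> real) \<Rightarrow> bool" where
  "minimal_submanifold \<A> f \<longleftrightarrow> immersed_submanifold \<A> f \<and> (\<forall>p. mean_curvature \<A> f p = 0)"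


subsection \<open>Sobolev spaces\<close>

definition gradient ::
  "('p, 'n::finite) chart set \<Rightarrow> ('p \<Rightarrow> 'h::euclidean_space \<times> real) \<Rightarrow> ('p \<Rightarrow> real) \<Rightarrow>
   'p \<Rightarrow> 'h \<times> real" where
  "gradient \<A> f u p =
     (let c = chart_at \<A> p; x = snd c p in
        \<Sum>i\<in>UNIV. \<Sum>j\<in>UNIV.
          (inv_metric f c x $ i $ j * partial i (u \<circ> chart_inv c) x) *\<^sub>R partial j (param f c) x)"

text \<open>\<open>X\<close> is the weak gradient of \<open>\<phi>\<close> if, in each chart, the components \<open>\<langle>X, \<partial>\<^sub>i\<rangle>\<close> of the dual
  1-form are the weak partial derivatives of \<open>\<phi>\<close>. This is for \<open>\<phi>\<close> and \<open>X\<close> in \<open>L\<^sup>2\<close>, so that all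
  integrals exist.\<close>

definition has_weak_gradient ::
  "('p::topological_space, 'n::finite) chart set \<Rightarrow> ('p \<Rightarrow> 'h::euclidean_space \<times> real) \<Rightarrow>
   ('p \<Rightarrow> real) \<Rightarrow> ('p \<Rightarrow> 'h \<times> real) \<Rightarrow> bool" where
  "has_weak_gradient \<A> f \<phi> X \<longleftrightarrow>
     (\<forall>p. X p \<in> tangent_space \<A> f p) \<and>
     (\<forall>c\<in>\<A>. \<forall>\<eta> :: real^'n \<Rightarrow> real. \<forall>i.
        smooth_on UNIV \<eta> \<and> compactly_supported \<eta> \<and> closure {x. \<eta> x \<noteq> 0} \<subseteq> chart_image c \<longrightarrow>
        (LINT x:chart_image c|lborel. \<phi> (chart_inv c x) * partial i \<eta> x) =
        - (LINT x:chart_image c|lborel.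
             lorentz (X (chart_inv c x)) (partial i (param f c) x) * \<eta> x))"

text \<open>An element of \<open>W\<^sup>1\<^sup>,\<^sup>2\<close> is given as a function together with its weak gradient, which is
  unique up to null sets.\<close>

definition W12 ::
  "('p::{t2_space,second_countable_topology}, 'n::finite) chart set \<Rightarrow>
   ('p \<Rightarrow> 'h::euclidean_space \<times> real) \<Rightarrow> (('p \<Rightarrow> real) \<times> ('p \<Rightarrow> 'h \<times> real)) set" where
  "W12 \<A> f = {(\<phi>, X).
     \<phi> \<in> borel_measurable borel \<and> X \<in> borel_measurable borel \<and>
     has_weak_gradient \<A> f \<phi> X \<and>
     integrable (volume_measure \<A> f) (\<lambda>p. (\<phi> p)\<^sup>2) \<and>
     integrable (volume_measure \<A> f) (\<lambda>p. lorentz (X p) (X p))}"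

definition W12_0 ::
  "('p::{t2_space,second_countable_topology}, 'n::finite) chart set \<Rightarrow>
   ('p \<Rightarrow> 'h::euclidean_space \<times> real) \<Rightarrow> (('p \<Rightarrow> real) \<times> ('p \<Rightarrow> 'h \<times> real)) set" where
  "W12_0 \<A> f = {(\<phi>, X) \<in> W12 \<A> f.
     \<exists>u :: nat \<Rightarrow> 'p \<Rightarrow> real.
       (\<forall>k. smooth_function \<A> (u k) \<and> compactly_supported (u k)) \<and>
       (\<lambda>k. \<integral>\<^sup>+p. ennreal ((u k p - \<phi> p)\<^sup>2 +
              lorentz (gradient \<A> f (u k) p - X p) (gradient \<A> f (u k) p - X p))
            \<partial>volume_measure \<A> f) \<longlonglongrightarrow> 0}"


subsection \<open>Super stability\<close>

text \<open>The positive part of the integrand is integrable for \<open>\<phi>\<close> in \<open>W\<^sup>1\<^sup>,\<^sup>2\<close>, so the integral always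
  exists in the extended sense; it fails to be integrable exactly if the integral is \<open>-\<infinity>\<close>. As
  \<open>integral\<^sup>L\<close> is 0 in that case, integrability has to be required for the inequality to mean
  what it says.\<close>

definition super_stable ::
  "('p::{t2_space,second_countable_topology}, 'n::finite) chart set \<Rightarrow>
   ('p \<Rightarrow> 'h::euclidean_space \<times> real) \<Rightarrow> bool" where
  "super_stable \<A> f \<longleftrightarrow>
     (\<forall>(\<phi>, X)\<in>W12_0 \<A> f.
        let q = (\<lambda>p. lorentz (X p) (X p) - (sff_norm_sq \<A> f p - real CARD('n)) * (\<phi> p)\<^sup>2) in
        integrable (volume_measure \<A> f) q \<and> (LINT p|volume_measure \<A> f. q p) \<ge> 0)"

end

theory Submission
  imports Defs
begin

text \<open>
  Since \<open>(n + 1)\<^sup>2 / 4 - n = ((n - 1) / 2)\<^sup>2\<close>, the claim follows once every minimal submanifold of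
  hyperbolic space satisfies the spectral gap
  \<open>\<integral> |\<nabla>\<phi>|\<^sup>2 \<ge> a\<^sup>2 \<integral> \<phi>\<^sup>2\<close> with \<open>a = (n - 1) / 2\<close> (lemma \<open>spectral_gap\<close>).

  The gap comes from the height function \<open>b = snd \<circ> f\<close>, the time coordinate in Minkowski space. The
  coordinates of a minimal immersion into the hyperboloid are eigenfunctions of the Laplacian, so
  \<open>\<Delta> b = n b\<close> (\<open>laplacian_height\<close>), while \<open>|\<nabla>b|\<^sup>2 \<le> b\<^sup>2\<close> (\<open>gradient_height_le\<close>). Hence
  \<open>b\<close> to the power \<open>- a\<close> is a positive supersolution of \<open>\<Delta> w + a\<^sup>2 w = 0\<close>, and the usual argument of Barta
  applies: for compactly supported \<open>u\<close>, the divergence of \<open>(u\<^sup>2 / b) \<nabla>b\<close> has integral zero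
  (\<open>integral_height_divergence\<close>), and adding \<open>a\<close> times it to \<open>|\<nabla>u|\<^sup>2 - a\<^sup>2 u\<^sup>2\<close> makes this integrand
  nonnegative at every point (\<open>gradient_gap_pointwise\<close>). The general case follows by approximation
  in \<open>W\<^sup>1\<^sup>,\<^sup>2\<close>.

  Two foundations carry most of the weight. First, the geometric quantities are defined through a chart
  chosen separately at each point, so nothing can be integrated or differentiated before they
  are known not to depend on the chart. This is read off from a chart-independent Parseval frame
  of each tangent space, the tangential parts of an orthonormal basis of the tangent space of
  hyperbolic space at that point (\<open>frame_change_chart\<close>): the gradient, the
  mean curvature and \<open>|A|\<^sup>2\<close> are sums over that frame. Second,
  the volume measure is given by a definite description; that it exists is the change of variables
  formula on overlaps of charts (\<open>exists_volume_measure\<close>). The divergence theorem reduces by a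
  partition of unity (\<open>C1_function_decomposition\<close>) to single charts, where it says that derivatives of
  compactly supported functions have integral zero (\<open>integral_derivative_eq_0\<close>).
\<close>

section \<open>Continuously differentiable maps\<close>

abbreviation C1_on :: "'a::real_normed_vector set \<Rightarrow> ('a \<Rightarrow> 'b::real_normed_vector) \<Rightarrow> bool" where
  "C1_on \<equiv> Ck_on (Suc 0)"

lemma C1_onI:
  assumes "\<And>x. x \<in> S \<Longrightarrow> (h has_derivative D x) (at x)"
    and "\<And>v. continuous_on S (\<lambda>x. D x v)"
  shows "C1_on S h"
proof -
  have "continuous_on S (\<lambda>x. frechet_derivative h (at x) v)" for v
    using assms(2)[of v] by (rule continuous_on_eq) (metis assms(1) frechet_derivative_at)
  then show ?thesis
    using assms(1) by (auto simp: differentiable_def)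
qed

lemma C1_on_has_derivative:
  assumes "C1_on S h" "x \<in> S"
  shows "(h has_derivative frechet_derivative h (at x)) (at x)"
  using assms frechet_derivative_works by auto

lemma C1_on_continuous_derivative:
  "C1_on S h \<Longrightarrow> continuous_on S (\<lambda>x. frechet_derivative h (at x) v)"
  by simp

lemma C1_on_imp_continuous_on: "C1_on S h \<Longrightarrow> continuous_on S h"
  by (auto intro!: continuous_at_imp_continuous_on differentiable_imp_continuous_within)

lemma C1_on_subset: "C1_on S h \<Longrightarrow> T \<subseteq> S \<Longrightarrow> C1_on T h"
  by (auto intro: continuous_on_subset)

lemma frechet_derivative_eq_on_open:
  assumes "open S" "x \<in> S" "\<And>y. y \<in> S \<Longrightarrow> h y = k y"
  shows "frechet_derivative h (at x) = frechet_derivative k (at x)"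
proof -
  have "(h has_derivative D) (at x) \<longleftrightarrow> (k has_derivative D) (at x)" for D
    using has_derivative_transform_within_open[OF _ assms(1,2), of h D UNIV k]
      has_derivative_transform_within_open[OF _ assms(1,2), of k D UNIV h] assms(3)
    by auto
  then show ?thesis by (simp add: frechet_derivative_def)
qed

lemma C1_on_cong:
  assumes "C1_on S h" "open S" "\<And>y. y \<in> S \<Longrightarrow> h y = k y"
  shows "C1_on S k"
proof (rule C1_onI)
  show "(k has_derivative frechet_derivative h (at x)) (at x)" if "x \<in> S" for x
    using has_derivative_transform_within_open[OF C1_on_has_derivative[OF assms(1) that] assms(2) that]
      assms(3) by auto
qed (rule C1_on_continuous_derivative[OF assms(1)])

lemma C1_on_Un:
  assumes "C1_on S h" "C1_on T h" "open S" "open T"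
  shows "C1_on (S \<union> T) h"
  using assms by (auto intro: continuous_on_open_Un)

lemma C1_on_const: "C1_on S (\<lambda>x. c)"
  by (rule C1_onI[where D="\<lambda>x v. 0"]) auto

lemma C1_on_bounded_linear:
  assumes "bounded_linear L" "C1_on S h"
  shows "C1_on S (\<lambda>x. L (h x))"
proof (rule C1_onI)
  show "((\<lambda>x. L (h x)) has_derivative (\<lambda>v. L (frechet_derivative h (at x) v))) (at x)"
    if "x \<in> S" for x
    using bounded_linear.has_derivative[OF assms(1) C1_on_has_derivative[OF assms(2) that]] .
  show "continuous_on S (\<lambda>x. L (frechet_derivative h (at x) v))" for v
    using bounded_linear.continuous_on[OF assms(1) C1_on_continuous_derivative[OF assms(2)]] .
qed

lemma (in bounded_bilinear) C1_on_product:
  assumes "C1_on S h" "C1_on S k"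
  shows "C1_on S (\<lambda>x. prod (h x) (k x))"
proof (rule C1_onI)
  show "((\<lambda>x. prod (h x) (k x)) has_derivative
          (\<lambda>v. prod (h x) (frechet_derivative k (at x) v) + prod (frechet_derivative h (at x) v) (k x))) (at x)"
    if "x \<in> S" for x
    using FDERIV[OF C1_on_has_derivative[OF assms(1) that] C1_on_has_derivative[OF assms(2) that]] .
  show "continuous_on S (\<lambda>x. prod (h x) (frechet_derivative k (at x) v)
          + prod (frechet_derivative h (at x) v) (k x))" for v
    using assms by (intro continuous_on_add continuous_on C1_on_imp_continuous_on
        C1_on_continuous_derivative)
qed

lemmas C1_on_mult = bounded_bilinear.C1_on_product[OF bounded_bilinear_mult]
lemmas C1_on_scaleR = bounded_bilinear.C1_on_product[OF bounded_bilinear_scaleR]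

lemma C1_on_add:
  assumes "C1_on S h" "C1_on S k"
  shows "C1_on S (\<lambda>x. h x + k x)"
  by (rule C1_onI[where D="\<lambda>x v. frechet_derivative h (at x) v + frechet_derivative k (at x) v"])
    (use assms in \<open>auto intro!: has_derivative_add continuous_on_add C1_on_has_derivative\<close>)

lemma C1_on_sum:
  "(\<And>i. i \<in> I \<Longrightarrow> C1_on S (h i)) \<Longrightarrow> C1_on S (\<lambda>x. \<Sum>i\<in>I. h i x)"
proof (induction I rule: infinite_finite_induct)
  case (insert i I)
  then show ?case using C1_on_add[of S "h i" "\<lambda>x. \<Sum>i\<in>I. h i x"] by auto
qed (use C1_on_const[of S 0] in auto)

lemma C1_on_prod:
  fixes h :: "'i \<Rightarrow> 'a::real_normed_vector \<Rightarrow> real"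
  shows "(\<And>i. i \<in> I \<Longrightarrow> C1_on S (h i)) \<Longrightarrow> C1_on S (\<lambda>x. \<Prod>i\<in>I. h i x)"
proof (induction I rule: infinite_finite_induct)
  case (insert i I)
  then show ?case using C1_on_mult[of S "h i" "\<lambda>x. \<Prod>i\<in>I. h i x"] by auto
qed (use C1_on_const[of S 1] in auto)

lemma C1_on_real_compose:
  fixes h :: "'a::real_normed_vector \<Rightarrow> real" and k :: "real \<Rightarrow> real"
  assumes "C1_on S h" "\<And>x. x \<in> S \<Longrightarrow> (k has_real_derivative k' (h x)) (at (h x))"
    and "continuous_on (h ` S) k'"
  shows "C1_on S (\<lambda>x. k (h x))"
proof (rule C1_onI)
  show "((\<lambda>x. k (h x)) has_derivative (\<lambda>v. k' (h x) * frechet_derivative h (at x) v)) (at x)"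
    if "x \<in> S" for x
    using has_derivative_compose[OF C1_on_has_derivative[OF assms(1) that]
        assms(2)[OF that, unfolded has_field_derivative_def]] by simp
  show "continuous_on S (\<lambda>x. k' (h x) * frechet_derivative h (at x) v)" for v
    using assms(1) by (intro continuous_on_mult C1_on_continuous_derivative
        continuous_on_compose2[OF assms(3)] C1_on_imp_continuous_on) auto
qed

lemma C1_on_divide:
  fixes h k :: "'a::real_normed_vector \<Rightarrow> real"
  assumes "C1_on S h" "C1_on S k" "\<And>x. x \<in> S \<Longrightarrow> k x \<noteq> 0"
  shows "C1_on S (\<lambda>x. h x / k x)"
proof -
  have "C1_on S (\<lambda>x. inverse (k x))"
    by (rule C1_on_real_compose[OF assms(2), where k'="\<lambda>t. - (inverse t ^ 2)"])
      (use assms(3) in \<open>auto intro!: derivative_eq_intros continuous_intros simp: power2_eq_square\<close>)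
  then show ?thesis
    unfolding divide_inverse by (rule C1_on_mult[OF assms(1)])
qed

lemma C1_on_sqrt:
  fixes h :: "'a::real_normed_vector \<Rightarrow> real"
  assumes "C1_on S h" "\<And>x. x \<in> S \<Longrightarrow> h x > 0"
  shows "C1_on S (\<lambda>x. sqrt (h x))"
proof (rule C1_on_real_compose[OF assms(1), where k'="\<lambda>t. inverse (sqrt t) / 2"])
  show "(sqrt has_real_derivative inverse (sqrt (h x)) / 2) (at (h x))" if "x \<in> S" for x
    using DERIV_real_sqrt[OF assms(2)[OF that]] .
  show "continuous_on (h ` S) (\<lambda>t. inverse (sqrt t) / 2)"
    using assms(2) by (intro continuous_intros) force+
qed

lemma C1_on_compose:
  fixes k :: "'b::euclidean_space \<Rightarrow> 'c::real_normed_vector"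
  assumes "C1_on S h" "C1_on T k" "h ` S \<subseteq> T"
  shows "C1_on S (k \<circ> h)"
proof (rule C1_onI)
  let ?D = "\<lambda>x v. \<Sum>b\<in>Basis. (frechet_derivative h (at x) v \<bullet> b) *\<^sub>R frechet_derivative k (at (h x)) b"
  show "(k \<circ> h has_derivative ?D x) (at x)" if "x \<in> S" for x
  proof -
    have k: "(k has_derivative frechet_derivative k (at (h x))) (at (h x))"
      using assms that by (intro C1_on_has_derivative[OF assms(2)]) auto
    interpret linear "frechet_derivative k (at (h x))"
      using has_derivative_linear[OF k] .
    have expand: "frechet_derivative k (at (h x)) y = (\<Sum>b\<in>Basis. (y \<bullet> b) *\<^sub>R frechet_derivative k (at (h x)) b)" for y
      by (metis (no_types, lifting) euclidean_representation scale sum sum.cong)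
    have "frechet_derivative k (at (h x)) \<circ> frechet_derivative h (at x) = ?D x"
      by (rule ext, unfold o_apply, rule expand)
    then show ?thesis
      using diff_chain_at[OF C1_on_has_derivative[OF assms(1) that] k] by simp
  qed
  show "continuous_on S (\<lambda>x. ?D x v)" for v
    by (intro continuous_on_sum continuous_on_scaleR continuous_on_inner continuous_on_const
        C1_on_continuous_derivative[OF assms(1)] continuous_on_compose2[OF C1_on_continuous_derivative[OF assms(2)]]
        C1_on_imp_continuous_on[OF assms(1)] assms(3))
qed

lemma C1_on_fst: "C1_on S h \<Longrightarrow> C1_on S (\<lambda>x. fst (h x))"
  by (rule C1_on_bounded_linear[OF bounded_linear_fst])

lemma C1_on_snd: "C1_on S h \<Longrightarrow> C1_on S (\<lambda>x. snd (h x))"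
  by (rule C1_on_bounded_linear[OF bounded_linear_snd])

lemma smooth_on_imp_C1_on: "smooth_on S h \<Longrightarrow> C1_on S h"
  unfolding smooth_on_def by blast

lemma smooth_on_derivative:
  assumes "smooth_on S h"
  shows "smooth_on S (\<lambda>x. frechet_derivative h (at x) v)"
  using assms unfolding smooth_on_def by (metis Ck_on.simps(2))

text \<open>Both mixed second derivatives are limits of the same second difference quotient
  \<open>(h (x + s v + s w) - h (x + s v) - h (x + s w) + h x) / s\<^sup>2\<close>, which two applications of the
  mean value theorem evaluate in either order.\<close>

lemma second_difference_mean_value:
  fixes h :: "'a::real_normed_vector \<Rightarrow> real"
  assumes S: "\<And>s t. s \<in> {0..r} \<Longrightarrow> t \<in> {0..r} \<Longrightarrow> x + s *\<^sub>R v + t *\<^sub>R w \<in> S"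
    and h: "C1_on S h" "C1_on S (\<lambda>y. frechet_derivative h (at y) v)" and "r > 0"
  shows "\<exists>s\<in>{0..r}. \<exists>t\<in>{0..r}. h (x + r *\<^sub>R v + r *\<^sub>R w) - h (x + r *\<^sub>R v) - h (x + r *\<^sub>R w) + h x
           = r\<^sup>2 * frechet_derivative (\<lambda>y. frechet_derivative h (at y) v) (at (x + s *\<^sub>R v + t *\<^sub>R w)) w"
proof -
  let ?D = "\<lambda>y. frechet_derivative h (at y)"
  let ?D2 = "\<lambda>y. frechet_derivative (\<lambda>y. frechet_derivative h (at y) v) (at y)"
  have lin: "linear (?D y)" if "y \<in> S" for y
    using has_derivative_linear[OF C1_on_has_derivative[OF h(1) that]] .
  have lin2: "linear (?D2 y)" if "y \<in> S" for y
    using has_derivative_linear[OF C1_on_has_derivative[OF h(2) that]] .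
  have "((\<lambda>s. h (x + s *\<^sub>R v + r *\<^sub>R w) - h (x + s *\<^sub>R v)) has_real_derivative
          (?D (x + s *\<^sub>R v + r *\<^sub>R w) v - ?D (x + s *\<^sub>R v) v)) (at s)" if "s \<in> {0..r}" for s
  proof -
    have in_S: "x + s *\<^sub>R v + r *\<^sub>R w \<in> S" "x + s *\<^sub>R v \<in> S"
      using S[OF that, of r] S[OF that, of 0] \<open>r > 0\<close> by auto
    have 1: "((\<lambda>s. h (x + s *\<^sub>R v + r *\<^sub>R w)) has_derivative (\<lambda>k. ?D (x + s *\<^sub>R v + r *\<^sub>R w) (k *\<^sub>R v))) (at s)"
      by (rule has_derivative_compose[where f="\<lambda>s. x + s *\<^sub>R v + r *\<^sub>R w" and g=h, OF _ C1_on_has_derivative[OF h(1) in_S(1)]])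
        (auto intro!: derivative_eq_intros)
    have 2: "((\<lambda>s. h (x + s *\<^sub>R v)) has_derivative (\<lambda>k. ?D (x + s *\<^sub>R v) (k *\<^sub>R v))) (at s)"
      by (rule has_derivative_compose[where f="\<lambda>s. x + s *\<^sub>R v" and g=h, OF _ C1_on_has_derivative[OF h(1) in_S(2)]])
        (auto intro!: derivative_eq_intros)
    show ?thesis
      unfolding has_field_derivative_def
      by (rule has_derivative_eq_rhs[OF has_derivative_diff[OF 1 2]])
        (simp add: linear_scale[OF lin[OF in_S(1)]] linear_scale[OF lin[OF in_S(2)]] fun_eq_iff
          right_diff_distrib mult.commute)
  qed
  then have "\<exists>s. 0 < s \<and> s < r \<and>
      (h (x + r *\<^sub>R v + r *\<^sub>R w) - h (x + r *\<^sub>R v)) - (h (x + 0 *\<^sub>R v + r *\<^sub>R w) - h (x + 0 *\<^sub>R v))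
      = (r - 0) * (?D (x + s *\<^sub>R v + r *\<^sub>R w) v - ?D (x + s *\<^sub>R v) v)"
    using \<open>r > 0\<close> by (intro MVT2) auto
  then obtain s where s: "0 < s" "s < r"
      "h (x + r *\<^sub>R v + r *\<^sub>R w) - h (x + r *\<^sub>R v) - h (x + r *\<^sub>R w) + h x
      = r * (?D (x + s *\<^sub>R v + r *\<^sub>R w) v - ?D (x + s *\<^sub>R v) v)"
    by auto
  have "((\<lambda>t. ?D (x + s *\<^sub>R v + t *\<^sub>R w) v) has_real_derivative ?D2 (x + s *\<^sub>R v + t *\<^sub>R w) w) (at t)"
    if "t \<in> {0..r}" for t
  proof -
    have in_S: "x + s *\<^sub>R v + t *\<^sub>R w \<in> S" using S s that by auto
    have "((\<lambda>t. ?D (x + s *\<^sub>R v + t *\<^sub>R w) v) has_derivative (\<lambda>k. ?D2 (x + s *\<^sub>R v + t *\<^sub>R w) (k *\<^sub>R w))) (at t)"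
      by (rule has_derivative_compose[where f="\<lambda>t. x + s *\<^sub>R v + t *\<^sub>R w" and g="\<lambda>y. ?D y v", OF _ C1_on_has_derivative[OF h(2) in_S]])
        (auto intro!: derivative_eq_intros)
    then show ?thesis
      unfolding has_field_derivative_def
      by (rule has_derivative_eq_rhs) (simp add: linear_scale[OF lin2[OF in_S]] fun_eq_iff mult.commute)
  qed
  then have "\<exists>t. 0 < t \<and> t < r \<and> ?D (x + s *\<^sub>R v + r *\<^sub>R w) v - ?D (x + s *\<^sub>R v + 0 *\<^sub>R w) v
      = (r - 0) * ?D2 (x + s *\<^sub>R v + t *\<^sub>R w) w"
    using \<open>r > 0\<close> by (intro MVT2) auto
  then obtain t where "0 < t" "t < r"
      "?D (x + s *\<^sub>R v + r *\<^sub>R w) v - ?D (x + s *\<^sub>R v) v = r * ?D2 (x + s *\<^sub>R v + t *\<^sub>R w) w"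
    by auto
  with s show ?thesis
    by (intro bexI[of _ s] bexI[of _ t]) (auto simp: power2_eq_square)
qed

lemma mixed_derivatives_commute_real:
  fixes h :: "'a::real_normed_vector \<Rightarrow> real"
  assumes "open S" "x \<in> S" "C1_on S h" "\<And>v. C1_on S (\<lambda>y. frechet_derivative h (at y) v)"
  shows "frechet_derivative (\<lambda>y. frechet_derivative h (at y) v) (at x) w
       = frechet_derivative (\<lambda>y. frechet_derivative h (at y) w) (at x) v"
proof -
  let ?D2 = "\<lambda>v w y. frechet_derivative (\<lambda>y. frechet_derivative h (at y) v) (at y) w"
  have near: "\<exists>d>0. \<forall>s\<in>{0..d}. \<forall>t\<in>{0..d}. x + s *\<^sub>R v + t *\<^sub>R w \<in> T" if T: "open T" "x \<in> T" for T
  proof -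
    obtain e where e: "e > 0" "ball x e \<subseteq> T" using T by (meson open_contains_ball)
    define N where "N = norm v + norm w + 1"
    have "N > 0" unfolding N_def by (smt (verit) norm_ge_zero)
    define d where "d = e / 2 / N"
    have d: "d > 0" "d * N < e"
      using e \<open>N > 0\<close> by (auto simp: d_def)
    have "x + s *\<^sub>R v + t *\<^sub>R w \<in> ball x e" if "s \<in> {0..d}" "t \<in> {0..d}" for s t
    proof -
      have "norm (s *\<^sub>R v + t *\<^sub>R w) \<le> s * norm v + t * norm w"
        using norm_triangle_ineq[of "s *\<^sub>R v" "t *\<^sub>R w"] that by simp
      also have "\<dots> \<le> d * norm v + d * norm w"
        using that by (intro add_mono mult_right_mono) auto
      also have "\<dots> < e" using d by (simp add: N_def algebra_simps)
      finally show ?thesis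
        by (metis add.assoc add_diff_cancel_left' dist_commute dist_norm mem_ball)
    qed
    with d e show ?thesis by blast
  qed
  \<comment> \<open>if they differed at \<open>x\<close>, continuity would keep the two values apart near \<open>x\<close>\<close>
  have "\<bar>?D2 v w x - ?D2 w v x\<bar> \<le> e" if "e > 0" for e
  proof -
    have cont: "isCont (?D2 v w) x" "isCont (?D2 w v) x"
      using C1_on_continuous_derivative[OF assms(4)] assms(1,2) continuous_on_eq_continuous_at by blast+
    have "eventually (\<lambda>y. dist (k y) (k x) < e/2) (nhds x)" if "isCont k x" for k :: "'a \<Rightarrow> real"
      using tendstoD[of k "k x" "nhds x" "e/2"] that \<open>e > 0\<close>
      by (simp add: continuous_at tendsto_at_iff_tendsto_nhds)
    from eventually_conj[OF this[OF cont(1)] this[OF cont(2)]]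
    obtain T where T: "open T" "x \<in> T"
        "\<And>y. y \<in> T \<Longrightarrow> dist (?D2 v w y) (?D2 v w x) < e/2 \<and> dist (?D2 w v y) (?D2 w v x) < e/2"
      unfolding eventually_nhds by auto
    obtain d where d: "d > 0" "\<And>s t. s \<in> {0..d} \<Longrightarrow> t \<in> {0..d} \<Longrightarrow> x + s *\<^sub>R v + t *\<^sub>R w \<in> S \<inter> T"
      using near[of "S \<inter> T"] assms(1,2) T(1,2) by (metis IntI open_Int)
    obtain s t where st: "s \<in> {0..d}" "t \<in> {0..d}"
        "h (x + d *\<^sub>R v + d *\<^sub>R w) - h (x + d *\<^sub>R v) - h (x + d *\<^sub>R w) + h x = d\<^sup>2 * ?D2 v w (x + s *\<^sub>R v + t *\<^sub>R w)"
      using second_difference_mean_value[of d x v w S h] assms(3,4) d by blast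
    have "x + s *\<^sub>R w + t *\<^sub>R v \<in> S" if "s \<in> {0..d}" "t \<in> {0..d}" for s t
      using d(2)[OF that(2,1)] by (simp add: algebra_simps)
    then obtain s' t' where st': "s' \<in> {0..d}" "t' \<in> {0..d}"
        "h (x + d *\<^sub>R w + d *\<^sub>R v) - h (x + d *\<^sub>R w) - h (x + d *\<^sub>R v) + h x = d\<^sup>2 * ?D2 w v (x + s' *\<^sub>R w + t' *\<^sub>R v)"
      using second_difference_mean_value[of d x w v S h] assms(3,4) d(1) by blast
    have "d\<^sup>2 * ?D2 v w (x + s *\<^sub>R v + t *\<^sub>R w) = d\<^sup>2 * ?D2 w v (x + s' *\<^sub>R w + t' *\<^sub>R v)"
      unfolding st(3)[symmetric] st'(3)[symmetric] by (simp add: algebra_simps)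
    then have eq: "?D2 v w (x + s *\<^sub>R v + t *\<^sub>R w) = ?D2 w v (x + s' *\<^sub>R w + t' *\<^sub>R v)"
      using d(1) by simp
    have "x + s *\<^sub>R v + t *\<^sub>R w \<in> T" "x + s' *\<^sub>R w + t' *\<^sub>R v \<in> T"
      using d(2)[OF st(1,2)] d(2)[OF st'(2,1)] by (auto simp: algebra_simps)
    then show ?thesis using T(3) eq by (smt (verit) dist_real_def field_sum_of_halves)
  qed
  then show ?thesis by (metis abs_le_zero_iff eq_iff_diff_eq_0 field_le_epsilon add_0)
qed

lemma mixed_derivatives_commute:
  fixes h :: "'a::real_normed_vector \<Rightarrow> 'b::real_inner"
  assumes "open S" "x \<in> S" "C1_on S h" "\<And>v. C1_on S (\<lambda>y. frechet_derivative h (at y) v)"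
  shows "frechet_derivative (\<lambda>y. frechet_derivative h (at y) v) (at x) w
       = frechet_derivative (\<lambda>y. frechet_derivative h (at y) w) (at x) v"
proof (rule vector_eq_ldot[THEN iffD1], intro allI)
  fix z :: 'b
  have L: "bounded_linear (\<lambda>b. z \<bullet> b)" by (rule bounded_linear_inner_right)
  have inner_deriv: "frechet_derivative (\<lambda>x. z \<bullet> k x) (at y) u = z \<bullet> frechet_derivative k (at y) u"
    if "y \<in> S" "C1_on S k" for y u and k :: "'a \<Rightarrow> 'b"
    using frechet_derivative_at[OF bounded_linear.has_derivative[OF L C1_on_has_derivative[OF that(2,1)]]]
    by metis
  have inner_second: "frechet_derivative (\<lambda>y. frechet_derivative (\<lambda>x. z \<bullet> h x) (at y) u) (at x) u'
      = z \<bullet> frechet_derivative (\<lambda>y. frechet_derivative h (at y) u) (at x) u'" for u u'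
    using frechet_derivative_eq_on_open[OF assms(1,2), of "\<lambda>y. frechet_derivative (\<lambda>x. z \<bullet> h x) (at y) u"
        "\<lambda>y. z \<bullet> frechet_derivative h (at y) u"] inner_deriv[OF _ assms(3)] inner_deriv[OF assms(2) assms(4)]
    by simp
  have "C1_on S (\<lambda>y. frechet_derivative (\<lambda>x. z \<bullet> h x) (at y) u)" for u
    by (rule C1_on_cong[OF C1_on_bounded_linear[OF L assms(4)[of u]] assms(1)])
      (rule inner_deriv[OF _ assms(3), symmetric])
  from mixed_derivatives_commute_real[OF assms(1,2) C1_on_bounded_linear[OF L assms(3)] this, of v w]
  show "z \<bullet> frechet_derivative (\<lambda>y. frechet_derivative h (at y) v) (at x) w
      = z \<bullet> frechet_derivative (\<lambda>y. frechet_derivative h (at y) w) (at x) v"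
    unfolding inner_second .
qed


text \<open>A compactly supported function has the same integral as its translates. Dominated convergence
  applied to the difference quotients \<open>(\<psi> (x + t v) - \<psi> x) / t\<close> then shows that its derivative
  in direction \<open>v\<close> has integral zero, without iterated integrals.\<close>

lemma integral_derivative_eq_0_UNIV:
  fixes \<psi> :: "'a::euclidean_space \<Rightarrow> real"
  assumes \<psi>: "C1_on UNIV \<psi>" and K: "compact K" "\<And>x. x \<notin> K \<Longrightarrow> \<psi> x = 0"
  shows "has_bochner_integral lborel (\<lambda>x. frechet_derivative \<psi> (at x) v) 0"
proof -
  define D where "D = (\<lambda>x. frechet_derivative \<psi> (at x) v)"
  define q where "q = (\<lambda>k x. (\<psi> ((1 / Suc k) *\<^sub>R v + x) - \<psi> x) / (1 / Suc k))"
  have cont: "continuous_on UNIV \<psi>" "continuous_on UNIV D"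
    unfolding D_def using C1_on_imp_continuous_on[OF \<psi>] C1_on_continuous_derivative[OF \<psi>] by auto
  have deriv: "(\<psi> has_derivative frechet_derivative \<psi> (at x)) (at x)" for x
    using C1_on_has_derivative[OF \<psi>] by simp
  have line: "((\<lambda>s. \<psi> (s *\<^sub>R v + x)) has_real_derivative D (s *\<^sub>R v + x)) (at s)" for s x
  proof -
    have "((\<lambda>s. \<psi> (s *\<^sub>R v + x)) has_derivative (\<lambda>k. frechet_derivative \<psi> (at (s *\<^sub>R v + x)) (k *\<^sub>R v))) (at s)"
      by (rule has_derivative_compose[where f="\<lambda>s. s *\<^sub>R v + x" and g=\<psi>, OF _ deriv])
        (auto intro!: derivative_eq_intros)
    then show ?thesis
      unfolding has_field_derivative_def D_def
      by (rule has_derivative_eq_rhs)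
        (simp add: linear_scale[OF has_derivative_linear[OF deriv]] fun_eq_iff mult.commute)
  qed
  have D_outside: "D x = 0" if "x \<notin> K" for x
    using frechet_derivative_eq_on_open[of "- K" x \<psi> "\<lambda>x. 0"] compact_imp_closed[OF K(1)] K(2) that
    by (simp add: D_def open_Compl)
  have "compact (D ` K)"
    using K(1) cont(2) by (intro compact_continuous_image continuous_on_subset[OF cont(2)]) auto
  then obtain M where M: "M > 0" "\<And>y. y \<in> D ` K \<Longrightarrow> norm y \<le> M"
    using compact_imp_bounded bounded_pos by metis
  have D_le: "\<bar>D x\<bar> \<le> M" for x
    using M D_outside by (cases "x \<in> K") auto
  obtain r where r: "\<And>x. x \<in> K \<Longrightarrow> norm x \<le> r"
    using compact_imp_bounded[OF K(1)] bounded_iff by metis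
  define K' where "K' = cball (0::'a) (r + norm v)"
  have q_le: "\<bar>q k x\<bar> \<le> M * indicator K' x" for k x
  proof (cases "x \<in> K'")
    case True
    have "\<exists>s. 0 < s \<and> s < 1 / Suc k \<and>
        \<psi> ((1 / Suc k) *\<^sub>R v + x) - \<psi> (0 *\<^sub>R v + x) = (1 / Suc k - 0) * D (s *\<^sub>R v + x)"
      using line by (intro MVT2) auto
    then obtain s where "q k x = D (s *\<^sub>R v + x)" unfolding q_def by auto
    then show ?thesis using True D_le by simp
  next
    case False
    have large: "norm x > r + norm v" using False by (simp add: K'_def)
    have "norm ((1 / Suc k) *\<^sub>R v) \<le> norm v"
      by (simp add: divide_le_eq mult_le_cancel_left1 mult.commute)
    then have "norm ((1 / Suc k) *\<^sub>R v + x) > r"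
      using large norm_diff_ineq[of x "(1 / Suc k) *\<^sub>R v"] by (simp add: add.commute)
    moreover have "norm x > r" using large by (smt (verit) norm_ge_zero)
    ultimately have "x \<notin> K" "(1 / Suc k) *\<^sub>R v + x \<notin> K" using r by fastforce+
    then show ?thesis using K(2) False by (simp add: q_def)
  qed
  have q_lim: "(\<lambda>k. q k x) \<longlonglongrightarrow> D x" for x
  proof -
    have "((\<lambda>s. (\<psi> (s *\<^sub>R v + x) - \<psi> (0 *\<^sub>R v + x)) / (s - 0)) \<longlongrightarrow> D (0 *\<^sub>R v + x)) (at 0)"
      using line[of x 0] unfolding has_field_derivative_iff .
    then have "(\<lambda>k. (\<psi> ((1 / Suc k) *\<^sub>R v + x) - \<psi> (0 *\<^sub>R v + x)) / (1 / Suc k - 0)) \<longlonglongrightarrow> D (0 *\<^sub>R v + x)"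
      by (rule filterlim_compose)
        (auto simp: filterlim_at LIMSEQ_Suc[OF lim_1_over_n] simp del: of_nat_Suc)
    then show ?thesis by (simp add: q_def)
  qed
  have int_\<psi>: "integrable lborel \<psi>"
  proof -
    have "integrable lborel (\<lambda>x. indicator K x *\<^sub>R \<psi> x)"
      using K(1) continuous_on_subset[OF cont(1)] by (intro borel_integrable_compact) auto
    moreover have "(\<lambda>x. indicator K x *\<^sub>R \<psi> x) = \<psi>"
      using K(2) by (auto simp: indicator_def fun_eq_iff)
    ultimately show ?thesis by simp
  qed
  have int_q: "(LINT x|lborel. q k x) = 0" for k
  proof -
    have m: "(+) c \<in> borel_measurable (lborel :: 'a measure)" for c by simp
    have shift: "integrable lborel (\<lambda>x. \<psi> (c + x))" "(LINT x|lborel. \<psi> (c + x)) = (LINT x|lborel. \<psi> x)" for c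
      using integrable_distr_eq[OF m, of \<psi> c] integral_distr[OF m, of \<psi> c] int_\<psi>
        borel_measurable_integrable[OF int_\<psi>] by (simp_all add: lborel_distr_plus)
    show ?thesis
      unfolding q_def using shift int_\<psi> by simp
  qed
  have meas: "D \<in> borel_measurable lborel" "q k \<in> borel_measurable lborel" for k
    unfolding q_def using borel_measurable_continuous_onI[OF cont(1)] borel_measurable_continuous_onI[OF cont(2)]
    by measurable
  have "emeasure lborel K' < \<infinity>"
    unfolding K'_def by (rule emeasure_bounded_finite) (rule bounded_cball)
  then have dom: "integrable lborel (\<lambda>x. M * indicator K' x)"
    by (intro integrable_mult_right integrable_real_indicator) (simp_all add: K'_def)
  have bound: "AE x in lborel. norm (q k x) \<le> M * indicator K' x" for k
    using q_le by simp
  have lim: "AE x in lborel. (\<lambda>k. q k x) \<longlonglongrightarrow> D x"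
    using q_lim by simp
  have "integrable lborel D"
    by (rule integrable_dominated_convergence[OF meas dom lim bound])
  moreover have "(\<lambda>k. LINT x|lborel. q k x) \<longlonglongrightarrow> (LINT x|lborel. D x)"
    by (rule integral_dominated_convergence[OF meas dom lim bound])
  then have "(LINT x|lborel. D x) = 0"
    by (simp add: int_q LIMSEQ_const_iff)
  ultimately show ?thesis
    by (simp add: has_bochner_integral_iff D_def)
qed

lemma integral_derivative_eq_0:
  fixes \<psi> :: "'a::euclidean_space \<Rightarrow> real"
  assumes "open U" and \<psi>: "C1_on U \<psi>" and K: "compact K" "K \<subseteq> U" "\<And>x. x \<in> U - K \<Longrightarrow> \<psi> x = 0"
  shows "has_bochner_integral lborel (\<lambda>x. indicator U x * frechet_derivative \<psi> (at x) v) 0"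
proof -
  define \<psi>' where "\<psi>' = (\<lambda>x. if x \<in> U then \<psi> x else 0)"
  have "C1_on (U \<union> - K) \<psi>'"
  proof (rule C1_on_Un)
    show "C1_on U \<psi>'" by (rule C1_on_cong[OF \<psi> \<open>open U\<close>]) (simp add: \<psi>'_def)
    show "C1_on (- K) \<psi>'"
      by (rule C1_on_cong[OF C1_on_const[of _ 0]]) (use K compact_imp_closed in \<open>auto simp: \<psi>'_def\<close>)
  qed (use assms compact_imp_closed in auto)
  moreover have "U \<union> - K = UNIV" using K by auto
  ultimately have int: "has_bochner_integral lborel (\<lambda>x. frechet_derivative \<psi>' (at x) v) 0"
    using K by (intro integral_derivative_eq_0_UNIV[OF _ K(1)]) (auto simp: \<psi>'_def)
  have "frechet_derivative \<psi>' (at x) v = indicator U x * frechet_derivative \<psi> (at x) v" for x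
  proof (cases "x \<in> U")
    case True
    then show ?thesis using frechet_derivative_eq_on_open[OF \<open>open U\<close> True, of \<psi>' \<psi>] by (simp add: \<psi>'_def)
  next
    case False
    then have "x \<in> - K" using K by auto
    moreover have "\<psi>' y = 0" if "y \<in> - K" for y using that K by (auto simp: \<psi>'_def)
    ultimately show ?thesis
      using frechet_derivative_eq_on_open[of "- K" x \<psi>' "\<lambda>x. 0"] compact_imp_closed[OF K(1)] False
      by (simp add: open_Compl)
  qed
  with int show ?thesis by simp
qed

section \<open>Determinants and inverses of matrix functions\<close>

lemma matrix_inv_mult:
  fixes A :: "real^'n^'n"
  assumes "det A \<noteq> 0"
  shows "matrix_inv A ** A = mat 1" "A ** matrix_inv A = mat 1"
proof -
  obtain B where "A ** B = mat 1 \<and> B ** A = mat 1"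
    using assms unfolding invertible_det_nz[symmetric] invertible_def by blast
  then have "A ** matrix_inv A = mat 1 \<and> matrix_inv A ** A = mat 1"
    unfolding matrix_inv_def by (rule someI)
  then show "matrix_inv A ** A = mat 1" "A ** matrix_inv A = mat 1" by auto
qed

lemma sum_matrix_inv_mult:
  fixes A :: "real^'n^'n"
  assumes "det A \<noteq> 0"
  shows "(\<Sum>j\<in>UNIV. matrix_inv A $ i $ j * A $ j $ k) = (if i = k then 1 else 0)"
    "(\<Sum>j\<in>UNIV. A $ i $ j * matrix_inv A $ j $ k) = (if i = k then 1 else 0)"
  using matrix_inv_mult[OF assms] by (auto simp: matrix_matrix_mult_def mat_def vec_eq_iff)

text \<open>The derivative of the determinant in the \<open>i\<close>-th row replaces that row by its derivative;
  writing the new row in the basis of the old rows, only the coefficient of the \<open>i\<close>-th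
  contributes.\<close>

lemma has_derivative_det:
  fixes A :: "'a::real_normed_vector \<Rightarrow> real^'n^'n"
  assumes A: "\<And>i j. ((\<lambda>x. A x $ i $ j) has_derivative A' i j) (at x)" and "det (A x) \<noteq> 0"
  shows "((\<lambda>x. det (A x)) has_derivative
           (\<lambda>v. det (A x) * (\<Sum>i\<in>UNIV. \<Sum>j\<in>UNIV. matrix_inv (A x) $ j $ i * A' i j v))) (at x)"
proof -
  let ?P = "{p. p permutes (UNIV :: 'n set)}"
  have replaced_row: "det (\<chi> r. if r = i then \<chi> j. A' i j v else row r (A x))
      = (\<Sum>j\<in>UNIV. A' i j v * matrix_inv (A x) $ j $ i) * det (A x)" for i v
  proof -
    define C where "C = (\<chi> k. \<Sum>j\<in>UNIV. A' i j v * matrix_inv (A x) $ j $ k)"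
    have "(\<Sum>k\<in>UNIV. C $ k *s row k (A x)) $ l = A' i l v" for l
    proof -
      have "(\<Sum>k\<in>UNIV. C $ k *s row k (A x)) $ l
          = (\<Sum>k\<in>UNIV. \<Sum>j\<in>UNIV. A' i j v * (matrix_inv (A x) $ j $ k * A x $ k $ l))"
        by (simp add: C_def row_def sum_distrib_right mult.assoc)
      also have "\<dots> = (\<Sum>j\<in>UNIV. A' i j v * (\<Sum>k\<in>UNIV. matrix_inv (A x) $ j $ k * A x $ k $ l))"
        by (subst sum.swap) (simp add: sum_distrib_left)
      also have "\<dots> = A' i l v"
        by (simp add: sum_matrix_inv_mult[OF assms(2)] if_distrib cong: if_cong)
      finally show ?thesis .
    qed
    then have "(\<chi> j. A' i j v) = (\<Sum>k\<in>UNIV. C $ k *s row k (A x))" by (simp add: vec_eq_iff)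
    moreover have "C $ i = (\<Sum>j\<in>UNIV. A' i j v * matrix_inv (A x) $ j $ i)" by (simp add: C_def)
    ultimately show ?thesis
      using cramer_lemma_transpose[of i C "A x"] by metis
  qed
  have "((\<lambda>x. det (A x)) has_derivative (\<lambda>v. \<Sum>p\<in>?P. of_int (sign p) *
      (\<Sum>i\<in>UNIV. A' i (p i) v * (\<Prod>j\<in>UNIV - {i}. A x $ j $ p j)))) (at x)"
    unfolding det_def
    by (intro has_derivative_sum has_derivative_mult_right has_derivative_prod A)
  moreover have "(\<Sum>p\<in>?P. of_int (sign p) * (\<Sum>i\<in>UNIV. A' i (p i) v * (\<Prod>j\<in>UNIV - {i}. A x $ j $ p j)))
      = det (A x) * (\<Sum>i\<in>UNIV. \<Sum>j\<in>UNIV. matrix_inv (A x) $ j $ i * A' i j v)" for v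
  proof -
    have "(\<Sum>p\<in>?P. of_int (sign p) * (\<Sum>i\<in>UNIV. A' i (p i) v * (\<Prod>j\<in>UNIV - {i}. A x $ j $ p j)))
        = (\<Sum>i\<in>UNIV. \<Sum>p\<in>?P. of_int (sign p) * (A' i (p i) v * (\<Prod>j\<in>UNIV - {i}. A x $ j $ p j)))"
      by (subst sum.swap) (simp add: sum_distrib_left)
    also have "\<dots> = (\<Sum>i\<in>UNIV. det (\<chi> r. if r = i then \<chi> j. A' i j v else row r (A x)))"
    proof (rule sum.cong)
      fix i :: 'n
      have "(\<Prod>r\<in>UNIV. (\<chi> r. if r = i then \<chi> j. A' i j v else row r (A x)) $ r $ p r)
          = A' i (p i) v * (\<Prod>j\<in>UNIV - {i}. A x $ j $ p j)" for p
        by (subst prod.remove[of _ i]) (auto simp: row_def intro!: prod.cong)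
      then show "(\<Sum>p\<in>?P. of_int (sign p) * (A' i (p i) v * (\<Prod>j\<in>UNIV - {i}. A x $ j $ p j)))
          = det (\<chi> r. if r = i then \<chi> j. A' i j v else row r (A x))"
        by (simp add: det_def)
    qed simp
    finally show ?thesis
      by (simp add: replaced_row sum_distrib_left sum_distrib_right mult_ac)
  qed
  ultimately show ?thesis by simp
qed

lemma C1_on_det:
  fixes A :: "'a::real_normed_vector \<Rightarrow> real^'n^'n"
  assumes "\<And>i j. C1_on S (\<lambda>x. A x $ i $ j)"
  shows "C1_on S (\<lambda>x. det (A x))"
  unfolding det_def by (intro C1_on_sum C1_on_mult C1_on_const C1_on_prod assms)

text \<open>By Cramer's rule.\<close>

lemma C1_on_matrix_inv_mult:
  fixes A :: "'a::real_normed_vector \<Rightarrow> real^'n^'n" and b :: "'a \<Rightarrow> real^'n"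
  assumes "open S" "\<And>i j. C1_on S (\<lambda>x. A x $ i $ j)" "\<And>i. C1_on S (\<lambda>x. b x $ i)"
    and "\<And>x. x \<in> S \<Longrightarrow> det (A x) \<noteq> 0"
  shows "C1_on S (\<lambda>x. (matrix_inv (A x) *v b x) $ k)"
proof (rule C1_on_cong[OF _ \<open>open S\<close>])
  show "C1_on S (\<lambda>x. det (\<chi> i j. if j = k then b x $ i else A x $ i $ j) / det (A x))"
  proof (intro C1_on_divide C1_on_det assms)
    show "C1_on S (\<lambda>x. (\<chi> i j. if j = k then b x $ i else A x $ i $ j) $ i $ j)" for i j
      using assms(2,3) by (cases "j = k") simp_all
  qed
  show "det (\<chi> i j. if j = k then b x $ i else A x $ i $ j) / det (A x) = (matrix_inv (A x) *v b x) $ k"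
    if "x \<in> S" for x
  proof -
    have "A x *v (matrix_inv (A x) *v b x) = b x"
      by (simp add: matrix_vector_mul_assoc matrix_inv_mult(2)[OF assms(4)[OF that]])
    then show ?thesis using cramer[OF assms(4)[OF that]] by simp
  qed
qed

lemma det_reindex:
  fixes A :: "real^'n^'n" and \<sigma> :: "'m::finite \<Rightarrow> 'n"
  assumes "bij \<sigma>"
  shows "det (\<chi> i j. A $ \<sigma> i $ \<sigma> j) = det A"
proof -
  let ?P = "{p. p permutes (UNIV :: 'm set)}" and ?Q = "{p. p permutes (UNIV :: 'n set)}"
  let ?c = "\<lambda>p. \<sigma> \<circ> p \<circ> inv \<sigma>"
  have inv: "inv \<sigma> (\<sigma> i) = i" "\<sigma> (inv \<sigma> k) = k" for i k
    using assms by (auto simp: bij_is_inj bij_is_surj surj_f_inv_f)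
  have c: "?c p permutes UNIV" "sign (?c p) = sign p" if "p permutes UNIV" for p
  proof -
    have "map_permutation UNIV \<sigma> p = ?c p"
      using assms by (simp add: map_permutation_def bij_is_surj restrict_id_def fun_eq_iff)
    then show "?c p permutes UNIV" "sign (?c p) = sign p"
      using map_permutation_permutes[of \<sigma> UNIV UNIV p] sign_map_permutation[of \<sigma> UNIV p] that assms
      by (simp_all add: bij_is_inj)
  qed
  have "bij_betw ?c ?P ?Q"
  proof (rule bij_betwI[where g="\<lambda>q. inv \<sigma> \<circ> q \<circ> \<sigma>"])
    have "inv \<sigma> \<circ> q \<circ> \<sigma> permutes UNIV" if "q permutes UNIV" for q
      using bij_imp_permutes[of "inv \<sigma> \<circ> q \<circ> \<sigma>" UNIV] permutes_bij[OF that] assms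
      by (simp add: bij_comp bij_imp_bij_inv)
    then show "(\<lambda>q. inv \<sigma> \<circ> q \<circ> \<sigma>) \<in> ?Q \<rightarrow> ?P" by auto
  qed (use c(1) inv in \<open>auto simp: fun_eq_iff\<close>)
  moreover have "(\<Prod>i\<in>UNIV. A $ \<sigma> i $ \<sigma> (p i)) = (\<Prod>k\<in>UNIV. A $ k $ ?c p k)" for p
    using prod.reindex_bij_betw[OF assms, of "\<lambda>k. A $ k $ ?c p k"] by (simp add: inv)
  ultimately show ?thesis
    unfolding det_def using c(2)
    by (subst sum.reindex_bij_betw[symmetric, where h="?c"]) (auto intro!: sum.cong)
qed

section \<open>Change of variables for nonnegative functions\<close>

text \<open>The change of variables theorem for Lebesgue integrals speaks of absolutely integrable functions. For
  nonnegative functions, the next lemma turns it into an identity of extended integrals, infinite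
  values included.\<close>

lemma nn_integral_lebesgue_set:
  fixes h :: "'a::euclidean_space \<Rightarrow> real"
  assumes "(\<lambda>x. indicator S x * h x) \<in> borel_measurable borel" "\<And>x. x \<in> S \<Longrightarrow> h x \<ge> 0"
  shows "h absolutely_integrable_on S \<longleftrightarrow> (\<integral>\<^sup>+x\<in>S. ennreal (h x) \<partial>lborel) < \<infinity>"
    and "h absolutely_integrable_on S \<Longrightarrow> (\<integral>\<^sup>+x\<in>S. ennreal (h x) \<partial>lborel) = ennreal (integral S h)"
proof -
  have eq: "(\<integral>\<^sup>+x\<in>S. ennreal (h x) \<partial>lborel) = (\<integral>\<^sup>+x. ennreal (indicator S x * h x) \<partial>lborel)"
    by (intro nn_integral_cong) (auto simp: indicator_def)
  have nonneg: "indicator S x * h x \<ge> 0" for x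
    using assms(2) by (auto simp: indicator_def)
  have iff: "h absolutely_integrable_on S \<longleftrightarrow> integrable lborel (\<lambda>x. indicator S x * h x)"
    unfolding set_integrable_def using integrable_completion[of "\<lambda>x. indicator S x * h x" lborel] assms(1) by simp
  then show "h absolutely_integrable_on S \<longleftrightarrow> (\<integral>\<^sup>+x\<in>S. ennreal (h x) \<partial>lborel) < \<infinity>"
    unfolding eq using assms(1) nonneg by (simp add: integrable_iff_bounded)
  assume int: "h absolutely_integrable_on S"
  then have "(\<integral>\<^sup>+x. ennreal (indicator S x * h x) \<partial>lborel) = ennreal (LINT x|lborel. indicator S x * h x)"
    using iff nonneg by (intro nn_integral_eq_integral) auto
  also have "(LINT x|lborel. indicator S x * h x) = integral S h"
    using set_lebesgue_integral_eq_integral(2)[OF int] integral_completion[of "\<lambda>x. indicator S x * h x" lborel] assms(1)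
    by (simp add: set_lebesgue_integral_def)
  finally show "(\<integral>\<^sup>+x\<in>S. ennreal (h x) \<partial>lborel) = ennreal (integral S h)" by (simp add: eq)
qed

lemma nn_integral_change_of_variables_wellorder:
  fixes g :: "real^'m::{finite,wellorder} \<Rightarrow> real^'m::_" and f :: "real^'m::_ \<Rightarrow> real"
  assumes "S \<in> sets borel" "\<And>x. x \<in> S \<Longrightarrow> (g has_derivative g' x) (at x)" "inj_on g S"
    and "\<And>x. x \<in> g ` S \<Longrightarrow> f x \<ge> 0"
    and meas: "(\<lambda>x. indicator (g ` S) x * f x) \<in> borel_measurable borel"
      "(\<lambda>x. indicator S x * (\<bar>det (matrix (g' x))\<bar> * f (g x))) \<in> borel_measurable borel"
  shows "(\<integral>\<^sup>+x\<in>g ` S. ennreal (f x) \<partial>lborel)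
    = (\<integral>\<^sup>+x\<in>S. ennreal (\<bar>det (matrix (g' x))\<bar> * f (g x)) \<partial>lborel)"
proof -
  let ?h = "\<lambda>x. \<bar>det (matrix (g' x))\<bar> * f (g x)"
  have "(\<lambda>x. \<bar>det (matrix (g' x))\<bar> *\<^sub>R (\<chi> _. f (g x) :: real^1)) absolutely_integrable_on S \<and>
      integral S (\<lambda>x. \<bar>det (matrix (g' x))\<bar> *\<^sub>R (\<chi> _. f (g x) :: real^1)) = (\<chi> _. b)
    \<longleftrightarrow> (\<lambda>x. \<chi> _. f x :: real^1) absolutely_integrable_on (g ` S) \<and>
      integral (g ` S) (\<lambda>x. \<chi> _. f x :: real^1) = (\<chi> _. b)" for b
    using assms(1-3) by (intro has_absolute_integral_change_of_variables)
      (auto intro: has_derivative_at_withinI)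
  then have cov: "?h absolutely_integrable_on S \<and> integral S ?h = b
    \<longleftrightarrow> f absolutely_integrable_on (g ` S) \<and> integral (g ` S) f = b" for b
    by (simp add: absolutely_integrable_on_1_iff integral_on_1_eq vec_eq_iff)
  have nonneg: "?h x \<ge> 0" if "x \<in> S" for x using assms(4) that by auto
  note S = nn_integral_lebesgue_set[OF meas(2) nonneg]
  note gS = nn_integral_lebesgue_set[OF meas(1) assms(4)]
  show ?thesis
  proof (cases "?h absolutely_integrable_on S")
    case True
    then show ?thesis using cov[of "integral S ?h"] S(2) gS(2) by simp
  next
    case False
    then have "\<not> f absolutely_integrable_on (g ` S)" using cov by blast
    then have "\<not> (\<integral>\<^sup>+x\<in>g ` S. ennreal (f x) \<partial>lborel) < \<infinity>" using gS(1) by blast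
    moreover have "\<not> (\<integral>\<^sup>+x\<in>S. ennreal (?h x) \<partial>lborel) < \<infinity>" using S(1) False by blast
    ultimately show ?thesis 
      by (simp only: infinity_ennreal_def top.not_eq_extremum[symmetric] not_not)
  qed
qed

text \<open>The result above needs a well-ordered index type. It carries over to an arbitrary finite index
  type by renaming the coordinates, since this preserves the Lebesgue measure and determinants;
  the following type is a well-ordered copy of the index type.\<close>

typedef 'a ordered_index = "{..<CARD('a::finite)}"
  by (rule exI[of _ 0]) simp

instance ordered_index :: (finite) finite
proof
  show "finite (UNIV :: 'a ordered_index set)"
    unfolding type_definition.univ[OF type_definition_ordered_index] by simp
qed

instantiation ordered_index :: (finite) wellorder
begin

definition less_eq_ordered_index :: "'a ordered_index \<Rightarrow> 'a ordered_index \<Rightarrow> bool" where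
  "i \<le> j \<longleftrightarrow> Rep_ordered_index i \<le> Rep_ordered_index j"

definition less_ordered_index :: "'a ordered_index \<Rightarrow> 'a ordered_index \<Rightarrow> bool" where
  "i < j \<longleftrightarrow> Rep_ordered_index i < Rep_ordered_index j"

instance
proof
  fix P :: "'a ordered_index \<Rightarrow> bool" and a :: "'a ordered_index"
  assume "\<And>i. (\<And>j. j < i \<Longrightarrow> P j) \<Longrightarrow> P i"
  then show "P a"
    unfolding less_ordered_index_def by (induction a rule: measure_induct_rule[of Rep_ordered_index]) blast
qed (auto simp: less_eq_ordered_index_def less_ordered_index_def Rep_ordered_index_inject)

end

lemma exists_bij_ordered_index: "\<exists>\<sigma> :: 'a::finite ordered_index \<Rightarrow> 'a. bij \<sigma>"
proof -
  have "card (UNIV :: 'a ordered_index set) = card (UNIV :: 'a set)"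
    using type_definition.card[OF type_definition_ordered_index] by simp
  then show ?thesis by (intro finite_same_card_bij) auto
qed

lemma lborel_distr_reindex:
  fixes \<sigma> :: "'m::finite \<Rightarrow> 'n::finite"
  assumes "bij \<sigma>"
  shows "distr lborel borel (\<lambda>y :: real^'m. \<chi> k. y $ inv \<sigma> k) = lborel"
proof (rule lborel_eqI[symmetric])
  let ?R = "\<lambda>y :: real^'m. \<chi> k. y $ inv \<sigma> k"
  have inv: "inv \<sigma> (\<sigma> i) = i" "\<sigma> (inv \<sigma> k) = k" for i k
    using assms by (auto simp: bij_is_inj bij_is_surj surj_f_inv_f)
  have prod_Basis: "(\<Prod>b\<in>Basis. x \<bullet> b) = (\<Prod>i\<in>UNIV. x $ i)" for x :: "real^'k"
  proof -
    have inj: "inj (\<lambda>i :: 'k. axis i (1::real))" by (auto simp: inj_def axis_eq_axis)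
    have "(Basis :: (real^'k) set) = range (\<lambda>i. axis i 1)" by (auto simp: Basis_vec_def)
    then show ?thesis
      using prod.reindex[OF inj, of "\<lambda>b. x \<bullet> b"] by (simp add: cart_eq_inner_axis)
  qed
  fix l u :: "real^'n"
  assume le: "\<And>b. b \<in> Basis \<Longrightarrow> l \<bullet> b \<le> u \<bullet> b"
  then have le': "l $ k \<le> u $ k" for k
    using axis_in_Basis_iff[of k "1::real"] by (auto simp: cart_eq_inner_axis)
  have "?R -` box l u = box (\<chi> i. l $ \<sigma> i) (\<chi> i. u $ \<sigma> i)"
    by (auto simp: mem_box_cart) (metis inv)+
  moreover have "?R \<in> borel_measurable borel"
    by (intro borel_measurable_continuous_onI continuous_intros)
  ultimately have "emeasure (distr lborel borel ?R) (box l u)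
      = emeasure lborel (box (\<chi> i. l $ \<sigma> i) (\<chi> i. u $ \<sigma> i))"
    by (simp add: emeasure_distr)
  also have "\<dots> = ennreal (\<Prod>i\<in>UNIV. (u - l) $ \<sigma> i)"
  proof -
    have "(\<chi> i. l $ \<sigma> i) \<bullet> b \<le> (\<chi> i. u $ \<sigma> i) \<bullet> b" if "b \<in> Basis" for b :: "real^'m"
      using that le' by (auto simp: Basis_vec_def inner_axis)
    from emeasure_lborel_box[OF this] show ?thesis by (simp add: prod_Basis)
  qed
  also have "(\<Prod>i\<in>UNIV. (u - l) $ \<sigma> i) = (\<Prod>k\<in>UNIV. (u - l) $ k)"
    by (rule prod.reindex_bij_betw[OF assms])
  finally show "emeasure (distr lborel borel ?R) (box l u) = (\<Prod>b\<in>Basis. (u - l) \<bullet> b)"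
    by (simp add: prod_Basis)
qed simp

theorem nn_integral_change_of_variables:
  fixes g :: "real^'n \<Rightarrow> real^'n" and f :: "real^'n \<Rightarrow> real"
  assumes S: "S \<in> sets borel" and deriv: "\<And>x. x \<in> S \<Longrightarrow> (g has_derivative g' x) (at x)" and inj: "inj_on g S"
    and nonneg: "\<And>x. x \<in> g ` S \<Longrightarrow> f x \<ge> 0"
    and meas: "(\<lambda>x. indicator (g ` S) x * f x) \<in> borel_measurable borel"
      "(\<lambda>x. indicator S x * (\<bar>det (matrix (g' x))\<bar> * f (g x))) \<in> borel_measurable borel"
  shows "(\<integral>\<^sup>+x\<in>g ` S. ennreal (f x) \<partial>lborel)
    = (\<integral>\<^sup>+x\<in>S. ennreal (\<bar>det (matrix (g' x))\<bar> * f (g x)) \<partial>lborel)"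
proof -
  obtain \<sigma> :: "'n ordered_index \<Rightarrow> 'n" where \<sigma>: "bij \<sigma>" using exists_bij_ordered_index by auto
  define R where "R = (\<lambda>y :: real^'n ordered_index. \<chi> k. y $ inv \<sigma> k)"
  define Q where "Q = (\<lambda>x :: real^'n. \<chi> i. x $ \<sigma> i)"
  have inv: "inv \<sigma> (\<sigma> i) = i" "\<sigma> (inv \<sigma> k) = k" for i k
    using \<sigma> by (auto simp: bij_is_inj bij_is_surj surj_f_inv_f)
  have RQ: "R (Q x) = x" "Q (R y) = y" for x y by (auto simp: R_def Q_def vec_eq_iff inv)
  have "linear R" "linear Q"
    by (auto simp: R_def Q_def linear_iff vec_eq_iff)
  then have lin: "bounded_linear R" "bounded_linear Q"
    by (simp_all add: linear_conv_bounded_linear)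
  have R_meas: "R \<in> borel_measurable borel"
    using linear_continuous_on[OF lin(1)] by (rule borel_measurable_continuous_onI)
  have transfer: "(\<integral>\<^sup>+x. h x \<partial>lborel) = (\<integral>\<^sup>+y. h (R y) \<partial>lborel)" if "h \<in> borel_measurable borel" for h
    using nn_integral_distr[of R lborel borel h] that R_meas lborel_distr_reindex[OF \<sigma>]
    unfolding R_def by simp
  let ?g = "Q \<circ> g \<circ> R" and ?g' = "\<lambda>y. Q \<circ> g' (R y) \<circ> R" and ?S = "R -` S"
  have image: "R y \<in> g ` S \<longleftrightarrow> y \<in> ?g ` ?S" for y
  proof
    assume "R y \<in> g ` S"
    then obtain x where "x \<in> S" "R y = g x" by auto
    then have "y = ?g (Q x)" "Q x \<in> ?S" using RQ(2)[of y] by (simp_all add: RQ(1))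
    then show "y \<in> ?g ` ?S" by blast
  next
    assume "y \<in> ?g ` ?S"
    then show "R y \<in> g ` S" by (auto simp: RQ(1))
  qed
  have det: "det (matrix (?g' y)) = det (matrix (g' (R y)))" if "R y \<in> S" for y
  proof -
    have "R (axis j 1) = axis (\<sigma> j) 1" for j
      by (auto simp: R_def vec_eq_iff axis_def inv)
    then have "matrix (?g' y) = (\<chi> i j. matrix (g' (R y)) $ \<sigma> i $ \<sigma> j)"
      by (simp add: matrix_def Q_def)
    then show ?thesis using det_reindex[OF \<sigma>] by metis
  qed
  have ind: "indicator (g ` S) (R y) = indicator (?g ` ?S) y" "indicator S (R y) = indicator ?S y" for y
    using image[of y] by (auto simp: indicator_def)
  have det_ind: "indicator S (R y) * (\<bar>det (matrix (g' (R y)))\<bar> * f (g (R y)))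
      = indicator ?S y * (\<bar>det (matrix (?g' y))\<bar> * f (R (?g y)))" for y
    using det[of y] by (auto simp: indicator_def RQ)
  have "(\<integral>\<^sup>+x\<in>g ` S. ennreal (f x) \<partial>lborel) = (\<integral>\<^sup>+x. ennreal (indicator (g ` S) x * f x) \<partial>lborel)"
    by (intro nn_integral_cong) (auto simp: indicator_def)
  also have "\<dots> = (\<integral>\<^sup>+y. ennreal (indicator (g ` S) (R y) * f (R y)) \<partial>lborel)"
    using meas(1) by (intro transfer) simp
  also have "\<dots> = (\<integral>\<^sup>+y\<in>?g ` ?S. ennreal (f (R y)) \<partial>lborel)"
    unfolding ind by (intro nn_integral_cong) (auto simp: indicator_def)
  also have "\<dots> = (\<integral>\<^sup>+y\<in>?S. ennreal (\<bar>det (matrix (?g' y))\<bar> * f (R (?g y))) \<partial>lborel)"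
  proof (rule nn_integral_change_of_variables_wellorder)
    show "?S \<in> sets borel" using measurable_sets[OF R_meas S] by simp
    show "(?g has_derivative ?g' y) (at y)" if "y \<in> ?S" for y
      using diff_chain_at[OF diff_chain_at[OF bounded_linear_imp_has_derivative[OF lin(1)] deriv]
          bounded_linear_imp_has_derivative[OF lin(2)], of y] that by (simp add: o_assoc)
    show "inj_on ?g ?S"
    proof (rule inj_onI)
      fix y z
      assume *: "y \<in> ?S" "z \<in> ?S" "?g y = ?g z"
      then have "g (R y) = g (R z)" by (metis RQ(1) o_apply)
      then have "R y = R z" using inj_onD[OF inj, of "R y" "R z"] * by simp
      then show "y = z" by (metis RQ(2))
    qed
    show "f (R y) \<ge> 0" if "y \<in> ?g ` ?S" for y using nonneg image that by blast
    show "(\<lambda>y. indicator (?g ` ?S) y * f (R y)) \<in> borel_measurable borel"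
      using measurable_compose[OF R_meas meas(1)] unfolding ind .
    show "(\<lambda>y. indicator ?S y * (\<bar>det (matrix (?g' y))\<bar> * f (R (?g y)))) \<in> borel_measurable borel"
      using measurable_compose[OF R_meas meas(2)] unfolding det_ind .
  qed
  also have "\<dots> = (\<integral>\<^sup>+y. ennreal (indicator S (R y) * (\<bar>det (matrix (g' (R y)))\<bar> * f (g (R y)))) \<partial>lborel)"
    unfolding det_ind by (intro nn_integral_cong) (auto simp: indicator_def)
  also have "\<dots> = (\<integral>\<^sup>+x. ennreal (indicator S x * (\<bar>det (matrix (g' x))\<bar> * f (g x))) \<partial>lborel)"
    using meas(2) by (intro transfer[symmetric]) simp
  also have "\<dots> = (\<integral>\<^sup>+x\<in>S. ennreal (\<bar>det (matrix (g' x))\<bar> * f (g x)) \<partial>lborel)"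
    by (intro nn_integral_cong) (auto simp: indicator_def)
  finally show ?thesis .
qed

section \<open>Linear algebra of Minkowski space\<close>

interpretation lorentz: bounded_bilinear lorentz
proof -
  have "bounded_linear (\<lambda>w :: 'a \<times> real. (fst w, - snd w))"
    by (intro bounded_linear_Pair bounded_linear_fst bounded_linear_minus bounded_linear_snd)
  from bounded_bilinear.comp[OF bounded_bilinear_inner bounded_linear_ident this]
  show "bounded_bilinear (lorentz :: 'a \<times> real \<Rightarrow> 'a \<times> real \<Rightarrow> real)"
    unfolding lorentz_def inner_prod_def by simp
qed

lemma lorentz_commute: "lorentz v w = lorentz w v"
  by (simp add: lorentz_def inner_commute mult.commute)

text \<open>On the tangent space at \<open>v\<close> of the hyperboloid, this is a linear isometry onto Euclidean
  space: up to scaling, the derivative of the stereographic projection from \<open>(0, -1)\<close>. It turns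
  statements about the Lorentz form on tangent vectors into statements about the inner product.\<close>

definition stereo :: "'h::real_inner \<times> real \<Rightarrow> 'h \<times> real \<Rightarrow> 'h" where
  "stereo v w = fst w - (snd w / (1 + snd v)) *\<^sub>R fst v"

lemma linear_stereo: "linear (stereo v)"
  unfolding stereo_def
  by (auto simp: linear_iff algebra_simps add_divide_distrib)

lemma inner_stereo:
  assumes "v \<in> hyperbolic_space" "lorentz w v = 0" "lorentz w' v = 0"
  shows "stereo v w \<bullet> stereo v w' = lorentz w w'"
proof -
  define t where "t = snd v"
  have t: "t > 0" "fst v \<bullet> fst v = t\<^sup>2 - 1"
    and w: "fst w \<bullet> fst v = snd w * t" "fst w' \<bullet> fst v = snd w' * t"
    using assms by (auto simp: hyperbolic_space_def lorentz_def power2_eq_square t_def)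
  have sq: "t\<^sup>2 - 1 = (1 + t) * (t - 1)" by (simp add: power2_eq_square algebra_simps)
  have "stereo v w \<bullet> stereo v w' = fst w \<bullet> fst w' - (snd w' / (1 + t)) * (fst w \<bullet> fst v)
      - (snd w / (1 + t)) * (fst w' \<bullet> fst v) + (snd w / (1 + t)) * (snd w' / (1 + t)) * (fst v \<bullet> fst v)"
    unfolding stereo_def t_def by (simp add: inner_diff_left inner_diff_right inner_commute)
  also have "\<dots> = fst w \<bullet> fst w' - snd w * snd w'"
  proof -
    define s s' where "s = snd w / (1 + t)" and "s' = snd w' / (1 + t)"
    then have "snd w = s * (1 + t)" "snd w' = s' * (1 + t)" using t(1) by simp_all
    then show ?thesis
      unfolding t w sq s_def[symmetric] s'_def[symmetric] by (simp add: algebra_simps)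
  qed
  finally show ?thesis by (simp add: lorentz_def)
qed

lemma lorentz_self_nonneg:
  "v \<in> hyperbolic_space \<Longrightarrow> lorentz w v = 0 \<Longrightarrow> lorentz w w \<ge> 0"
  by (metis inner_ge_zero inner_stereo)

lemma lorentz_self_eq_0:
  assumes "v \<in> hyperbolic_space" "lorentz w v = 0" "lorentz w w = 0"
  shows "w = 0"
proof -
  have "stereo v w = 0" using inner_stereo[of v w w] assms by simp
  then have fst: "fst w = (snd w / (1 + snd v)) *\<^sub>R fst v" by (simp add: stereo_def)
  define t where "t = snd v"
  have t: "t > 0" "fst v \<bullet> fst v = t\<^sup>2 - 1"
    using assms by (auto simp: hyperbolic_space_def lorentz_def power2_eq_square t_def)
  have "snd w * t = fst w \<bullet> fst v"
    using assms(2) by (simp add: lorentz_def t_def)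
  also have "\<dots> = snd w / (1 + t) * (t\<^sup>2 - 1)"
    using t(2) fst by (simp add: t_def)
  also have "\<dots> = snd w * (t - 1)"
    using t(1) by (simp add: field_simps power2_eq_square)
  finally have "snd w = 0" by (simp add: algebra_simps)
  then show ?thesis using fst by (simp add: prod_eq_iff)
qed

section \<open>Tangent frames of an immersed submanifold\<close>

lemma linear_basis_expansion:
  fixes D :: "real^'n \<Rightarrow> 'b::real_vector"
  assumes "linear D"
  shows "D v = (\<Sum>i\<in>UNIV. (v $ i) *\<^sub>R D (axis i 1 :: real^'n))"
proof -
  have "v = (\<Sum>i\<in>UNIV. (v $ i) *\<^sub>R axis i 1)"
    by (metis (no_types) basis_expansion scalar_mult_eq_scaleR)
  then have "D v = D (\<Sum>i\<in>UNIV. (v $ i) *\<^sub>R axis i 1)" by simp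
  also have "\<dots> = (\<Sum>i\<in>UNIV. (v $ i) *\<^sub>R D (axis i 1 :: real^'n))"
    by (simp add: linear_sum[OF assms] linear_scale[OF assms])
  finally show ?thesis .
qed

locale immersion =
  fixes \<A> :: "('p::{t2_space,second_countable_topology}, 'n::finite) chart set"
    and f :: "'p \<Rightarrow> 'h::euclidean_space \<times> real"
  assumes immersed: "immersed_submanifold \<A> f"
begin

lemma chart_props:
  assumes "c \<in> \<A>"
  shows "open (fst c)" "open (chart_image c)" "continuous_on (fst c) (snd c)"
    "continuous_on (chart_image c) (chart_inv c)"
    "p \<in> fst c \<Longrightarrow> chart_inv c (snd c p) = p" "x \<in> chart_image c \<Longrightarrow> chart_inv c x \<in> fst c"
    "x \<in> chart_image c \<Longrightarrow> snd c (chart_inv c x) = x"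
proof -
  have c: "open (fst c)" "open (chart_image c)" "homeomorphism (fst c) (chart_image c) (snd c) (chart_inv c)"
    using immersed assms unfolding immersed_submanifold_def smooth_atlas_def by simp_all
  then show "open (fst c)" "open (chart_image c)" by simp_all
  show "continuous_on (fst c) (snd c)" "continuous_on (chart_image c) (chart_inv c)"
    using homeomorphism_cont1[OF c(3)] homeomorphism_cont2[OF c(3)] .
  show "chart_inv c (snd c p) = p" if "p \<in> fst c"
    using homeomorphism_apply1[OF c(3) that] .
  show "chart_inv c x \<in> fst c" "snd c (chart_inv c x) = x" if "x \<in> chart_image c"
    using that homeomorphism_apply2[OF c(3) that] inv_into_into[OF that] by auto
qed

lemma exists_chart: "\<exists>c\<in>\<A>. p \<in> fst c"
  using immersed unfolding immersed_submanifold_def smooth_atlas_def by auto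

lemma chart_at_props: "chart_at \<A> p \<in> \<A>" "p \<in> fst (chart_at \<A> p)"
  using someI_ex[of "\<lambda>c. c \<in> \<A> \<and> p \<in> fst c"] exists_chart[of p] unfolding chart_at_def by blast+

lemma in_hyperbolic_space: "f p \<in> hyperbolic_space"
  using immersed unfolding immersed_submanifold_def by blast

lemma param_in_hyperbolic_space: "param f c x \<in> hyperbolic_space"
  using in_hyperbolic_space by simp

lemma smooth_param: "c \<in> \<A> \<Longrightarrow> smooth_on (chart_image c) (param f c)"
  using immersed unfolding immersed_submanifold_def smooth_function_def by blast

abbreviation dparam :: "('p, 'n) chart \<Rightarrow> real^'n \<Rightarrow> real^'n \<Rightarrow> 'h \<times> real" where
  "dparam c x \<equiv> frechet_derivative (param f c) (at x)"

lemma C1_param: "c \<in> \<A> \<Longrightarrow> C1_on (chart_image c) (param f c)"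
  by (intro smooth_on_imp_C1_on smooth_param)

lemma C1_dparam: "c \<in> \<A> \<Longrightarrow> C1_on (chart_image c) (\<lambda>x. dparam c x v)"
  by (intro smooth_on_imp_C1_on smooth_on_derivative smooth_param)

lemma C1_partial: "c \<in> \<A> \<Longrightarrow> C1_on (chart_image c) (partial i (param f c))"
  unfolding partial_def by (rule C1_dparam)

lemma linear_dparam: "c \<in> \<A> \<Longrightarrow> x \<in> chart_image c \<Longrightarrow> linear (dparam c x)"
  by (rule has_derivative_linear[OF C1_on_has_derivative[OF C1_param]])

lemma dparam_expansion:
  assumes "c \<in> \<A>" "x \<in> chart_image c"
  shows "dparam c x v = (\<Sum>i\<in>UNIV. (v $ i) *\<^sub>R partial i (param f c) x)"
  unfolding partial_def by (rule linear_basis_expansion[OF linear_dparam[OF assms]])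

lemma dparam_eq_0:
  assumes "c \<in> \<A>" "x \<in> chart_image c" "dparam c x v = 0"
  shows "v = 0"
proof -
  have "inj (dparam c x)"
    using immersed assms unfolding immersed_submanifold_def by blast
  then show ?thesis using linear_0[OF linear_dparam[OF assms(1,2)]] assms(3) by (metis injD)
qed

text \<open>Differentiate \<open>\<langle>F, F\<rangle> = -1\<close>.\<close>

lemma dparam_orthogonal:
  assumes "c \<in> \<A>" "x \<in> chart_image c"
  shows "lorentz (dparam c x v) (param f c x) = 0"
proof -
  have "((\<lambda>y. lorentz (param f c y) (param f c y)) has_derivative
      (\<lambda>v. lorentz (param f c x) (dparam c x v) + lorentz (dparam c x v) (param f c x))) (at x)"
    using lorentz.FDERIV C1_on_has_derivative[OF C1_param assms(2)] assms(1) by blast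
  moreover have "(\<lambda>y. lorentz (param f c y) (param f c y)) = (\<lambda>y. -1)"
    using param_in_hyperbolic_space unfolding hyperbolic_space_def by blast
  ultimately have "((\<lambda>y. -1 :: real) has_derivative
      (\<lambda>v. lorentz (param f c x) (dparam c x v) + lorentz (dparam c x v) (param f c x))) (at x)"
    by simp
  from has_derivative_unique[OF this has_derivative_const]
  have "lorentz (param f c x) (dparam c x v) + lorentz (dparam c x v) (param f c x) = 0"
    by (rule fun_cong)
  then show ?thesis
    using lorentz_commute[of "param f c x"] by simp
qed

lemma lorentz_dparam:
  assumes "c \<in> \<A>" "x \<in> chart_image c"
  shows "lorentz (dparam c x v) (dparam c x w) = v \<bullet> (metric f c x *v w)"
    and "lorentz (dparam c x v) (dparam c x w)
      = stereo (param f c x) (dparam c x v) \<bullet> stereo (param f c x) (dparam c x w)"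
proof -
  show "lorentz (dparam c x v) (dparam c x w) = v \<bullet> (metric f c x *v w)"
    unfolding dparam_expansion[OF assms]
    by (simp add: lorentz.sum_left lorentz.sum_right lorentz.scaleR_left lorentz.scaleR_right
        inner_vec_def matrix_vector_mult_def metric_def sum_distrib_left mult_ac)
      (rule sum.swap)
  show "lorentz (dparam c x v) (dparam c x w)
      = stereo (param f c x) (dparam c x v) \<bullet> stereo (param f c x) (dparam c x w)"
    by (rule inner_stereo[OF param_in_hyperbolic_space dparam_orthogonal[OF assms]
          dparam_orthogonal[OF assms], symmetric])
qed

lemma lorentz_dparam_pos:
  assumes "c \<in> \<A>" "x \<in> chart_image c" "v \<noteq> 0"
  shows "lorentz (dparam c x v) (dparam c x v) > 0"
proof -
  have "lorentz (dparam c x v) (dparam c x v) \<noteq> 0"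
    using lorentz_self_eq_0[OF param_in_hyperbolic_space dparam_orthogonal[OF assms(1,2)]]
      dparam_eq_0[OF assms(1,2)] assms(3) by blast
  with lorentz_self_nonneg[OF param_in_hyperbolic_space dparam_orthogonal[OF assms(1,2)], of v]
  show ?thesis by simp
qed

lemma lorentz_dparam_nondegenerate:
  assumes "c \<in> \<A>" "x \<in> chart_image c"
    and "\<And>w. lorentz (dparam c x w) (dparam c x v) = lorentz (dparam c x w) (dparam c x v')"
  shows "v = v'"
proof (rule ccontr)
  assume "v \<noteq> v'"
  then have "lorentz (dparam c x (v - v')) (dparam c x (v - v')) > 0"
    using lorentz_dparam_pos[OF assms(1,2)] by simp
  moreover have "lorentz (dparam c x (v - v')) (dparam c x (v - v')) = 0"
    using assms(3)[of "v - v'"] linear_diff[OF linear_dparam[OF assms(1,2)], of v v']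
    by (simp add: lorentz.diff_right)
  ultimately show False by simp
qed

text \<open>The segment from the identity to the metric consists of positive definite, hence regular
  matrices, so the determinant does not change sign along it.\<close>

lemma det_metric_pos:
  assumes "c \<in> \<A>" "x \<in> chart_image c"
  shows "det (metric f c x) > 0"
proof (rule ccontr)
  let ?g = "metric f c x"
  let ?A = "\<lambda>t::real. (1 - t) *\<^sub>R mat 1 + t *\<^sub>R ?g"
  assume "\<not> det ?g > 0"
  moreover have "continuous_on {0..1} (\<lambda>t. det (?A t))"
    unfolding det_def by (intro continuous_intros)
  ultimately obtain t where t: "0 \<le> t" "t \<le> 1" "det (?A t) = 0"
    using IVT2'[of "\<lambda>t. det (?A t)" 1 0 0] by (auto simp: not_less)
  then obtain v where v: "?A t *v v = 0" "v \<noteq> 0"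
    using invertible_det_nz[of "?A t"] invertible_left_inverse[of "?A t"] matrix_left_invertible_ker[of "?A t"] by blast
  have "v \<bullet> (?A t *v v) = (1 - t) * (v \<bullet> v) + t * lorentz (dparam c x v) (dparam c x v)"
    by (simp add: lorentz_dparam(1)[OF assms] matrix_vector_mult_add_rdistrib scaleR_matrix_vector_assoc[symmetric]
        inner_add_right)
  moreover have "\<dots> > 0"
    using t v(2) lorentz_dparam_pos[OF assms v(2)]
    by (cases "t = 0") (auto intro!: add_nonneg_pos mult_nonneg_nonneg mult_pos_pos)
  ultimately show False using v(1) by simp
qed

text \<open>The coordinates of the tangential parts of the vectors that \<open>stereo\<close> maps to the standard
  basis. These vectors form a Parseval frame of the tangent space; unlike an orthonormal frame,
  it is given by a formula, depends continuously on the point and does not depend on the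
  chart.\<close>

definition frame :: "('p, 'n) chart \<Rightarrow> real^'n \<Rightarrow> 'h \<Rightarrow> real^'n" where
  "frame c x e = inv_metric f c x *v (\<chi> k. stereo (param f c x) (partial k (param f c) x) \<bullet> e)"

abbreviation tangent_frame :: "('p, 'n) chart \<Rightarrow> real^'n \<Rightarrow> 'h \<Rightarrow> 'h \<times> real" where
  "tangent_frame c x e \<equiv> dparam c x (frame c x e)"

lemma lorentz_frame:
  assumes "c \<in> \<A>" "x \<in> chart_image c"
  shows "lorentz (dparam c x v) (tangent_frame c x e) = stereo (param f c x) (dparam c x v) \<bullet> e"
proof -
  have "metric f c x *v frame c x e = (\<chi> k. stereo (param f c x) (partial k (param f c) x) \<bullet> e)"
    unfolding frame_def inv_metric_def
    by (simp add: matrix_vector_mul_assoc matrix_inv_mult(2) less_imp_neq[OF det_metric_pos[OF assms], symmetric])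
  then have "lorentz (dparam c x v) (tangent_frame c x e)
      = (\<Sum>k\<in>UNIV. v $ k * (stereo (param f c x) (partial k (param f c) x) \<bullet> e))"
    by (simp add: lorentz_dparam(1)[OF assms] inner_vec_def)
  also have "\<dots> = stereo (param f c x) (dparam c x v) \<bullet> e"
    unfolding dparam_expansion[OF assms]
    by (simp add: linear_sum[OF linear_stereo] linear_scale[OF linear_stereo] inner_sum_left)
  finally show ?thesis .
qed

text \<open>Since \<open>stereo\<close> is isometric, the reproducing property below is Parseval's identity for
  \<open>stereo (dparam c x v)\<close>.\<close>

lemma frame_expansion:
  assumes "c \<in> \<A>" "x \<in> chart_image c"
  shows "v = (\<Sum>e\<in>Basis. (stereo (param f c x) (dparam c x v) \<bullet> e) *\<^sub>R frame c x e)" (is "v = ?v")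
proof (rule lorentz_dparam_nondegenerate[OF assms])
  fix w
  have "dparam c x ?v = (\<Sum>e\<in>Basis. (stereo (param f c x) (dparam c x v) \<bullet> e) *\<^sub>R tangent_frame c x e)"
    by (simp add: linear_sum[OF linear_dparam[OF assms]] linear_scale[OF linear_dparam[OF assms]])
  then have "lorentz (dparam c x w) (dparam c x ?v)
      = stereo (param f c x) (dparam c x v) \<bullet> stereo (param f c x) (dparam c x w)"
    by (subst euclidean_inner) (simp add: lorentz.sum_right lorentz.scaleR_right lorentz_frame[OF assms])
  then show "lorentz (dparam c x w) (dparam c x v) = lorentz (dparam c x w) (dparam c x ?v)"
    by (simp add: lorentz_dparam(2)[OF assms] inner_commute)
qed

lemma inv_metric_frame:
  assumes "c \<in> \<A>" "x \<in> chart_image c"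
  shows "inv_metric f c x $ i $ j = (\<Sum>e\<in>Basis. frame c x e $ i * frame c x e $ j)"
proof -
  define G where "G = (\<chi> i j. \<Sum>e\<in>Basis. frame c x e $ i * frame c x e $ j)"
  have "(G ** metric f c x) $ i $ k = (mat 1 :: real^'n^'n) $ i $ k" for i k
  proof -
    have axis: "dparam c x (axis k 1) = partial k (param f c) x" for k by (simp add: partial_def)
    have "(\<Sum>j\<in>UNIV. frame c x e $ j * metric f c x $ j $ k) = stereo (param f c x) (dparam c x (axis k 1)) \<bullet> e" for e
      unfolding lorentz_frame[OF assms, symmetric]
      unfolding dparam_expansion[OF assms, of "frame c x e"] axis
      by (simp add: lorentz.sum_right lorentz.scaleR_right metric_def lorentz_commute)
    then have "(G ** metric f c x) $ i $ k
        = (\<Sum>e\<in>Basis. (stereo (param f c x) (dparam c x (axis k 1)) \<bullet> e) *\<^sub>R frame c x e) $ i"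
      unfolding G_def matrix_matrix_mult_def
      by (simp add: sum_distrib_right mult.assoc)
        (subst sum.swap, simp add: sum_distrib_left[symmetric] mult.commute)
    also have "\<dots> = axis k 1 $ i" using frame_expansion[OF assms, of "axis k 1"] by simp
    finally show ?thesis by (simp add: mat_def axis_def)
  qed
  then have "G ** metric f c x = mat 1" by (simp add: vec_eq_iff)
  then have "G = inv_metric f c x"
    unfolding inv_metric_def
    by (metis det_metric_pos[OF assms] less_irrefl matrix_inv_mult(2) matrix_mul_assoc matrix_mul_lid matrix_mul_rid)
  then show ?thesis by (metis (no_types, lifting) G_def vec_lambda_beta)
qed

end

section \<open>Change of charts\<close>

context immersion
begin

definition transition :: "('p, 'n) chart \<Rightarrow> ('p, 'n) chart \<Rightarrow> real^'n \<Rightarrow> real^'n" where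
  "transition c d = snd d \<circ> chart_inv c"

abbreviation overlap :: "('p, 'n) chart \<Rightarrow> ('p, 'n) chart \<Rightarrow> (real^'n) set" where
  "overlap c d \<equiv> snd c ` (fst c \<inter> fst d)"

abbreviation dtransition :: "('p, 'n) chart \<Rightarrow> ('p, 'n) chart \<Rightarrow> real^'n \<Rightarrow> real^'n \<Rightarrow> real^'n" where
  "dtransition c d x \<equiv> frechet_derivative (transition c d) (at x)"

lemma overlap_props:
  assumes "c \<in> \<A>" "d \<in> \<A>"
  shows "open (overlap c d)"
    and "x \<in> overlap c d \<Longrightarrow> x \<in> chart_image c"
    and "x \<in> overlap c d \<Longrightarrow> chart_inv c x \<in> fst d"
    and "x \<in> overlap c d \<Longrightarrow> transition c d x \<in> overlap d c"
    and "x \<in> overlap c d \<Longrightarrow> transition c d x \<in> chart_image d"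
    and "x \<in> overlap c d \<Longrightarrow> chart_inv d (transition c d x) = chart_inv c x"
    and "x \<in> overlap c d \<Longrightarrow> transition d c (transition c d x) = x"
proof -
  have "overlap c d = chart_image c \<inter> chart_inv c -` fst d"
    using chart_props(5,6)[OF assms(1)] by (fastforce simp: image_iff)
  then show "open (overlap c d)"
    using continuous_open_preimage[OF chart_props(4,2)[OF assms(1)] chart_props(1)[OF assms(2)]] by simp
  assume x: "x \<in> overlap c d"
  then show "x \<in> chart_image c" by auto
  obtain p where p: "p \<in> fst c" "p \<in> fst d" "x = snd c p" using x by blast
  then have inv: "chart_inv c x = p" using chart_props(5)[OF assms(1)] by simp
  have \<tau>: "transition c d x = snd d p" using inv by (simp add: transition_def)
  show "chart_inv c x \<in> fst d" using inv p by simp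
  show "transition c d x \<in> overlap d c" "transition c d x \<in> chart_image d" using \<tau> p by auto
  show "chart_inv d (transition c d x) = chart_inv c x"
    using inv \<tau> chart_props(5)[OF assms(2) p(2)] by simp
  then show "transition d c (transition c d x) = x"
    using inv p(3) by (simp add: transition_def)
qed

lemma smooth_transition:
  assumes "c \<in> \<A>" "d \<in> \<A>"
  shows "smooth_on (overlap c d) (transition c d)"
  using immersed assms unfolding immersed_submanifold_def smooth_atlas_def transition_def by blast

lemma C1_transition: "c \<in> \<A> \<Longrightarrow> d \<in> \<A> \<Longrightarrow> C1_on (overlap c d) (transition c d)"
  by (intro smooth_on_imp_C1_on smooth_transition)

lemma transition_has_derivative:
  "c \<in> \<A> \<Longrightarrow> d \<in> \<A> \<Longrightarrow> x \<in> overlap c d \<Longrightarrow> (transition c d has_derivative dtransition c d x) (at x)"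
  by (rule C1_on_has_derivative[OF C1_transition])

lemma derivative_change_chart:
  fixes u :: "'p \<Rightarrow> 'b::real_normed_vector"
  assumes cd: "c \<in> \<A>" "d \<in> \<A>" and x: "x \<in> overlap c d" and "C1_on (chart_image d) (u \<circ> chart_inv d)"
  shows "frechet_derivative (u \<circ> chart_inv c) (at x) v
    = frechet_derivative (u \<circ> chart_inv d) (at (transition c d x)) (dtransition c d x v)"
proof -
  have "((u \<circ> chart_inv d) \<circ> transition c d has_derivative
      frechet_derivative (u \<circ> chart_inv d) (at (transition c d x)) \<circ> dtransition c d x) (at x)"
    by (intro diff_chain_at transition_has_derivative[OF cd x] C1_on_has_derivative[OF assms(4)] overlap_props(5)[OF cd x])
  then have "frechet_derivative ((u \<circ> chart_inv d) \<circ> transition c d) (at x)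
      = frechet_derivative (u \<circ> chart_inv d) (at (transition c d x)) \<circ> dtransition c d x"
    by (rule frechet_derivative_at[symmetric])
  moreover have "frechet_derivative (u \<circ> chart_inv c) (at x)
      = frechet_derivative ((u \<circ> chart_inv d) \<circ> transition c d) (at x)"
    by (rule frechet_derivative_eq_on_open[OF overlap_props(1)[OF cd] x]) (simp add: overlap_props(6)[OF cd])
  ultimately show ?thesis by simp
qed

lemma dparam_change_chart:
  "c \<in> \<A> \<Longrightarrow> d \<in> \<A> \<Longrightarrow> x \<in> overlap c d \<Longrightarrow>
    dparam c x v = dparam d (transition c d x) (dtransition c d x v)"
  by (rule derivative_change_chart[OF _ _ _ C1_param])

lemma param_change_chart:
  "c \<in> \<A> \<Longrightarrow> d \<in> \<A> \<Longrightarrow> x \<in> overlap c d \<Longrightarrow> param f d (transition c d x) = param f c x"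
  using overlap_props(6) by simp

lemma dtransition_inverse:
  assumes cd: "c \<in> \<A>" "d \<in> \<A>" and x: "x \<in> overlap c d"
  shows "dtransition c d x (dtransition d c (transition c d x) w) = w"
proof -
  let ?y = "transition c d x"
  have y: "?y \<in> overlap d c" "transition d c ?y = x"
    using overlap_props(4,7)[OF cd x] by auto
  have "(transition c d \<circ> transition d c has_derivative dtransition c d x \<circ> dtransition d c ?y) (at ?y)"
    using diff_chain_at[OF transition_has_derivative[OF cd(2,1) y(1)], of "transition c d" "dtransition c d x"]
      transition_has_derivative[OF cd x] y(2) by simp
  moreover have "transition c d (transition d c z) = z" if "z \<in> overlap d c" for z
    using overlap_props(7)[OF cd(2,1) that] .
  ultimately have "((\<lambda>z. z) has_derivative dtransition c d x \<circ> dtransition d c ?y) (at ?y)"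
    using has_derivative_transform_within_open[OF _ overlap_props(1)[OF cd(2,1)] y(1),
        of "transition c d \<circ> transition d c" _ UNIV "\<lambda>z. z"] by (metis (no_types) o_apply)
  from has_derivative_unique[OF this has_derivative_ident] show ?thesis by (metis o_apply)
qed

text \<open>In either chart the frame vector represents the same linear functional on tangent vectors
  (\<open>lorentz_frame\<close>), and such a representation is unique.\<close>

lemma frame_change_chart:
  assumes cd: "c \<in> \<A>" "d \<in> \<A>" and x: "x \<in> overlap c d"
  shows "frame d (transition c d x) e = dtransition c d x (frame c x e)"
proof (rule lorentz_dparam_nondegenerate[OF cd(2) overlap_props(5)[OF cd x]])
  fix w
  let ?y = "transition c d x"
  define w' where "w' = dtransition d c ?y w"
  have w: "dparam d ?y w = dparam c x w'"
    using dparam_change_chart[OF cd x, of w'] dtransition_inverse[OF cd x] by (simp add: w'_def)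
  have "lorentz (dparam d ?y w) (tangent_frame d ?y e) = stereo (param f d ?y) (dparam d ?y w) \<bullet> e"
    by (rule lorentz_frame[OF cd(2) overlap_props(5)[OF cd x]])
  also have "\<dots> = stereo (param f c x) (dparam c x w') \<bullet> e"
    by (simp only: w param_change_chart[OF cd x])
  also have "\<dots> = lorentz (dparam c x w') (tangent_frame c x e)"
    by (rule lorentz_frame[OF cd(1) overlap_props(2)[OF cd x], symmetric])
  also have "\<dots> = lorentz (dparam d ?y w) (dparam d ?y (dtransition c d x (frame c x e)))"
    by (simp only: w dparam_change_chart[OF cd x])
  finally show "lorentz (dparam d ?y w) (tangent_frame d ?y e)
      = lorentz (dparam d ?y w) (dparam d ?y (dtransition c d x (frame c x e)))" .
qed

lemma tangent_frame_change_chart: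
  "c \<in> \<A> \<Longrightarrow> d \<in> \<A> \<Longrightarrow> x \<in> overlap c d \<Longrightarrow>
    tangent_frame d (transition c d x) e = tangent_frame c x e"
  by (simp add: frame_change_chart dparam_change_chart[symmetric])

section \<open>The second fundamental form as a bilinear map\<close>

lemma normal_part_frame:
  assumes "c \<in> \<A>" "x \<in> chart_image c"
  shows "normal_part f c x w
    = w - (\<Sum>e\<in>Basis. lorentz w (tangent_frame c x e) *\<^sub>R tangent_frame c x e)"
proof -
  let ?F = "\<lambda>k. partial k (param f c) x" and ?r = "frame c x"
  have "(\<Sum>k\<in>UNIV. \<Sum>l\<in>UNIV. (inv_metric f c x $ k $ l * lorentz w (?F k)) *\<^sub>R ?F l)
      = (\<Sum>k\<in>UNIV. \<Sum>l\<in>UNIV. \<Sum>e\<in>Basis. (?r e $ k * lorentz w (?F k)) *\<^sub>R ?r e $ l *\<^sub>R ?F l)"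
    by (simp only: inv_metric_frame[OF assms] sum_distrib_right scaleR_sum_left) (simp add: mult_ac)
  also have "\<dots> = (\<Sum>k\<in>UNIV. \<Sum>e\<in>Basis. \<Sum>l\<in>UNIV. (?r e $ k * lorentz w (?F k)) *\<^sub>R ?r e $ l *\<^sub>R ?F l)"
    by (rule sum.cong[OF refl], rule sum.swap)
  also have "\<dots> = (\<Sum>e\<in>Basis. \<Sum>k\<in>UNIV. \<Sum>l\<in>UNIV. (?r e $ k * lorentz w (?F k)) *\<^sub>R ?r e $ l *\<^sub>R ?F l)"
    by (rule sum.swap)
  also have "\<dots> = (\<Sum>e\<in>Basis. lorentz w (tangent_frame c x e) *\<^sub>R tangent_frame c x e)"
    unfolding dparam_expansion[OF assms]
    by (simp only: lorentz.sum_right lorentz.scaleR_right scaleR_sum_left scaleR_sum_right real_scaleR_def)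
      (rule sum.cong[OF refl], rule sum.swap)
  finally show ?thesis unfolding normal_part_def by simp
qed

lemma linear_normal_part:
  assumes "c \<in> \<A>" "x \<in> chart_image c"
  shows "linear (normal_part f c x)"
  unfolding normal_part_frame[OF assms, abs_def]
  by (auto simp: linear_iff lorentz.add_left lorentz.scaleR_left scaleR_add_left sum.distrib
      scaleR_sum_right algebra_simps)

lemma normal_part_dparam:
  assumes "c \<in> \<A>" "x \<in> chart_image c"
  shows "normal_part f c x (dparam c x v) = 0"
proof -
  have "dparam c x v = dparam c x (\<Sum>e\<in>Basis. (stereo (param f c x) (dparam c x v) \<bullet> e) *\<^sub>R frame c x e)"
    using frame_expansion[OF assms, of v] by simp
  also have "\<dots> = (\<Sum>e\<in>Basis. (stereo (param f c x) (dparam c x v) \<bullet> e) *\<^sub>R tangent_frame c x e)"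
    by (simp only: linear_sum[OF linear_dparam[OF assms]] linear_scale[OF linear_dparam[OF assms]])
  finally show ?thesis
    by (simp add: normal_part_frame[OF assms] lorentz_frame[OF assms])
qed

lemma normal_part_change_chart:
  assumes cd: "c \<in> \<A>" "d \<in> \<A>" and x: "x \<in> overlap c d"
  shows "normal_part f d (transition c d x) w = normal_part f c x w"
  unfolding normal_part_frame[OF cd(1) overlap_props(2)[OF cd x]]
    normal_part_frame[OF cd(2) overlap_props(5)[OF cd x]]
  by (simp only: tangent_frame_change_chart[OF cd x])

abbreviation hess :: "('p, 'n) chart \<Rightarrow> real^'n \<Rightarrow> real^'n \<Rightarrow> real^'n \<Rightarrow> 'h \<times> real" where
  "hess c x v w \<equiv> frechet_derivative (\<lambda>y. dparam c y w) (at x) v"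

lemma partial_partial: "partial i (partial j (param f c)) x = hess c x (axis i 1) (axis j 1)"
  by (simp add: partial_def[abs_def])

lemma hess_commute:
  "c \<in> \<A> \<Longrightarrow> x \<in> chart_image c \<Longrightarrow> hess c x v w = hess c x w v"
  by (rule mixed_derivatives_commute[OF chart_props(2) _ C1_param C1_dparam])

lemma linear_hess:
  assumes "c \<in> \<A>" "x \<in> chart_image c"
  shows "linear (\<lambda>v. hess c x v w)" "linear (\<lambda>w. hess c x v w)"
proof -
  show left: "linear (\<lambda>v. hess c x v w)" for w
    by (rule has_derivative_linear[OF C1_on_has_derivative[OF C1_dparam[OF assms(1)] assms(2)]])
  have "(\<lambda>w. hess c x v w) = (\<lambda>w. hess c x w v)"
    using hess_commute[OF assms] by blast
  then show "linear (\<lambda>w. hess c x v w)" using left[of v] by simp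
qed

lemma hess_expansion_right:
  assumes "c \<in> \<A>" "x \<in> chart_image c"
  shows "hess c x v w = (\<Sum>i\<in>UNIV. (w $ i) *\<^sub>R hess c x v (axis i 1))"
  by (rule linear_basis_expansion[OF linear_hess(2)[OF assms]])

lemma hess_expansion:
  assumes "c \<in> \<A>" "x \<in> chart_image c"
  shows "hess c x v w = (\<Sum>i\<in>UNIV. \<Sum>j\<in>UNIV. (v $ i * w $ j) *\<^sub>R partial i (partial j (param f c)) x)"
proof -
  have "hess c x v w = (\<Sum>j\<in>UNIV. (w $ j) *\<^sub>R hess c x v (axis j 1))"
    by (rule hess_expansion_right[OF assms])
  also have "\<dots> = (\<Sum>j\<in>UNIV. \<Sum>i\<in>UNIV. (v $ i * w $ j) *\<^sub>R hess c x (axis i 1) (axis j 1))"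
    by (subst linear_basis_expansion[OF linear_hess(1)[OF assms], of _ v]) (simp add: scaleR_sum_right mult.commute)
  finally show ?thesis unfolding partial_partial by (subst sum.swap)
qed

text \<open>Differentiating the chain rule once more; the term with second derivatives of the
  transition map is tangent to the submanifold.\<close>

lemma hess_change_chart:
  assumes cd: "c \<in> \<A>" "d \<in> \<A>" and x: "x \<in> overlap c d"
  shows "\<exists>z. hess c x v w = hess d (transition c d x) (dtransition c d x v) (dtransition c d x w)
    + dparam d (transition c d x) z"
proof -
  let ?y = "transition c d x" and ?W = "overlap c d"
  let ?J = "\<lambda>y. dtransition c d y w"
  define z where "z = frechet_derivative ?J (at x) v"
  have y: "?y \<in> chart_image d" by (rule overlap_props(5)[OF cd x])
  have J: "(?J has_derivative frechet_derivative ?J (at x)) (at x)"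
    using C1_on_has_derivative[OF smooth_on_imp_C1_on[OF smooth_on_derivative[OF smooth_transition[OF cd]]] x] .
  have "((\<lambda>y. \<Sum>l\<in>UNIV. ?J y $ l *\<^sub>R partial l (param f d) (transition c d y)) has_derivative
      (\<lambda>v. \<Sum>l\<in>UNIV. ?J x $ l *\<^sub>R frechet_derivative (partial l (param f d)) (at ?y) (dtransition c d x v)
        + frechet_derivative ?J (at x) v $ l *\<^sub>R partial l (param f d) ?y)) (at x)"
    by (intro has_derivative_sum has_derivative_scaleR bounded_linear.has_derivative[OF bounded_linear_vec_nth J]
        has_derivative_compose[OF transition_has_derivative[OF cd x] C1_on_has_derivative[OF C1_partial[OF cd(2)] y]])
  then have "hess c x v w = (\<Sum>l\<in>UNIV. ?J x $ l *\<^sub>R frechet_derivative (partial l (param f d)) (at ?y) (dtransition c d x v)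
        + z $ l *\<^sub>R partial l (param f d) ?y)"
    unfolding z_def
    by (subst frechet_derivative_eq_on_open[OF overlap_props(1)[OF cd] x, of _
          "\<lambda>y. \<Sum>l\<in>UNIV. ?J y $ l *\<^sub>R partial l (param f d) (transition c d y)"])
      (simp_all add: dparam_change_chart[OF cd] dparam_expansion[OF cd(2) overlap_props(5)[OF cd]]
        frechet_derivative_at[symmetric])
  also have "\<dots> = (\<Sum>l\<in>UNIV. ?J x $ l *\<^sub>R hess d ?y (dtransition c d x v) (axis l 1)) + dparam d ?y z"
    unfolding dparam_expansion[OF cd(2) y] by (simp add: sum.distrib partial_def[abs_def])
  also have "(\<Sum>l\<in>UNIV. ?J x $ l *\<^sub>R hess d ?y (dtransition c d x v) (axis l 1))
      = hess d ?y (dtransition c d x v) (?J x)"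
    by (rule linear_basis_expansion[OF linear_hess(2)[OF cd(2) y], symmetric])
  finally show ?thesis by blast
qed

definition sff :: "('p, 'n) chart \<Rightarrow> real^'n \<Rightarrow> real^'n \<Rightarrow> real^'n \<Rightarrow> 'h \<times> real" where
  "sff c x v w = normal_part f c x (hyp_proj (param f c x) (hess c x v w))"

lemma linear_hyp_proj: "linear (hyp_proj v)"
  unfolding hyp_proj_def by (auto simp: linear_iff lorentz.add_left lorentz.scaleR_left algebra_simps)

lemma sff_expansion:
  assumes "c \<in> \<A>" "x \<in> chart_image c"
  shows "sff c x v w = (\<Sum>i\<in>UNIV. \<Sum>j\<in>UNIV. (v $ i * w $ j) *\<^sub>R second_fundamental_form f c x i j)"
  unfolding sff_def hess_expansion[OF assms] second_fundamental_form_def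
  by (simp only: linear_sum[OF linear_hyp_proj] linear_scale[OF linear_hyp_proj]
      linear_sum[OF linear_normal_part[OF assms]] linear_scale[OF linear_normal_part[OF assms]])

lemma sff_change_chart:
  assumes cd: "c \<in> \<A>" "d \<in> \<A>" and x: "x \<in> overlap c d"
  shows "sff c x v w = sff d (transition c d x) (dtransition c d x v) (dtransition c d x w)"
proof -
  let ?y = "transition c d x"
  have y: "?y \<in> chart_image d" by (rule overlap_props(5)[OF cd x])
  obtain z where z: "hess c x v w = hess d ?y (dtransition c d x v) (dtransition c d x w) + dparam d ?y z"
    using hess_change_chart[OF cd x] by blast
  have "hyp_proj (param f d ?y) (dparam d ?y z) = dparam d ?y z"
    by (simp add: hyp_proj_def dparam_orthogonal[OF cd(2) y, unfolded o_apply] del: o_apply)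
      (use dparam_orthogonal[OF cd(2) y, of z] in simp)
  then show ?thesis
    unfolding sff_def z param_change_chart[OF cd x, symmetric] normal_part_change_chart[OF cd x, symmetric]
    by (simp add: linear_add[OF linear_hyp_proj] linear_add[OF linear_normal_part[OF cd(2) y]]
        normal_part_dparam[OF cd(2) y] del: o_apply)
qed

text \<open>Written over the frame, contractions with the inverse metric become plain sums of
  chart-independent terms. The next two lemmas thus replace the chart chosen at \<open>p\<close> by any chart
  around \<open>p\<close>.\<close>

lemma mean_curvature_frame:
  assumes c: "c \<in> \<A>" and p: "p \<in> fst c"
  shows "mean_curvature \<A> f p
    = (1 / real CARD('n)) *\<^sub>R (\<Sum>e\<in>Basis. sff c (snd c p) (frame c (snd c p) e) (frame c (snd c p) e))"
proof -
  define d where "d = chart_at \<A> p"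
  have d: "d \<in> \<A>" "p \<in> fst d" using chart_at_props by (auto simp: d_def)
  let ?x = "snd c p" and ?y = "snd d p"
  have y: "?y \<in> chart_image d" using d by auto
  have x: "?x \<in> overlap c d" "transition c d ?x = ?y"
    using c p d chart_props(5)[OF c p] by (auto simp: transition_def)
  have "(\<Sum>i\<in>UNIV. \<Sum>j\<in>UNIV. inv_metric f d ?y $ i $ j *\<^sub>R second_fundamental_form f d ?y i j)
      = (\<Sum>i\<in>UNIV. \<Sum>j\<in>UNIV. \<Sum>e\<in>Basis. (frame d ?y e $ i * frame d ?y e $ j) *\<^sub>R second_fundamental_form f d ?y i j)"
    by (simp only: inv_metric_frame[OF d(1) y] scaleR_sum_left)
  also have "\<dots> = (\<Sum>i\<in>UNIV. \<Sum>e\<in>Basis. \<Sum>j\<in>UNIV. (frame d ?y e $ i * frame d ?y e $ j) *\<^sub>R second_fundamental_form f d ?y i j)"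
    by (rule sum.cong[OF refl], rule sum.swap)
  also have "\<dots> = (\<Sum>e\<in>Basis. sff d ?y (frame d ?y e) (frame d ?y e))"
    unfolding sff_expansion[OF d(1) y] by (rule sum.swap)
  also have "\<dots> = (\<Sum>e\<in>Basis. sff c ?x (frame c ?x e) (frame c ?x e))"
    unfolding sff_change_chart[OF c d(1) x(1)] x(2) by (simp add: frame_change_chart[OF c d(1) x(1), unfolded x(2)])
  finally show ?thesis
    unfolding mean_curvature_def by (simp add: Let_def d_def)
qed

lemma sff_norm_sq_frame:
  assumes c: "c \<in> \<A>" and p: "p \<in> fst c"
  shows "sff_norm_sq \<A> f p
    = (\<Sum>e\<in>Basis. \<Sum>e'\<in>Basis. let a = sff c (snd c p) (frame c (snd c p) e) (frame c (snd c p) e') in lorentz a a)"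
proof -
  define d where "d = chart_at \<A> p"
  have d: "d \<in> \<A>" "p \<in> fst d" using chart_at_props by (auto simp: d_def)
  let ?x = "snd c p" and ?y = "snd d p"
  have y: "?y \<in> chart_image d" using d by auto
  have x: "?x \<in> overlap c d" "transition c d ?x = ?y"
    using c p d chart_props(5)[OF c p] by (auto simp: transition_def)
  let ?A = "second_fundamental_form f d ?y" and ?r = "frame d ?y"
  have "sff_norm_sq \<A> f p = (\<Sum>i\<in>UNIV. \<Sum>j\<in>UNIV. \<Sum>k\<in>UNIV. \<Sum>l\<in>UNIV.
      (\<Sum>e\<in>Basis. ?r e $ i * ?r e $ k) * (\<Sum>e'\<in>Basis. ?r e' $ j * ?r e' $ l) * lorentz (?A i j) (?A k l))"
    unfolding sff_norm_sq_def by (simp add: Let_def d_def[symmetric] inv_metric_frame[OF d(1) y])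
  also have "\<dots> = (\<Sum>i\<in>UNIV. \<Sum>j\<in>UNIV. \<Sum>k\<in>UNIV. \<Sum>l\<in>UNIV. \<Sum>e\<in>Basis. \<Sum>e'\<in>Basis.
      (?r e $ i * ?r e' $ j) * (?r e $ k * ?r e' $ l) * lorentz (?A i j) (?A k l))"
    by (simp only: sum_product, simp only: sum_distrib_right) (simp add: mult_ac)
  also have "\<dots> = (\<Sum>e\<in>Basis. \<Sum>e'\<in>Basis. \<Sum>i\<in>UNIV. \<Sum>j\<in>UNIV. \<Sum>k\<in>UNIV. \<Sum>l\<in>UNIV.
      (?r e $ i * ?r e' $ j) * (?r e $ k * ?r e' $ l) * lorentz (?A i j) (?A k l))"
    by (simp only: sum.swap[where A="Basis :: 'h set" and B="UNIV :: 'n set"]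
        sum.swap[where B="Basis :: 'h set" and A="UNIV :: 'n set", symmetric])
  also have "\<dots> = (\<Sum>e\<in>Basis. \<Sum>e'\<in>Basis. lorentz (sff d ?y (?r e) (?r e')) (sff d ?y (?r e) (?r e')))"
    unfolding sff_expansion[OF d(1) y]
    by (simp only: lorentz.sum_left lorentz.scaleR_left,
        simp only: lorentz.sum_right lorentz.scaleR_right real_scaleR_def sum_distrib_left)
      (simp add: mult_ac)
  also have "\<dots> = (\<Sum>e\<in>Basis. \<Sum>e'\<in>Basis. lorentz (sff c ?x (frame c ?x e) (frame c ?x e')) (sff c ?x (frame c ?x e) (frame c ?x e')))"
    unfolding sff_change_chart[OF c d(1) x(1)] x(2) by (simp add: frame_change_chart[OF c d(1) x(1), unfolded x(2)])
  finally show ?thesis by (simp add: Let_def)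
qed

section \<open>Continuously differentiable functions and their gradients\<close>

definition C1_function :: "('p \<Rightarrow> real) \<Rightarrow> bool" where
  "C1_function u \<longleftrightarrow> (\<forall>c\<in>\<A>. C1_on (chart_image c) (u \<circ> chart_inv c))"

lemma C1_functionD: "C1_function u \<Longrightarrow> c \<in> \<A> \<Longrightarrow> C1_on (chart_image c) (u \<circ> chart_inv c)"
  unfolding C1_function_def by blast

lemma smooth_function_imp_C1_function: "smooth_function \<A> u \<Longrightarrow> C1_function u"
  unfolding C1_function_def smooth_function_def by (blast intro: smooth_on_imp_C1_on)

lemma continuous_on_charts:
  fixes h :: "'p \<Rightarrow> 'b::topological_space"
  assumes "\<And>c. c \<in> \<A> \<Longrightarrow> continuous_on (chart_image c) (\<lambda>x. h (chart_inv c x))"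
  shows "continuous_on UNIV h"
proof -
  have "continuous_on (fst c) h" if c: "c \<in> \<A>" for c
  proof -
    have "continuous_on (fst c) (\<lambda>p. h (chart_inv c (snd c p)))"
      by (rule continuous_on_compose2[OF assms[OF c] chart_props(3)[OF c]]) auto
    then show ?thesis
      by (rule continuous_on_eq) (simp add: chart_props(5)[OF c])
  qed
  then have "continuous_on (\<Union>c\<in>\<A>. fst c) h"
    by (intro continuous_on_open_UN chart_props(1))
  moreover have "(\<Union>c\<in>\<A>. fst c) = UNIV" using exists_chart by auto
  ultimately show ?thesis by simp
qed

lemma C1_function_continuous: "C1_function u \<Longrightarrow> continuous_on UNIV u"
  by (rule continuous_on_charts) (drule (1) C1_functionD, drule C1_on_imp_continuous_on, simp add: o_def)

lemma C1_metric: "c \<in> \<A> \<Longrightarrow> C1_on (chart_image c) (\<lambda>x. metric f c x $ i $ j)"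
  unfolding metric_def vec_lambda_beta by (intro lorentz.C1_on_product C1_partial)

lemma C1_det_metric: "c \<in> \<A> \<Longrightarrow> C1_on (chart_image c) (\<lambda>x. det (metric f c x))"
  by (intro C1_on_det C1_metric)

lemma C1_frame:
  assumes c: "c \<in> \<A>"
  shows "C1_on (chart_image c) (\<lambda>x. frame c x e $ k)"
proof -
  have "1 + snd (param f c x) \<noteq> 0" for x
    using param_in_hyperbolic_space[of c x] unfolding hyperbolic_space_def by force
  then have "C1_on (chart_image c) (\<lambda>x. fst (partial i (param f c) x)
      + (- (snd (partial i (param f c) x) / (1 + snd (param f c x)))) *\<^sub>R fst (param f c x))" for i
    using bounded_linear_minus[OF bounded_linear_ident]
    by (intro C1_on_add C1_on_scaleR C1_on_bounded_linear[of uminus] C1_on_divide C1_on_const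
        C1_on_fst C1_on_snd C1_partial[OF c] C1_param[OF c]) auto
  then have "C1_on (chart_image c) (\<lambda>x. stereo (param f c x) (partial i (param f c) x) \<bullet> e)" for i
    unfolding stereo_def
    by (intro C1_on_bounded_linear[OF bounded_linear_inner_left]) (simp del: Ck_on.simps)
  then show ?thesis
    unfolding frame_def inv_metric_def
    by (intro C1_on_matrix_inv_mult chart_props(2)[OF c] C1_metric[OF c])
      (use det_metric_pos[OF c] in \<open>auto simp del: Ck_on.simps simp: less_imp_neq[THEN not_sym]\<close>)
qed

lemma continuous_tangent_frame:
  assumes "c \<in> \<A>"
  shows "continuous_on (chart_image c) (\<lambda>x. tangent_frame c x e)"
proof -
  have "continuous_on (chart_image c) (\<lambda>x. \<Sum>i\<in>UNIV. (frame c x e $ i) *\<^sub>R partial i (param f c) x)"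
    using C1_frame[OF assms] C1_partial[OF assms]
    by (intro continuous_on_sum continuous_on_scaleR C1_on_imp_continuous_on)
  then show ?thesis
    by (rule continuous_on_eq) (simp add: dparam_expansion[OF assms])
qed

lemma gradient_frame:
  assumes u: "C1_function u" and c: "c \<in> \<A>" and p: "p \<in> fst c"
  shows "gradient \<A> f u p = (\<Sum>e\<in>Basis. frechet_derivative (u \<circ> chart_inv c) (at (snd c p)) (frame c (snd c p) e)
    *\<^sub>R tangent_frame c (snd c p) e)"
proof -
  define d where "d = chart_at \<A> p"
  have d: "d \<in> \<A>" "p \<in> fst d" using chart_at_props by (auto simp: d_def)
  let ?x = "snd c p" and ?y = "snd d p"
  have y: "?y \<in> chart_image d" using d by auto
  have x: "?x \<in> overlap c d" "transition c d ?x = ?y"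
    using c p d chart_props(5)[OF c p] by (auto simp: transition_def)
  let ?r = "frame d ?y" and ?F = "\<lambda>j. partial j (param f d) ?y"
  let ?D = "frechet_derivative (u \<circ> chart_inv d) (at ?y)"
  have D: "?D v = (\<Sum>i\<in>UNIV. (v $ i) *\<^sub>R ?D (axis i 1))" for v
    by (rule linear_basis_expansion[OF has_derivative_linear[OF C1_on_has_derivative[OF C1_functionD[OF u d(1)] y]]])
  have "gradient \<A> f u p = (\<Sum>i\<in>UNIV. \<Sum>j\<in>UNIV. \<Sum>e\<in>Basis. (?r e $ i * ?D (axis i 1)) *\<^sub>R ?r e $ j *\<^sub>R ?F j)"
    unfolding gradient_def Let_def d_def[symmetric] inv_metric_frame[OF d(1) y]
    by (simp only: sum_distrib_right scaleR_sum_left) (simp add: partial_def mult_ac)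
  also have "\<dots> = (\<Sum>i\<in>UNIV. \<Sum>e\<in>Basis. \<Sum>j\<in>UNIV. (?r e $ i * ?D (axis i 1)) *\<^sub>R ?r e $ j *\<^sub>R ?F j)"
    by (rule sum.cong[OF refl], rule sum.swap)
  also have "\<dots> = (\<Sum>e\<in>Basis. \<Sum>i\<in>UNIV. \<Sum>j\<in>UNIV. (?r e $ i * ?D (axis i 1)) *\<^sub>R ?r e $ j *\<^sub>R ?F j)"
    by (rule sum.swap)
  also have "\<dots> = (\<Sum>e\<in>Basis. ?D (?r e) *\<^sub>R tangent_frame d ?y e)"
  proof (rule sum.cong[OF refl])
    fix e
    show "(\<Sum>i\<in>UNIV. \<Sum>j\<in>UNIV. (?r e $ i * ?D (axis i 1)) *\<^sub>R ?r e $ j *\<^sub>R ?F j)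
        = ?D (?r e) *\<^sub>R tangent_frame d ?y e"
      unfolding D[of "?r e"] dparam_expansion[OF d(1) y]
      by (simp only: scaleR_sum_left real_scaleR_def, simp only: scaleR_sum_right)
  qed
  also have "\<dots> = (\<Sum>e\<in>Basis. frechet_derivative (u \<circ> chart_inv c) (at ?x) (frame c ?x e) *\<^sub>R tangent_frame c ?x e)"
    unfolding derivative_change_chart[OF c d(1) x(1) C1_functionD[OF u d(1)]]
      tangent_frame_change_chart[OF c d(1) x(1), symmetric] frame_change_chart[OF c d(1) x(1), symmetric] x(2) ..
  finally show ?thesis .
qed

lemma lorentz_gradient:
  assumes u: "C1_function u" and c: "c \<in> \<A>" and p: "p \<in> fst c"
  shows "lorentz (gradient \<A> f u p) (dparam c (snd c p) v) = frechet_derivative (u \<circ> chart_inv c) (at (snd c p)) v"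
proof -
  let ?x = "snd c p" and ?D = "frechet_derivative (u \<circ> chart_inv c) (at (snd c p))"
  have x: "?x \<in> chart_image c" using p by auto
  have lin: "linear ?D"
    by (rule has_derivative_linear[OF C1_on_has_derivative[OF C1_functionD[OF u c] x]])
  have "lorentz (gradient \<A> f u p) (dparam c ?x v)
      = (\<Sum>e\<in>Basis. (stereo (param f c ?x) (dparam c ?x v) \<bullet> e) * ?D (frame c ?x e))"
    by (subst lorentz_commute, subst gradient_frame[OF u c p])
      (simp only: lorentz.sum_right lorentz.scaleR_right lorentz_frame[OF c x] real_scaleR_def mult.commute)
  also have "\<dots> = ?D (\<Sum>e\<in>Basis. (stereo (param f c ?x) (dparam c ?x v) \<bullet> e) *\<^sub>R frame c ?x e)"
    by (simp only: linear_sum[OF lin] linear_scale[OF lin] real_scaleR_def)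
  also have "\<dots> = ?D v" using frame_expansion[OF c x, of v] by simp
  finally show ?thesis .
qed

lemma gradient_tangent:
  assumes u: "C1_function u" and c: "c \<in> \<A>" and p: "p \<in> fst c"
  obtains v where "gradient \<A> f u p = dparam c (snd c p) v"
proof
  have x: "snd c p \<in> chart_image c" using p by auto
  show "gradient \<A> f u p = dparam c (snd c p)
      (\<Sum>e\<in>Basis. frechet_derivative (u \<circ> chart_inv c) (at (snd c p)) (frame c (snd c p) e) *\<^sub>R frame c (snd c p) e)"
    unfolding gradient_frame[OF u c p]
    by (simp only: linear_sum[OF linear_dparam[OF c x]] linear_scale[OF linear_dparam[OF c x]])
qed

lemma continuous_derivative_frame:
  assumes u: "C1_function u" and c: "c \<in> \<A>"
  shows "continuous_on (chart_image c) (\<lambda>x. frechet_derivative (u \<circ> chart_inv c) (at x) (frame c x e))"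
proof -
  note C1 = C1_functionD[OF u c]
  have "continuous_on (chart_image c)
      (\<lambda>x. \<Sum>i\<in>UNIV. (frame c x e $ i) *\<^sub>R frechet_derivative (u \<circ> chart_inv c) (at x) (axis i 1))"
    by (intro continuous_on_sum continuous_on_scaleR C1_on_imp_continuous_on[OF C1_frame[OF c]]
        C1_on_continuous_derivative[OF C1])
  then show ?thesis
    by (rule continuous_on_eq)
      (rule linear_basis_expansion[OF has_derivative_linear[OF C1_on_has_derivative[OF C1]], symmetric])
qed

lemma continuous_gradient:
  assumes u: "C1_function u"
  shows "continuous_on UNIV (gradient \<A> f u)"
proof (rule continuous_on_charts)
  fix c assume c: "c \<in> \<A>"
  have "continuous_on (chart_image c) (\<lambda>x. \<Sum>e\<in>Basis.
      frechet_derivative (u \<circ> chart_inv c) (at x) (frame c x e) *\<^sub>R tangent_frame c x e)"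
    by (intro continuous_on_sum continuous_on_scaleR continuous_derivative_frame[OF u c]
        continuous_tangent_frame[OF c])
  then show "continuous_on (chart_image c) (\<lambda>x. gradient \<A> f u (chart_inv c x))"
    by (rule continuous_on_eq) (simp add: gradient_frame[OF u c] chart_props(6,7)[OF c])
qed

end

section \<open>The volume measure\<close>

context immersion
begin

definition volume_density :: "('p, 'n) chart \<Rightarrow> real^'n \<Rightarrow> real" where
  "volume_density c x = indicator (chart_image c) x * sqrt (det (metric f c x))"

text \<open>The value outside the image of the chart is irrelevant because \<open>volume_density c\<close> vanishes there;
  any constant makes the function measurable on the whole space.\<close>

definition chart_inv_total :: "('p, 'n) chart \<Rightarrow> real^'n \<Rightarrow> 'p" where
  "chart_inv_total c x = (if x \<in> chart_image c then chart_inv c x else undefined)"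

definition chart_measure :: "('p, 'n) chart \<Rightarrow> 'p measure" where
  "chart_measure c = distr (density lborel (volume_density c)) borel (chart_inv_total c)"

lemma volume_density_nonneg: "c \<in> \<A> \<Longrightarrow> volume_density c x \<ge> 0"
  using det_metric_pos[of c x] by (auto simp: volume_density_def indicator_def intro: less_imp_le)

lemma measurable_volume_density [measurable]:
  assumes "c \<in> \<A>"
  shows "volume_density c \<in> borel_measurable borel"
proof -
  have "continuous_on (chart_image c) (\<lambda>x. sqrt (det (metric f c x)))"
    by (intro continuous_on_real_sqrt C1_on_imp_continuous_on C1_det_metric assms)
  from borel_measurable_continuous_on_indicator[OF borel_open[OF chart_props(2)[OF assms]] this]
  show ?thesis unfolding volume_density_def[abs_def] by simp
qed

lemma measurable_chart_inv_total [measurable]: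
  assumes "c \<in> \<A>"
  shows "chart_inv_total c \<in> borel_measurable borel"
  unfolding chart_inv_total_def[abs_def]
  by (intro borel_measurable_continuous_on_if borel_open chart_props[OF assms] continuous_on_const)

lemma image_chart_eq:
  assumes "c \<in> \<A>" "B \<subseteq> fst c"
  shows "snd c ` B = chart_inv_total c -` B \<inter> chart_image c"
proof (intro set_eqI iffI)
  show "x \<in> chart_inv_total c -` B \<inter> chart_image c" if x: "x \<in> snd c ` B" for x
  proof -
    obtain p where p: "p \<in> B" "x = snd c p" using x by blast
    then have "chart_inv c x = p" using assms(2) chart_props(5)[OF assms(1)] by blast
    with p assms(2) show ?thesis by (auto simp: chart_inv_total_def)
  qed
  show "x \<in> snd c ` B" if "x \<in> chart_inv_total c -` B \<inter> chart_image c" for x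
  proof -
    have "chart_inv c x \<in> B" "x = snd c (chart_inv c x)"
      using that chart_props(7)[OF assms(1), of x] by (auto simp: chart_inv_total_def)
    then show ?thesis by blast
  qed
qed

lemma measurable_image_chart:
  assumes "c \<in> \<A>" "B \<in> sets borel" "B \<subseteq> fst c"
  shows "snd c ` B \<in> sets borel"
  unfolding image_chart_eq[OF assms(1,3)]
  using measurable_sets[OF measurable_chart_inv_total[OF assms(1)] assms(2)] borel_open[OF chart_props(2)[OF assms(1)]]
  by simp

lemma sets_chart_measure [simp]: "sets (chart_measure c) = sets borel"
  by (simp add: chart_measure_def)

lemma emeasure_chart_measure:
  assumes c: "c \<in> \<A>" and B: "B \<in> sets borel"
  shows "emeasure (chart_measure c) B = (\<integral>\<^sup>+x\<in>snd c ` (B \<inter> fst c). ennreal (sqrt (det (metric f c x))) \<partial>lborel)"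
proof -
  have "emeasure (chart_measure c) B
      = (\<integral>\<^sup>+x. ennreal (volume_density c x) * indicator (chart_inv_total c -` B) x \<partial>lborel)"
    unfolding chart_measure_def using c B measurable_sets[OF measurable_chart_inv_total[OF c] B]
    by (subst emeasure_distr) (auto simp: emeasure_density)
  also have "\<dots> = (\<integral>\<^sup>+x\<in>snd c ` (B \<inter> fst c). ennreal (sqrt (det (metric f c x))) \<partial>lborel)"
  proof (rule nn_integral_cong)
    fix x
    have "x \<in> snd c ` (B \<inter> fst c) \<longleftrightarrow> x \<in> chart_image c \<and> chart_inv_total c x \<in> B"
      using image_chart_eq[OF c, of "B \<inter> fst c"] chart_props(6)[OF c] by (auto simp: chart_inv_total_def)
    then show "ennreal (volume_density c x) * indicator (chart_inv_total c -` B) x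
        = ennreal (sqrt (det (metric f c x))) * indicator (snd c ` (B \<inter> fst c)) x"
      by (auto simp: volume_density_def indicator_def)
  qed
  finally show ?thesis .
qed

lemma metric_change_chart:
  assumes cd: "c \<in> \<A>" "d \<in> \<A>" and x: "x \<in> overlap c d"
  defines "J \<equiv> matrix (dtransition c d x)"
  shows "metric f c x = transpose J ** (metric f d (transition c d x) ** J)"
proof -
  have "metric f c x $ i $ j = (transpose J ** (metric f d (transition c d x) ** J)) $ i $ j" for i j
  proof -
    have J: "dtransition c d x (axis i 1) $ k = J $ k $ i" for i k
      by (simp add: J_def matrix_def)
    have "metric f c x $ i $ j = lorentz (dparam c x (axis i 1)) (dparam c x (axis j 1))"
      by (simp add: metric_def partial_def)
    also have "\<dots> = dtransition c d x (axis i 1) \<bullet> (metric f d (transition c d x) *v dtransition c d x (axis j 1))"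
      unfolding dparam_change_chart[OF cd x] by (rule lorentz_dparam(1)[OF cd(2) overlap_props(5)[OF cd x]])
    also have "\<dots> = (transpose J ** (metric f d (transition c d x) ** J)) $ i $ j"
      by (simp add: inner_vec_def matrix_vector_mult_def matrix_matrix_mult_def transpose_def J)
    finally show ?thesis .
  qed
  then show ?thesis by (simp add: vec_eq_iff)
qed

lemma volume_density_change_chart:
  assumes cd: "c \<in> \<A>" "d \<in> \<A>" and x: "x \<in> overlap c d"
  shows "sqrt (det (metric f c x))
    = \<bar>det (matrix (dtransition c d x))\<bar> * sqrt (det (metric f d (transition c d x)))"
proof -
  define J where "J = matrix (dtransition c d x)"
  have "det (metric f c x) = (det J)\<^sup>2 * det (metric f d (transition c d x))"
    using arg_cong[OF metric_change_chart[OF cd x], of det]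
    by (simp add: det_mul power2_eq_square J_def mult_ac)
  then show ?thesis by (simp add: real_sqrt_mult J_def)
qed

lemma chart_measure_compatible:
  assumes cd: "c \<in> \<A>" "d \<in> \<A>" and B: "B \<in> sets borel" "B \<subseteq> fst c" "B \<subseteq> fst d"
  shows "emeasure (chart_measure c) B = emeasure (chart_measure d) B"
proof -
  let ?S = "snd c ` B" and ?f = "\<lambda>y. sqrt (det (metric f d y))"
  have sub: "?S \<subseteq> overlap c d" using B by auto
  have image: "transition c d ` ?S = snd d ` B"
    using B(2) chart_props(5)[OF cd(1)] by (force simp: transition_def image_image)
  have eq: "\<bar>det (matrix (dtransition c d x))\<bar> * ?f (transition c d x) = sqrt (det (metric f c x))" if "x \<in> ?S" for x
    using volume_density_change_chart[OF cd] sub that by auto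
  have meas: "snd c ` B \<in> sets borel" "snd d ` B \<in> sets borel"
    using measurable_image_chart B cd by auto
  have density: "indicator (snd b ` B) x * sqrt (det (metric f b x)) = indicator (snd b ` B) x * volume_density b x"
    if "B \<subseteq> fst b" for b x
    using that by (auto simp: indicator_def volume_density_def)
  have "(\<integral>\<^sup>+y\<in>snd d ` B. ennreal (?f y) \<partial>lborel)
      = (\<integral>\<^sup>+x\<in>?S. ennreal (\<bar>det (matrix (dtransition c d x))\<bar> * ?f (transition c d x)) \<partial>lborel)"
    unfolding image[symmetric]
  proof (rule nn_integral_change_of_variables[OF meas(1)])
    show "(transition c d has_derivative dtransition c d x) (at x)" if "x \<in> ?S" for x
      using transition_has_derivative[OF cd] sub that by auto
    show "inj_on (transition c d) ?S"
      using overlap_props(7)[OF cd] sub by (metis (no_types, lifting) inj_onI subsetD)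
    show "?f y \<ge> 0" if "y \<in> transition c d ` ?S" for y
      using that B(3) det_metric_pos[OF cd(2), of y] unfolding image by (force intro: less_imp_le)
    show "(\<lambda>y. indicator (transition c d ` ?S) y * ?f y) \<in> borel_measurable borel"
      unfolding image density[OF B(3)] using meas(2) cd(2) by measurable
    have "(\<lambda>x. indicator ?S x * (\<bar>det (matrix (dtransition c d x))\<bar> * ?f (transition c d x)))
        = (\<lambda>x. indicator ?S x * volume_density c x)"
      unfolding density[OF B(2), symmetric] using eq by (auto simp: indicator_def fun_eq_iff)
    then show "(\<lambda>x. indicator ?S x * (\<bar>det (matrix (dtransition c d x))\<bar> * ?f (transition c d x))) \<in> borel_measurable borel"
      using meas(1) cd(1) by simp
  qed
  also have "\<dots> = (\<integral>\<^sup>+x\<in>?S. ennreal (sqrt (det (metric f c x))) \<partial>lborel)"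
    by (intro nn_integral_cong) (use eq in \<open>auto simp: indicator_def\<close>)
  finally show ?thesis
    using B by (simp add: emeasure_chart_measure[OF cd(1) B(1)] emeasure_chart_measure[OF cd(2) B(1)] Int_absorb2)
qed

definition is_volume_measure :: "'p measure \<Rightarrow> bool" where
  "is_volume_measure \<mu> \<longleftrightarrow> sets \<mu> = sets borel \<and>
    (\<forall>c\<in>\<A>. \<forall>B\<in>sets borel. B \<subseteq> fst c \<longrightarrow>
       emeasure \<mu> B = (\<integral>\<^sup>+x\<in>snd c ` B. ennreal (sqrt (det (metric f c x))) \<partial>lborel))"

lemma is_volume_measure_iff:
  "is_volume_measure \<mu> \<longleftrightarrow> sets \<mu> = sets borel \<and>
    (\<forall>c\<in>\<A>. \<forall>B\<in>sets borel. B \<subseteq> fst c \<longrightarrow> emeasure \<mu> B = emeasure (chart_measure c) B)"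
  unfolding is_volume_measure_def by (auto simp: emeasure_chart_measure Int_absorb2)

lemma countable_atlas:
  "\<exists>cs :: nat \<Rightarrow> ('p, 'n) chart. range cs \<subseteq> \<A> \<and> (\<Union>i. fst (cs i)) = UNIV"
proof -
  obtain \<F> where \<F>: "\<F> \<subseteq> fst ` \<A>" "countable \<F>" "\<Union>\<F> = \<Union>(fst ` \<A>)"
    using Lindelof[of "fst ` \<A>"] chart_props(1) by blast
  obtain C where C: "C \<subseteq> \<A>" "countable C" "fst ` C = \<F>"
    using \<F>(1,2) countable_subset_image[of \<F> fst \<A>] by metis
  have cover: "(\<Union>c\<in>C. fst c) = UNIV"
    using C(3) \<F>(3) exists_chart by auto
  then have "C \<noteq> {}" by auto
  show ?thesis
  proof (intro exI conjI)
    show "range (from_nat_into C) \<subseteq> \<A>" using range_from_nat_into[OF \<open>C \<noteq> {}\<close> C(2)] C(1) by simp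
    show "(\<Union>i. fst (from_nat_into C i)) = UNIV"
    proof (intro equalityI subset_UNIV subsetI)
      fix p
      obtain c where "c \<in> C" "p \<in> fst c" using cover by blast
      then show "p \<in> (\<Union>i. fst (from_nat_into C i))" using from_nat_into_surj[OF C(2)] by fastforce
    qed
  qed
qed

text \<open>A disjoint countable subdivision of the manifold into Borel sets, each in the domain of a chart,
  determines the measure; the chart measures glue because of the change of variables formula.\<close>

lemma exists_volume_measure: "\<exists>!\<mu>. is_volume_measure \<mu>"
proof -
  obtain cs :: "nat \<Rightarrow> ('p, 'n) chart" where cs: "range cs \<subseteq> \<A>" "(\<Union>i. fst (cs i)) = UNIV"
    using countable_atlas by metis
  have cs': "cs i \<in> \<A>" for i using cs(1) by auto
  define P where "P = disjointed (\<lambda>i. fst (cs i))"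
  have P: "P i \<in> sets borel" "P i \<subseteq> fst (cs i)" "disjoint_family P" "(\<Union>i. P i) = UNIV" for i
  proof -
    have "range (\<lambda>i. fst (cs i)) \<subseteq> sets borel"
      using chart_props(1)[OF cs'] by auto
    then have "range P \<subseteq> sets borel"
      unfolding P_def using sets.range_disjointed_sets[of "\<lambda>i. fst (cs i)" borel] by simp
    then show "P i \<in> sets borel" by auto
  qed (use cs(2) in \<open>auto simp: P_def UN_disjointed_eq disjoint_family_disjointed intro: disjointed_subset[THEN subsetD]\<close>)
  have split: "emeasure \<mu> B = (\<Sum>i. emeasure \<mu> (B \<inter> P i))" if "sets \<mu> = sets borel" "B \<in> sets borel" for \<mu> B
  proof -
    have "(\<Sum>i. emeasure \<mu> (B \<inter> P i)) = emeasure \<mu> (\<Union>i. B \<inter> P i)"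
    proof (rule suminf_emeasure)
      show "disjoint_family (\<lambda>i. B \<inter> P i)" using P(3) unfolding disjoint_family_on_def by blast
    qed (use that P(1) in auto)
    also have "(\<Union>i. B \<inter> P i) = B" using P(4) by blast
    finally show ?thesis by simp
  qed
  define \<nu> where "\<nu> B = (\<Sum>i. emeasure (chart_measure (cs i)) (B \<inter> P i))" for B
  define \<mu> where "\<mu> = measure_of UNIV (sets borel) \<nu>"
  have sets_\<mu>: "sets \<mu> = sets borel"
    unfolding \<mu>_def using sets.sigma_sets_eq[of borel] by (simp add: space_borel[symmetric] sets.space_closed del: space_borel)
  have "countably_additive (sets borel) \<nu>"
  proof (rule countably_additiveI)
    fix A :: "nat \<Rightarrow> 'p set"
    assume A: "range A \<subseteq> sets borel" "disjoint_family A"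
    have "(\<Sum>k. \<nu> (A k)) = (\<Sum>k. \<integral>\<^sup>+i. emeasure (chart_measure (cs i)) (A k \<inter> P i) \<partial>count_space UNIV)"
      by (simp add: \<nu>_def nn_integral_count_space_nat)
    also have "\<dots> = (\<integral>\<^sup>+i. (\<Sum>k. emeasure (chart_measure (cs i)) (A k \<inter> P i)) \<partial>count_space UNIV)"
      by (rule nn_integral_suminf[symmetric]) simp
    also have "\<dots> = (\<integral>\<^sup>+i. emeasure (chart_measure (cs i)) (\<Union>k. A k \<inter> P i) \<partial>count_space UNIV)"
      by (intro nn_integral_cong suminf_emeasure) (use A P(1) in \<open>auto simp: disjoint_family_on_def\<close>)
    also have "\<dots> = \<nu> (\<Union>k. A k)"
      by (simp add: \<nu>_def nn_integral_count_space_nat)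
    finally show "(\<Sum>k. \<nu> (A k)) = \<nu> (\<Union>k. A k)" .
  qed
  then have emeasure_\<mu>: "emeasure \<mu> B = \<nu> B" if "B \<in> sets borel" for B
    unfolding \<mu>_def using that sets.sigma_algebra_axioms[of borel]
    by (intro emeasure_measure_of_sigma) (auto simp: positive_def \<nu>_def)
  show ?thesis
  proof (rule ex1I)
    show "is_volume_measure \<mu>"
      unfolding is_volume_measure_iff
    proof (intro conjI sets_\<mu> ballI impI)
      fix c B
      assume c: "c \<in> \<A>" and B: "B \<in> sets borel" "B \<subseteq> fst c"
      have "emeasure \<mu> B = (\<Sum>i. emeasure (chart_measure (cs i)) (B \<inter> P i))"
        using emeasure_\<mu>[OF B(1)] by (simp add: \<nu>_def)
      also have "\<dots> = (\<Sum>i. emeasure (chart_measure c) (B \<inter> P i))"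
        using B P(1,2) by (intro suminf_cong chart_measure_compatible cs' c) auto
      also have "\<dots> = emeasure (chart_measure c) B" using split[OF sets_chart_measure B(1)] by simp
      finally show "emeasure \<mu> B = emeasure (chart_measure c) B" .
    qed
  next
    fix \<mu>' assume \<mu>': "is_volume_measure \<mu>'"
    show "\<mu>' = \<mu>"
    proof (rule measure_eqI)
      show "sets \<mu>' = sets \<mu>" using \<mu>' sets_\<mu> by (simp add: is_volume_measure_def)
      fix B assume "B \<in> sets \<mu>'"
      then have B: "B \<in> sets borel" and sets: "sets \<mu>' = sets borel"
        using \<mu>' by (auto simp: is_volume_measure_def)
      have "emeasure \<mu>' (B \<inter> P i) = emeasure (chart_measure (cs i)) (B \<inter> P i)" for i
        using \<mu>' B P(1,2)[of i] cs' unfolding is_volume_measure_iff by (meson inf.coboundedI2 sets.Int)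
      then show "emeasure \<mu>' B = emeasure \<mu> B"
        using split[OF sets B] emeasure_\<mu>[OF B] by (simp add: \<nu>_def)
    qed
  qed
qed

abbreviation volume :: "'p measure" where
  "volume \<equiv> volume_measure \<A> f"

lemma volume_props:
  shows sets_volume: "sets volume = sets borel"
    and emeasure_volume: "c \<in> \<A> \<Longrightarrow> B \<in> sets borel \<Longrightarrow> B \<subseteq> fst c \<Longrightarrow> emeasure volume B = emeasure (chart_measure c) B"
proof -
  have "is_volume_measure volume"
    using theI'[OF exists_volume_measure] unfolding volume_measure_def is_volume_measure_def .
  then show "sets volume = sets borel"
    "c \<in> \<A> \<Longrightarrow> B \<in> sets borel \<Longrightarrow> B \<subseteq> fst c \<Longrightarrow> emeasure volume B = emeasure (chart_measure c) B"
    unfolding is_volume_measure_iff by blast+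
qed

lemma measurable_volume [simp]: "borel_measurable volume = borel_measurable borel"
  by (rule measurable_cong_sets[OF sets_volume refl])

lemma space_volume [simp]: "space volume = UNIV"
  using sets_eq_imp_space_eq[OF sets_volume] by simp

lemma density_volume_chart:
  assumes c: "c \<in> \<A>"
  shows "density volume (indicator (fst c)) = chart_measure c"
proof (rule measure_eqI)
  show "sets (density volume (indicator (fst c))) = sets (chart_measure c)" by (simp add: sets_volume)
  fix B assume "B \<in> sets (density volume (indicator (fst c)))"
  then have B: "B \<in> sets borel" by (simp add: sets_volume)
  have open_c: "fst c \<in> sets borel" using chart_props(1)[OF c] by simp
  have "emeasure (density volume (indicator (fst c))) B = (\<integral>\<^sup>+p. indicator (fst c) p * indicator B p \<partial>volume)"
    using B open_c by (intro emeasure_density) (auto simp: sets_volume)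
  also have "\<dots> = (\<integral>\<^sup>+p. indicator (B \<inter> fst c) p \<partial>volume)"
    by (intro nn_integral_cong) (auto simp: indicator_def)
  also have "\<dots> = emeasure volume (B \<inter> fst c)"
    using B open_c by (intro nn_integral_indicator) (auto simp: sets_volume)
  also have "\<dots> = emeasure (chart_measure c) (B \<inter> fst c)"
    using B open_c by (intro emeasure_volume[OF c]) auto
  also have "\<dots> = emeasure (chart_measure c) B"
    using emeasure_chart_measure[OF c] B open_c by simp
  finally show "emeasure (density volume (indicator (fst c))) B = emeasure (chart_measure c) B" .
qed

text \<open>Integration in coordinates: the volume measure restricted to the domain of a chart is the image of
  the Lebesgue measure with density \<open>volume_density c\<close>.\<close>

lemma has_bochner_integral_chart:
  fixes h :: "'p \<Rightarrow> real"
  assumes c: "c \<in> \<A>" and h: "h \<in> borel_measurable borel" "\<And>p. p \<notin> fst c \<Longrightarrow> h p = 0"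
  shows "has_bochner_integral volume h I
    \<longleftrightarrow> has_bochner_integral lborel (\<lambda>x. volume_density c x * h (chart_inv c x)) I"
proof -
  let ?\<kappa> = "chart_inv_total c"
  have eq: "h = (\<lambda>p. indicator (fst c) p *\<^sub>R h p)" "(\<lambda>x. volume_density c x * h (chart_inv c x)) = (\<lambda>x. volume_density c x *\<^sub>R h (?\<kappa> x))"
    using h(2) by (auto simp: fun_eq_iff indicator_def volume_density_def chart_inv_total_def)
  have open_c: "(\<lambda>p. indicator (fst c) p :: real) \<in> borel_measurable borel" using chart_props(1)[OF c] by simp
  have \<kappa>: "?\<kappa> \<in> density lborel (volume_density c) \<rightarrow>\<^sub>M borel"
    using measurable_chart_inv_total[OF c] by simp
  have h\<kappa>: "(\<lambda>x. h (?\<kappa> x)) \<in> borel_measurable lborel"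
    using measurable_compose[OF measurable_chart_inv_total[OF c] h(1)] by simp
  have dens: "density volume (\<lambda>p. ennreal (indicator (fst c) p)) = distr (density lborel (volume_density c)) borel ?\<kappa>"
    using density_volume_chart[OF c] unfolding chart_measure_def by (simp add: ennreal_indicator)
  have vd: "volume_density c \<in> borel_measurable lborel" "AE x in lborel. 0 \<le> volume_density c x"
    using c volume_density_nonneg by simp_all
  have i: "(\<lambda>p. indicator (fst c) p :: real) \<in> borel_measurable volume" "AE p in volume. 0 \<le> (indicator (fst c) p :: real)"
    "h \<in> borel_measurable volume"
    using open_c h(1) by simp_all
  have "integrable volume h \<longleftrightarrow> integrable (density volume (\<lambda>p. ennreal (indicator (fst c) p))) h"
    by (subst (1) eq(1)) (rule integrable_density[OF i(3,1,2), symmetric])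
  also have "\<dots> \<longleftrightarrow> integrable lborel (\<lambda>x. volume_density c x *\<^sub>R h (?\<kappa> x))"
    unfolding dens integrable_distr_eq[OF \<kappa> h(1)] by (rule integrable_density[OF h\<kappa> vd])
  moreover have "(LINT p|volume. h p) = (LINT p|density volume (\<lambda>p. ennreal (indicator (fst c) p)). h p)"
    by (subst (1) eq(1)) (rule integral_density[OF i(3,1,2), symmetric])
  moreover have "\<dots> = (LINT x|lborel. volume_density c x *\<^sub>R h (?\<kappa> x))"
    unfolding dens integral_distr[OF \<kappa> h(1)] by (rule integral_density[OF h\<kappa> vd])
  ultimately show ?thesis
    unfolding eq(2) by (simp add: has_bochner_integral_iff)
qed

lemma exists_chart_ball:
  obtains c r where "c \<in> \<A>" "p \<in> fst c" "r > 0" "cball (snd c p) r \<subseteq> chart_image c"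
proof -
  obtain c where c: "c \<in> \<A>" "p \<in> fst c" using exists_chart by blast
  then obtain r where "r > 0" "cball (snd c p) r \<subseteq> chart_image c"
    using chart_props(2)[OF c(1)] open_contains_cball by (metis imageI)
  with c that show ?thesis by blast
qed

lemma open_chart_ball:
  assumes "c \<in> \<A>"
  shows "open (fst c \<inter> snd c -` ball x r)"
  by (rule continuous_open_preimage[OF chart_props(3,1)[OF assms]]) simp

lemma compact_chart_ball:
  assumes "c \<in> \<A>" "cball x r \<subseteq> chart_image c"
  shows "compact (fst c \<inter> snd c -` cball x r)"
proof -
  have "fst c \<inter> snd c -` cball x r = chart_inv c ` cball x r"
    using assms(2) chart_props(5-7)[OF assms(1)] by (force simp: image_iff)
  then show ?thesis
    using continuous_on_subset[OF chart_props(4)[OF assms(1)] assms(2)] by (simp add: compact_continuous_image)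
qed

lemma emeasure_volume_compact:
  assumes "compact K"
  shows "emeasure volume K < \<infinity>"
proof -
  have "\<exists>N. open N \<and> p \<in> N \<and> emeasure volume N < \<infinity>" for p
  proof -
    obtain c r where c: "c \<in> \<A>" "p \<in> fst c" and r: "r > 0" "cball (snd c p) r \<subseteq> chart_image c"
      by (rule exists_chart_ball)
    let ?N = "fst c \<inter> snd c -` ball (snd c p) r"
    have N: "open ?N" "p \<in> ?N" using open_chart_ball[OF c(1)] c(2) r(1) by auto
    have "continuous_on (cball (snd c p) r) (\<lambda>x. sqrt (det (metric f c x)))"
      by (intro continuous_on_real_sqrt continuous_on_subset[OF C1_on_imp_continuous_on[OF C1_det_metric[OF c(1)]] r(2)])
    then have "bounded ((\<lambda>x. sqrt (det (metric f c x))) ` cball (snd c p) r)"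
      by (intro compact_imp_bounded compact_continuous_image) auto
    then obtain m where m: "\<And>x. x \<in> cball (snd c p) r \<Longrightarrow> sqrt (det (metric f c x)) \<le> m"
      unfolding bounded_iff by (metis abs_le_D1 image_eqI real_norm_def)
    have "emeasure volume ?N = (\<integral>\<^sup>+x\<in>snd c ` ?N. ennreal (sqrt (det (metric f c x))) \<partial>lborel)"
      using emeasure_volume[OF c(1)] emeasure_chart_measure[OF c(1)] N(1) by (simp add: Int_commute)
    also have "\<dots> \<le> (\<integral>\<^sup>+x. ennreal m * indicator (cball (snd c p) r) x \<partial>lborel)"
      using m by (intro nn_integral_mono) (auto simp: indicator_def intro: ennreal_leI)
    also have "\<dots> = ennreal m * emeasure lborel (cball (snd c p) r)"
      by (simp add: nn_integral_cmult_indicator)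
    also have "\<dots> < \<infinity>"
      using emeasure_bounded_finite[OF bounded_cball, of "snd c p" r]
      by (simp add: ennreal_mult_less_top)
    finally show ?thesis using N by blast
  qed
  then obtain N where N: "\<And>p. open (N p)" "\<And>p. p \<in> N p" "\<And>p. emeasure volume (N p) < \<infinity>" by metis
  have "K \<subseteq> (\<Union>p\<in>UNIV. N p)" using N(2) by blast
  then obtain T where T: "finite T" "K \<subseteq> (\<Union>p\<in>T. N p)"
    using compactE_image[OF assms, of UNIV N] N(1) by metis
  have "emeasure volume K \<le> emeasure volume (\<Union>p\<in>T. N p)"
    using T N(1) by (intro emeasure_mono) (auto simp: sets_volume)
  also have "\<dots> \<le> (\<Sum>p\<in>T. emeasure volume (N p))"
    using T N(1) by (intro emeasure_subadditive_finite) (auto simp: sets_volume)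
  also have "\<dots> < \<infinity>" using N(3) T(1) by simp
  finally show ?thesis .
qed

lemma integrable_compact_support:
  fixes h :: "'p \<Rightarrow> real"
  assumes h: "continuous_on UNIV h" and K: "compact K" "\<And>p. p \<notin> K \<Longrightarrow> h p = 0"
  shows "integrable volume h"
proof -
  have "bounded (h ` K)"
    using K(1) continuous_on_subset[OF h] by (intro compact_imp_bounded compact_continuous_image) auto
  then obtain m where m: "\<And>p. p \<in> K \<Longrightarrow> norm (h p) \<le> m" unfolding bounded_iff by auto
  show ?thesis
    using emeasure_volume_compact[OF K(1)] m K borel_measurable_continuous_onI[OF h]
    by (intro integrableI_bounded_set[of K _ _ m]) (auto simp: sets_volume compact_imp_closed)
qed

end

section \<open>The height function of a minimal submanifold\<close>

context immersion
begin

lemma det_metric_neq_0: "c \<in> \<A> \<Longrightarrow> x \<in> chart_image c \<Longrightarrow> det (metric f c x) \<noteq> 0"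
  using det_metric_pos by force

text \<open>For an orthonormal frame this is the definition of the trace. A Parseval frame gives the same
  value, because its reproducing formula expresses each coordinate of \<open>L\<close> by frame coefficients.\<close>

lemma trace_frame:
  assumes c: "c \<in> \<A>" and x: "x \<in> chart_image c" and L: "linear L"
  shows "(\<Sum>e\<in>Basis. lorentz (dparam c x (L (frame c x e))) (tangent_frame c x e)) = (\<Sum>k\<in>UNIV. L (axis k 1) $ k)"
proof -
  have expand: "L (axis k 1) $ k
      = (\<Sum>e\<in>Basis. lorentz (dparam c x (L (axis k 1))) (tangent_frame c x e) * frame c x e $ k)" for k
    by (subst frame_expansion[OF c x, of "L (axis k 1)"]) (simp add: lorentz_frame[OF c x] del: o_apply)
  have "lorentz (dparam c x (L (frame c x e))) (tangent_frame c x e)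
      = (\<Sum>k\<in>UNIV. lorentz (dparam c x (L (axis k 1))) (tangent_frame c x e) * frame c x e $ k)" for e
    by (subst linear_basis_expansion[OF L])
      (simp add: linear_sum[OF linear_dparam[OF c x]] linear_scale[OF linear_dparam[OF c x]]
        lorentz.sum_left lorentz.scaleR_left mult.commute)
  then show ?thesis
    unfolding expand by (simp add: sum.swap[of _ UNIV Basis])
qed

lemma sum_lorentz_frame:
  assumes "c \<in> \<A>" "x \<in> chart_image c"
  shows "(\<Sum>e\<in>Basis. lorentz (tangent_frame c x e) (tangent_frame c x e)) = real CARD('n)"
  using trace_frame[OF assms linear_id] by simp

text \<open>Differentiate \<open>\<langle>\<partial>\<^sub>w F, F\<rangle> = 0\<close>.\<close>

lemma lorentz_hess_param:
  assumes c: "c \<in> \<A>" and x: "x \<in> chart_image c"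
  shows "lorentz (hess c x v w) (param f c x) = - lorentz (dparam c x v) (dparam c x w)"
proof -
  have "((\<lambda>y. lorentz (dparam c y w) (param f c y)) has_derivative
      (\<lambda>v. lorentz (dparam c x w) (dparam c x v) + lorentz (hess c x v w) (param f c x))) (at x)"
    by (rule lorentz.FDERIV[OF C1_on_has_derivative[OF C1_dparam[OF c] x] C1_on_has_derivative[OF C1_param[OF c] x]])
  then have "((\<lambda>y. 0 :: real) has_derivative
      (\<lambda>v. lorentz (dparam c x w) (dparam c x v) + lorentz (hess c x v w) (param f c x))) (at x)"
    by (rule has_derivative_transform_within_open[OF _ chart_props(2)[OF c] x]) (rule dparam_orthogonal[OF c])
  from has_derivative_unique[OF this has_derivative_const]
  have "lorentz (dparam c x w) (dparam c x v) + lorentz (hess c x v w) (param f c x) = 0"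
    by (rule fun_cong)
  then show ?thesis using lorentz_commute[of "dparam c x w"] by simp
qed

text \<open>The derivative of the volume density: since the metric is the Gram matrix of the coordinate
  fields, Jacobi's formula turns into a trace over the frame.\<close>

lemma derivative_sqrt_det_metric:
  assumes c: "c \<in> \<A>" and x: "x \<in> chart_image c"
  shows "((\<lambda>y. sqrt (det (metric f c y))) has_derivative
    (\<lambda>v. sqrt (det (metric f c x)) * (\<Sum>e\<in>Basis. lorentz (hess c x v (frame c x e)) (tangent_frame c x e)))) (at x)"
proof -
  let ?g = "\<lambda>y. metric f c y" and ?F = "\<lambda>i. partial i (param f c)" and ?r = "frame c x"
  let ?H = "\<lambda>v i. hess c x v (axis i 1)"
  define T where "T v = (\<Sum>e\<in>Basis. lorentz (hess c x v (?r e)) (tangent_frame c x e))" for v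
  have "((\<lambda>y. lorentz (?F i y) (?F j y)) has_derivative
      (\<lambda>v. lorentz (?F i x) (?H v j) + lorentz (?H v i) (?F j x))) (at x)" for i j
    unfolding partial_def
    by (rule lorentz.FDERIV[OF C1_on_has_derivative[OF C1_dparam[OF c] x] C1_on_has_derivative[OF C1_dparam[OF c] x]])
  then have "((\<lambda>y. ?g y $ i $ j) has_derivative
      (\<lambda>v. lorentz (?F i x) (?H v j) + lorentz (?H v i) (?F j x))) (at x)" for i j
    by (simp add: metric_def)
  from has_derivative_det[OF this det_metric_neq_0[OF c x]]
  have "((\<lambda>y. det (?g y)) has_derivative (\<lambda>v. det (?g x) * (\<Sum>i\<in>UNIV. \<Sum>j\<in>UNIV.
      inv_metric f c x $ j $ i * (lorentz (?F i x) (?H v j) + lorentz (?H v i) (?F j x))))) (at x)"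
    unfolding inv_metric_def .
  moreover have "(\<Sum>i\<in>UNIV. \<Sum>j\<in>UNIV. inv_metric f c x $ j $ i * (lorentz (?F i x) (?H v j) + lorentz (?H v i) (?F j x)))
      = 2 * T v" for v
  proof -
    have T: "T v = (\<Sum>i\<in>UNIV. \<Sum>j\<in>UNIV. inv_metric f c x $ i $ j * lorentz (?H v i) (?F j x))"
    proof -
      have "T v = (\<Sum>e\<in>Basis. \<Sum>i\<in>UNIV. \<Sum>j\<in>UNIV. ?r e $ i * ?r e $ j * lorentz (?H v i) (?F j x))"
        unfolding T_def
      proof (rule sum.cong[OF refl])
        fix e
        show "lorentz (hess c x v (?r e)) (tangent_frame c x e)
            = (\<Sum>i\<in>UNIV. \<Sum>j\<in>UNIV. ?r e $ i * ?r e $ j * lorentz (?H v i) (?F j x))"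
          by (rule trans[OF arg_cong2[where f=lorentz, OF hess_expansion_right[OF c x] dparam_expansion[OF c x]]])
            (simp only: lorentz.sum_left lorentz.scaleR_left,
              simp only: lorentz.sum_right lorentz.scaleR_right real_scaleR_def sum_distrib_left mult.assoc)
      qed
      also have "\<dots> = (\<Sum>i\<in>UNIV. \<Sum>j\<in>UNIV. \<Sum>e\<in>Basis. ?r e $ i * ?r e $ j * lorentz (?H v i) (?F j x))"
        by (subst sum.swap) (rule sum.cong[OF refl], rule sum.swap)
      finally show ?thesis by (simp add: inv_metric_frame[OF c x] sum_distrib_right)
    qed
    have sym: "inv_metric f c x $ j $ i = inv_metric f c x $ i $ j" for i j
      by (simp add: inv_metric_frame[OF c x] mult.commute)
    have "(\<Sum>i\<in>UNIV. \<Sum>j\<in>UNIV. inv_metric f c x $ j $ i * lorentz (?F i x) (?H v j)) = T v"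
      unfolding T by (subst sum.swap) (simp add: lorentz_commute[of "?F _ x"])
    moreover have "(\<Sum>i\<in>UNIV. \<Sum>j\<in>UNIV. inv_metric f c x $ j $ i * lorentz (?H v i) (?F j x)) = T v"
      unfolding T by (simp only: sym)
    ultimately show ?thesis by (simp add: distrib_left sum.distrib)
  qed
  ultimately have "((\<lambda>y. det (?g y)) has_derivative (\<lambda>v. det (?g x) * (2 * T v))) (at x)" by simp
  moreover have "(sqrt has_derivative (\<lambda>t. inverse (sqrt (det (?g x))) / 2 * t)) (at (det (?g x)))"
    using DERIV_real_sqrt[OF det_metric_pos[OF c x]] unfolding has_field_derivative_def .
  ultimately have "((\<lambda>y. sqrt (det (?g y))) has_derivative
      (\<lambda>v. inverse (sqrt (det (?g x))) / 2 * (det (?g x) * (2 * T v)))) (at x)"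
    by (rule has_derivative_compose)
  moreover have "inverse (sqrt (det (?g x))) / 2 * (det (?g x) * (2 * t)) = sqrt (det (?g x)) * t" for t
    using det_metric_pos[OF c x] by (simp add: field_simps)
  ultimately have "((\<lambda>y. sqrt (det (?g y))) has_derivative (\<lambda>v. sqrt (det (?g x)) * T v)) (at x)"
    by (simp only:)
  then show ?thesis unfolding T_def .
qed

abbreviation height :: "'p \<Rightarrow> real" where
  "height \<equiv> \<lambda>p. snd (f p)"

lemma height_pos: "height p > 0"
  using in_hyperbolic_space[of p] by (simp add: hyperbolic_space_def)

lemma C1_height: "C1_function height"
  unfolding C1_function_def
proof
  fix c assume "c \<in> \<A>"
  then show "C1_on (chart_image c) (height \<circ> chart_inv c)"
    using C1_on_snd[OF C1_param] unfolding o_def by blast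
qed

text \<open>The coordinates of the gradient of the height function.\<close>

definition height_gradient :: "('p, 'n) chart \<Rightarrow> real^'n \<Rightarrow> real^'n" where
  "height_gradient c x = matrix_inv (metric f c x) *v (\<chi> k. snd (partial k (param f c) x))"

lemma C1_height_gradient:
  "c \<in> \<A> \<Longrightarrow> C1_on (chart_image c) (\<lambda>x. height_gradient c x $ k)"
  unfolding height_gradient_def
  by (rule C1_on_matrix_inv_mult[OF chart_props(2) C1_metric])
    (auto simp del: Ck_on.simps simp: det_metric_neq_0 intro!: C1_on_snd C1_partial)

lemma lorentz_height_gradient:
  assumes c: "c \<in> \<A>" and x: "x \<in> chart_image c"
  shows "lorentz (dparam c x v) (dparam c x (height_gradient c x)) = snd (dparam c x v)"
proof -
  have "metric f c x *v height_gradient c x = (\<chi> k. snd (partial k (param f c) x))"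
    unfolding height_gradient_def
    by (simp add: matrix_vector_mul_assoc matrix_inv_mult(2)[OF det_metric_neq_0[OF c x]])
  then show ?thesis
    unfolding lorentz_dparam(1)[OF c x]
    by (simp add: dparam_expansion[OF c x, of v] inner_vec_def linear_sum[OF bounded_linear.linear[OF bounded_linear_snd]])
qed

lemma gradient_height:
  assumes c: "c \<in> \<A>" and p: "p \<in> fst c"
  shows "gradient \<A> f height p = dparam c (snd c p) (height_gradient c (snd c p))"
proof -
  let ?x = "snd c p"
  have x: "?x \<in> chart_image c" using p by auto
  obtain w where w: "gradient \<A> f height p = dparam c ?x w"
    by (rule gradient_tangent[OF C1_height c p])
  have "frechet_derivative (height \<circ> chart_inv c) (at ?x) v = snd (dparam c ?x v)" for v
  proof -
    have "((\<lambda>y. snd (param f c y)) has_derivative (\<lambda>v. snd (dparam c ?x v))) (at ?x)"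
      by (rule bounded_linear.has_derivative[OF bounded_linear_snd C1_on_has_derivative[OF C1_param[OF c] x]])
    then have "frechet_derivative (\<lambda>y. snd (param f c y)) (at ?x) = (\<lambda>v. snd (dparam c ?x v))"
      by (rule frechet_derivative_at[symmetric])
    moreover have "height \<circ> chart_inv c = (\<lambda>y. snd (param f c y))" by auto
    ultimately show ?thesis by (simp only:)
  qed
  then have "lorentz (dparam c ?x v) (dparam c ?x w) = lorentz (dparam c ?x v) (dparam c ?x (height_gradient c ?x))" for v
    using lorentz_gradient[OF C1_height c p, of v] w lorentz_height_gradient[OF c x, of v]
    by (simp add: lorentz_commute)
  then show ?thesis using lorentz_dparam_nondegenerate[OF c x] w by metis
qed

text \<open>The squared length of the tangential part of the time vector \<open>(0, -1)\<close> is at most that of its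
  projection to the tangent space of the hyperboloid, which is \<open>height\<^sup>2 - 1\<close>. The tangential part
  \<open>w\<close> satisfies \<open>\<langle>w, w\<rangle> = snd w\<close>, and the bound is the Cauchy-Schwarz inequality for the spatial
  parts of \<open>w\<close> and \<open>f p\<close>.\<close>

lemma gradient_height_le: "lorentz (gradient \<A> f height p) (gradient \<A> f height p) \<le> (height p)\<^sup>2"
proof -
  obtain c where c: "c \<in> \<A>" "p \<in> fst c" using exists_chart by blast
  have x: "snd c p \<in> chart_image c" using c by auto
  define w where "w = gradient \<A> f height p"
  define s t where "s = snd w" and "t = height p"
  have w: "w = dparam c (snd c p) (height_gradient c (snd c p))"
    unfolding w_def by (rule gradient_height[OF c])
  have fp: "param f c (snd c p) = f p" using chart_props(5)[OF c] by simp
  have ww: "lorentz w w = s"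
    unfolding s_def w by (rule lorentz_height_gradient[OF c(1) x])
  have wf: "lorentz w (f p) = 0"
    using dparam_orthogonal[OF c(1) x] unfolding w fp .
  have s: "s \<ge> 0" using lorentz_self_nonneg[OF in_hyperbolic_space wf] ww by simp
  have "(fst w \<bullet> fst (f p))\<^sup>2 \<le> (fst w \<bullet> fst w) * (fst (f p) \<bullet> fst (f p))"
    by (rule Cauchy_Schwarz_ineq)
  moreover have "fst w \<bullet> fst (f p) = s * t" "fst w \<bullet> fst w = s + s\<^sup>2"
    using wf ww by (simp_all add: lorentz_def s_def t_def power2_eq_square)
  moreover have "fst (f p) \<bullet> fst (f p) = t\<^sup>2 - 1"
    using in_hyperbolic_space[of p] by (simp add: hyperbolic_space_def lorentz_def t_def power2_eq_square)
  ultimately have "(s * t)\<^sup>2 \<le> (s + s\<^sup>2) * (t\<^sup>2 - 1)" by simp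
  then have "s * (s + 1) \<le> s * t\<^sup>2" by (simp add: algebra_simps power2_eq_square)
  then have "s = 0 \<or> s + 1 \<le> t\<^sup>2" using s by (metis mult_le_cancel_left_pos less_eq_real_def)
  then have "s \<le> t\<^sup>2" by auto
  then show ?thesis using ww by (simp add: w_def t_def)
qed

end

locale minimal_immersion = immersion \<A> f
  for \<A> :: "('p::{t2_space,second_countable_topology}, 'n::finite) chart set"
    and f :: "'p \<Rightarrow> 'h::euclidean_space \<times> real" +
  assumes minimal: "\<And>p. mean_curvature \<A> f p = 0"
begin

text \<open>A minimal submanifold satisfies \<open>\<Delta> f = n f\<close>; modulo tangent vectors, the trace of the second
  derivatives in any chart is this Laplacian.\<close>

lemma trace_hess:
  assumes c: "c \<in> \<A>" and x: "x \<in> chart_image c"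
  obtains z where "(\<Sum>e\<in>Basis. hess c x (frame c x e) (frame c x e)) = real CARD('n) *\<^sub>R param f c x + dparam c x z"
proof -
  let ?r = "frame c x" and ?N = "normal_part f c x" and ?F = "param f c x"
  let ?p = "chart_inv c x"
  have p: "?p \<in> fst c" "snd c ?p = x" using chart_props(6,7)[OF c x] by auto
  have "(\<Sum>e\<in>Basis. sff c x (?r e) (?r e)) = 0"
    using minimal[of ?p] mean_curvature_frame[OF c p(1)] p(2) by simp
  moreover have "sff c x (?r e) (?r e)
      = ?N (hess c x (?r e) (?r e) - lorentz (tangent_frame c x e) (tangent_frame c x e) *\<^sub>R ?F)" for e
    unfolding sff_def hyp_proj_def lorentz_hess_param[OF c x] by simp
  ultimately have "?N (\<Sum>e\<in>Basis. hess c x (?r e) (?r e) - lorentz (tangent_frame c x e) (tangent_frame c x e) *\<^sub>R ?F) = 0"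
    by (simp add: linear_sum[OF linear_normal_part[OF c x]])
  moreover have "(\<Sum>e\<in>Basis. hess c x (?r e) (?r e) - lorentz (tangent_frame c x e) (tangent_frame c x e) *\<^sub>R ?F)
      = (\<Sum>e\<in>Basis. hess c x (?r e) (?r e)) - real CARD('n) *\<^sub>R ?F"
    by (simp only: sum_subtractf scaleR_sum_left[symmetric] sum_lorentz_frame[OF c x])
  ultimately have N0: "?N ((\<Sum>e\<in>Basis. hess c x (?r e) (?r e)) - real CARD('n) *\<^sub>R ?F) = 0" by simp
  define w where "w = (\<Sum>e\<in>Basis. hess c x (?r e) (?r e)) - real CARD('n) *\<^sub>R ?F"
  have "w = (\<Sum>e\<in>Basis. lorentz w (tangent_frame c x e) *\<^sub>R tangent_frame c x e)"
    using N0 unfolding w_def[symmetric] normal_part_frame[OF c x] by simp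
  also have "\<dots> = dparam c x (\<Sum>e\<in>Basis. lorentz w (tangent_frame c x e) *\<^sub>R ?r e)"
    by (simp only: linear_sum[OF linear_dparam[OF c x]] linear_scale[OF linear_dparam[OF c x]])
  finally have "w = dparam c x (\<Sum>e\<in>Basis. lorentz w (tangent_frame c x e) *\<^sub>R ?r e)" .
  then have "(\<Sum>e\<in>Basis. hess c x (?r e) (?r e))
      = real CARD('n) *\<^sub>R ?F + dparam c x (\<Sum>e\<in>Basis. lorentz w (tangent_frame c x e) *\<^sub>R ?r e)"
    unfolding w_def by (simp only: diff_eq_eq add.commute)
  then show ?thesis by (rule that)
qed

text \<open>That is, \<open>\<Delta> height = n height\<close>. With \<open>\<xi>\<close> the gradient of the height function, \<open>T\<close> its image in
  Minkowski space and \<open>E = (0, -1)\<close>, so that \<open>\<langle>E, v\<rangle> = snd v\<close>, differentiating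
  \<open>\<langle>T, \<partial>\<^sub>w\<rangle> = \<langle>E, \<partial>\<^sub>w\<rangle>\<close> in direction \<open>w\<close> and summing over the frame expresses the divergence of \<open>\<xi>\<close> by the trace of the second derivatives;
  by symmetry of these, the remaining term is the derivative of the volume density.\<close>

lemma laplacian_height:
  assumes c: "c \<in> \<A>" and x: "x \<in> chart_image c"
  shows "(\<Sum>k\<in>UNIV. partial k (\<lambda>y. sqrt (det (metric f c y)) * height_gradient c y $ k) x)
    = sqrt (det (metric f c x)) * (real CARD('n) * height (chart_inv c x))"
proof -
  let ?s = "\<lambda>y. sqrt (det (metric f c y))" and ?\<xi> = "height_gradient c" and ?r = "frame c x"
  define \<xi>' where "\<xi>' v = (\<chi> k. frechet_derivative (\<lambda>y. ?\<xi> y $ k) (at x) v)" for v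
  have \<xi>'_deriv: "((\<lambda>y. ?\<xi> y $ k) has_derivative (\<lambda>v. \<xi>' v $ k)) (at x)" for k
    unfolding \<xi>'_def vec_lambda_beta by (rule C1_on_has_derivative[OF C1_height_gradient[OF c] x])
  have linear_\<xi>': "linear \<xi>'"
    using has_derivative_linear[OF \<xi>'_deriv] by (simp add: linear_iff vec_eq_iff)
  define T where "T = dparam c x (?\<xi> x)"
  have T_deriv: "((\<lambda>y. dparam c y (?\<xi> y)) has_derivative (\<lambda>v. hess c x v (?\<xi> x) + dparam c x (\<xi>' v))) (at x)"
  proof -
    have "((\<lambda>y. \<Sum>k\<in>UNIV. (?\<xi> y $ k) *\<^sub>R partial k (param f c) y) has_derivative
        (\<lambda>v. \<Sum>k\<in>UNIV. (?\<xi> x $ k) *\<^sub>R hess c x v (axis k 1) + (\<xi>' v $ k) *\<^sub>R partial k (param f c) x)) (at x)"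
      unfolding partial_def
      by (intro has_derivative_sum has_derivative_scaleR \<xi>'_deriv C1_on_has_derivative[OF C1_dparam[OF c] x])
    moreover have "(\<lambda>v. \<Sum>k\<in>UNIV. (?\<xi> x $ k) *\<^sub>R hess c x v (axis k 1) + (\<xi>' v $ k) *\<^sub>R partial k (param f c) x)
        = (\<lambda>v. hess c x v (?\<xi> x) + dparam c x (\<xi>' v))"
      unfolding sum.distrib
      by (intro ext arg_cong2[where f="(+)"] hess_expansion_right[OF c x, symmetric] dparam_expansion[OF c x, symmetric])
    ultimately show ?thesis
      using has_derivative_transform_within_open[OF _ chart_props(2)[OF c] x,
          of "\<lambda>y. \<Sum>k\<in>UNIV. (?\<xi> y $ k) *\<^sub>R partial k (param f c) y" _ UNIV "\<lambda>y. dparam c y (?\<xi> y)"]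
      by (simp add: dparam_expansion[OF c] del: o_apply)
  qed
  have key: "lorentz (dparam c x (\<xi>' v)) (dparam c x w) + lorentz (hess c x v (?\<xi> x)) (dparam c x w)
      = snd (hess c x v w) - lorentz T (hess c x v w)" for v w
  proof -
    have w_deriv: "((\<lambda>y. dparam c y w) has_derivative (\<lambda>v. hess c x v w)) (at x)"
      by (rule C1_on_has_derivative[OF C1_dparam[OF c] x])
    have "((\<lambda>y. lorentz (dparam c y (?\<xi> y)) (dparam c y w)) has_derivative
        (\<lambda>v. lorentz T (hess c x v w) + lorentz (hess c x v (?\<xi> x) + dparam c x (\<xi>' v)) (dparam c x w))) (at x)"
      unfolding T_def by (rule lorentz.FDERIV[OF T_deriv w_deriv])
    then have "((\<lambda>y. snd (dparam c y w)) has_derivative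
        (\<lambda>v. lorentz T (hess c x v w) + lorentz (hess c x v (?\<xi> x) + dparam c x (\<xi>' v)) (dparam c x w))) (at x)"
      by (rule has_derivative_transform_within_open[OF _ chart_props(2)[OF c] x])
        (simp add: lorentz_commute[of "dparam c _ (?\<xi> _)"] lorentz_height_gradient[OF c] del: o_apply)
    moreover have "((\<lambda>y. snd (dparam c y w)) has_derivative (\<lambda>v. snd (hess c x v w))) (at x)"
      by (rule bounded_linear.has_derivative[OF bounded_linear_snd w_deriv])
    ultimately have "(\<lambda>v. lorentz T (hess c x v w) + lorentz (hess c x v (?\<xi> x) + dparam c x (\<xi>' v)) (dparam c x w))
        = (\<lambda>v. snd (hess c x v w))"
      by (rule has_derivative_unique)
    then have "lorentz T (hess c x v w) + lorentz (hess c x v (?\<xi> x) + dparam c x (\<xi>' v)) (dparam c x w)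
        = snd (hess c x v w)"
      by (rule fun_cong)
    then show ?thesis by (simp add: lorentz.add_left)
  qed
  define D where "D = (\<Sum>e\<in>Basis. lorentz (hess c x (?\<xi> x) (?r e)) (tangent_frame c x e))"
  have "(\<Sum>k\<in>UNIV. \<xi>' (axis k 1) $ k) + D
      = (\<Sum>e\<in>Basis. snd (hess c x (?r e) (?r e)) - lorentz T (hess c x (?r e) (?r e)))"
    unfolding trace_frame[OF c x linear_\<xi>', symmetric] D_def sum.distrib[symmetric]
  proof (rule sum.cong[OF refl])
    fix e
    show "lorentz (dparam c x (\<xi>' (?r e))) (tangent_frame c x e) + lorentz (hess c x (?\<xi> x) (?r e)) (tangent_frame c x e)
        = snd (hess c x (?r e) (?r e)) - lorentz T (hess c x (?r e) (?r e))"
      by (rule trans[OF _ key])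
        (rule arg_cong2[where f="(+)", OF refl arg_cong2[where f=lorentz, OF hess_commute[OF c x] refl]])
  qed
  also have "\<dots> = snd (\<Sum>e\<in>Basis. hess c x (?r e) (?r e)) - lorentz T (\<Sum>e\<in>Basis. hess c x (?r e) (?r e))"
    by (simp add: sum_subtractf lorentz.sum_right snd_sum)
  also have "\<dots> = real CARD('n) * height (chart_inv c x)"
  proof -
    obtain z where z: "(\<Sum>e\<in>Basis. hess c x (?r e) (?r e)) = real CARD('n) *\<^sub>R param f c x + dparam c x z"
      by (rule trace_hess[OF c x])
    have "lorentz T (dparam c x z) = snd (dparam c x z)"
      unfolding T_def by (subst lorentz_commute) (rule lorentz_height_gradient[OF c x])
    moreover have "lorentz T (param f c x) = 0" unfolding T_def by (rule dparam_orthogonal[OF c x])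
    ultimately show ?thesis
      unfolding z by (simp add: lorentz.add_right lorentz.scaleR_right)
  qed
  finally have trace: "(\<Sum>k\<in>UNIV. \<xi>' (axis k 1) $ k) + D = real CARD('n) * height (chart_inv c x)" .
  let ?S = "\<lambda>v. ?s x * (\<Sum>e\<in>Basis. lorentz (hess c x v (?r e)) (tangent_frame c x e))"
  have S_deriv: "(?s has_derivative ?S) (at x)" by (rule derivative_sqrt_det_metric[OF c x])
  have "partial k (\<lambda>y. ?s y * ?\<xi> y $ k) x = ?s x * \<xi>' (axis k 1) $ k + ?S (axis k 1) * ?\<xi> x $ k" for k
    unfolding partial_def
    by (rule fun_cong[OF frechet_derivative_at[OF has_derivative_mult[OF S_deriv \<xi>'_deriv[of k]], symmetric]])
  then have "(\<Sum>k\<in>UNIV. partial k (\<lambda>y. ?s y * ?\<xi> y $ k) x)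
      = ?s x * (\<Sum>k\<in>UNIV. \<xi>' (axis k 1) $ k) + (\<Sum>k\<in>UNIV. ?\<xi> x $ k *\<^sub>R ?S (axis k 1))"
    by (simp add: sum.distrib sum_distrib_left mult.commute)
  also have "(\<Sum>k\<in>UNIV. ?\<xi> x $ k *\<^sub>R ?S (axis k 1)) = ?S (?\<xi> x)"
    by (rule linear_basis_expansion[OF has_derivative_linear[OF S_deriv], symmetric])
  finally show ?thesis
    unfolding D_def[symmetric] trace[symmetric] by (simp add: distrib_left)
qed

end

section \<open>Localization of functions\<close>

text \<open>The square makes the positive part continuously differentiable, which suffices for the
  partition of unity below.\<close>

lemma has_derivative_square_positive_part:
  "((\<lambda>t::real. (max 0 t)\<^sup>2) has_real_derivative 2 * max 0 t) (at t)"
proof (cases t "0::real" rule: linorder_cases)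
  case less
  have "((\<lambda>t. 0) has_real_derivative 2 * max 0 t) (at t)" using less by simp
  then show ?thesis
    by (rule has_field_derivative_transform_within_open[of _ _ _ "{..<0}"]) (use less in auto)
next
  case greater
  have "((\<lambda>t. t\<^sup>2) has_real_derivative 2 * max 0 t) (at t)"
    using greater by (auto intro!: derivative_eq_intros)
  then show ?thesis
    by (rule has_field_derivative_transform_within_open[of _ _ _ "{0<..}"]) (use greater in auto)
next
  case equal
  have "((\<lambda>h::real. max 0 h) \<longlongrightarrow> max 0 0) (at 0)"
    by (intro tendsto_max tendsto_const tendsto_ident_at)
  moreover have "eventually (\<lambda>h::real. max 0 h = ((max 0 (0 + h))\<^sup>2 - (max 0 0)\<^sup>2) / h) (at 0)"
    by (auto simp: eventually_at_filter max_def power2_eq_square)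
  ultimately have "((\<lambda>h::real. ((max 0 (0 + h))\<^sup>2 - (max 0 0)\<^sup>2) / h) \<longlongrightarrow> max 0 0) (at 0)"
    by (rule Lim_transform_eventually)
  then show ?thesis using equal by (simp add: DERIV_def)
qed

context immersion
begin

text \<open>For gluing: a function is shown to be continuously differentiable on the two members of an open
  cover: one where it is given by a formula, and the complement of its support.\<close>

definition C1_function_on :: "'p set \<Rightarrow> ('p \<Rightarrow> real) \<Rightarrow> bool" where
  "C1_function_on N u \<longleftrightarrow> (\<forall>c\<in>\<A>. C1_on (chart_image c \<inter> chart_inv c -` N) (u \<circ> chart_inv c))"

lemma open_chart_preimage: "c \<in> \<A> \<Longrightarrow> open N \<Longrightarrow> open (chart_image c \<inter> chart_inv c -` N)"
  by (intro continuous_open_preimage chart_props)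

lemma C1_function_on_UNIV: "C1_function_on UNIV u \<longleftrightarrow> C1_function u"
  by (simp add: C1_function_on_def C1_function_def del: Ck_on.simps)

lemma C1_function_on_subset: "C1_function_on N u \<Longrightarrow> N' \<subseteq> N \<Longrightarrow> C1_function_on N' u"
  unfolding C1_function_on_def by (blast intro: C1_on_subset)

lemma C1_function_on_const: "C1_function_on N (\<lambda>p. a)"
  unfolding C1_function_on_def comp_def by (intro ballI C1_on_const)

lemma C1_function_on_mult: "C1_function_on N u \<Longrightarrow> C1_function_on N w \<Longrightarrow> C1_function_on N (\<lambda>p. u p * w p)"
  unfolding C1_function_on_def comp_def by (intro ballI C1_on_mult) blast+

lemma C1_function_on_divide:
  "C1_function_on N u \<Longrightarrow> C1_function_on N w \<Longrightarrow> (\<And>p. p \<in> N \<Longrightarrow> w p \<noteq> 0) \<Longrightarrow> C1_function_on N (\<lambda>p. u p / w p)"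
  unfolding C1_function_on_def comp_def by (intro ballI C1_on_divide) blast+

lemma C1_function_on_sum:
  "(\<And>i. i \<in> I \<Longrightarrow> C1_function_on N (u i)) \<Longrightarrow> C1_function_on N (\<lambda>p. \<Sum>i\<in>I. u i p)"
  unfolding C1_function_on_def comp_def by (intro ballI C1_on_sum) blast

lemma C1_function_on_cong:
  assumes "C1_function_on N u" "open N" "\<And>p. p \<in> N \<Longrightarrow> u p = w p"
  shows "C1_function_on N w"
  unfolding C1_function_on_def
proof
  fix c assume c: "c \<in> \<A>"
  have "C1_on (chart_image c \<inter> chart_inv c -` N) (u \<circ> chart_inv c)"
    using assms(1) c unfolding C1_function_on_def by (rule bspec)
  then show "C1_on (chart_image c \<inter> chart_inv c -` N) (w \<circ> chart_inv c)"
    by (rule C1_on_cong[OF _ open_chart_preimage[OF c assms(2)]]) (simp add: assms(3))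
qed

lemma C1_function_Un:
  assumes "C1_function_on N u" "C1_function_on N' u" "open N" "open N'" "N \<union> N' = UNIV"
  shows "C1_function u"
  unfolding C1_function_def
proof
  fix c assume c: "c \<in> \<A>"
  have "C1_on ((chart_image c \<inter> chart_inv c -` N) \<union> (chart_image c \<inter> chart_inv c -` N')) (u \<circ> chart_inv c)"
    by (rule C1_on_Un[OF bspec[OF assms(1)[unfolded C1_function_on_def] c] bspec[OF assms(2)[unfolded C1_function_on_def] c]
          open_chart_preimage[OF c assms(3)] open_chart_preimage[OF c assms(4)]])
  moreover have "(chart_image c \<inter> chart_inv c -` N) \<union> (chart_image c \<inter> chart_inv c -` N') = chart_image c"
    using assms(5) by blast
  ultimately show "C1_on (chart_image c) (u \<circ> chart_inv c)" by (simp only:)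
qed

lemma gradient_eq_0:
  assumes "C1_function u" "open N" "p \<in> N" "\<And>q. q \<in> N \<Longrightarrow> u q = 0"
  shows "gradient \<A> f u p = 0"
proof -
  obtain c where c: "c \<in> \<A>" "p \<in> fst c" using exists_chart by blast
  have "snd c p \<in> chart_image c \<inter> chart_inv c -` N"
    using c assms(3) chart_props(5)[OF c] by auto
  then have "frechet_derivative (u \<circ> chart_inv c) (at (snd c p)) = frechet_derivative (\<lambda>x. 0) (at (snd c p))"
    by (rule frechet_derivative_eq_on_open[OF open_chart_preimage[OF c(1) assms(2)]]) (auto simp: assms(4))
  then show ?thesis by (simp add: gradient_frame[OF assms(1) c])
qed

lemma gradient_sum:
  assumes "\<And>i. i \<in> I \<Longrightarrow> C1_function (u i)"
  shows "gradient \<A> f (\<lambda>p. \<Sum>i\<in>I. u i p) p = (\<Sum>i\<in>I. gradient \<A> f (u i) p)"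
proof -
  obtain c where c: "c \<in> \<A>" "p \<in> fst c" using exists_chart by blast
  have x: "snd c p \<in> chart_image c" using c by auto
  have C1: "C1_function (\<lambda>p. \<Sum>i\<in>I. u i p)"
    using C1_function_on_sum[of I UNIV u] assms by (simp add: C1_function_on_UNIV)
  have "((\<lambda>x. \<Sum>i\<in>I. (u i \<circ> chart_inv c) x) has_derivative
      (\<lambda>v. \<Sum>i\<in>I. frechet_derivative (u i \<circ> chart_inv c) (at (snd c p)) v)) (at (snd c p))"
    by (intro has_derivative_sum C1_on_has_derivative[OF C1_functionD[OF assms c(1)] x])
  from frechet_derivative_at[OF this]
  have "frechet_derivative ((\<lambda>p. \<Sum>i\<in>I. u i p) \<circ> chart_inv c) (at (snd c p))
      = (\<lambda>v. \<Sum>i\<in>I. frechet_derivative (u i \<circ> chart_inv c) (at (snd c p)) v)"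
    by (simp add: comp_def)
  then show ?thesis
    using assms by (simp add: gradient_frame[OF C1 c] gradient_frame[OF _ c] scaleR_sum_left sum.swap[of _ I])
qed

text \<open>A fourth-degree polynomial bump in a chart ball, extended by zero. That the extension stays
  continuously differentiable uses that the compact ball is closed in the manifold, a Hausdorff
  space.\<close>

lemma exists_bump:
  obtains \<eta> K c where "C1_function \<eta>" "\<And>q. \<eta> q \<ge> 0" "\<eta> p > 0" "c \<in> \<A>" "compact K" "K \<subseteq> fst c" "\<And>q. q \<notin> K \<Longrightarrow> \<eta> q = 0"
proof -
  obtain c r where c: "c \<in> \<A>" "p \<in> fst c" and r: "r > 0" "cball (snd c p) r \<subseteq> chart_image c"
    by (rule exists_chart_ball)
  define K where "K = fst c \<inter> snd c -` cball (snd c p) r"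
  have K: "compact K" "K \<subseteq> fst c" using compact_chart_ball[OF c(1) r(2)] by (auto simp: K_def)
  define h where "h x = (max 0 (r\<^sup>2 - (x - snd c p) \<bullet> (x - snd c p)))\<^sup>2" for x
  define \<eta> where "\<eta> q = (if q \<in> fst c then h (snd c q) else 0)" for q
  have "C1_on UNIV (\<lambda>x. r\<^sup>2 - (x - snd c p) \<bullet> (x - snd c p))"
    by (rule C1_onI[where D="\<lambda>x v. - 2 * ((x - snd c p) \<bullet> v)"])
      (auto intro!: derivative_eq_intros continuous_intros simp: inner_commute)
  then have h: "C1_on UNIV h"
    unfolding h_def
    by (rule C1_on_real_compose[where k="\<lambda>t. (max 0 t)\<^sup>2"])
      (auto intro!: has_derivative_square_positive_part continuous_intros)
  have outside: "\<eta> q = 0" if "q \<notin> K" for q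
  proof (cases "q \<in> fst c")
    case True
    then have "dist (snd c q) (snd c p) > r" using that by (auto simp: K_def dist_commute)
    then have "r\<^sup>2 \<le> (dist (snd c q) (snd c p))\<^sup>2" using r(1) by (intro power_mono) auto
    then have "r\<^sup>2 \<le> (snd c q - snd c p) \<bullet> (snd c q - snd c p)"
      by (simp add: dist_norm power2_norm_eq_inner)
    then show ?thesis by (simp add: \<eta>_def h_def)
  qed (simp add: \<eta>_def)
  have "C1_function_on (fst c) \<eta>"
    unfolding C1_function_on_def
  proof
    fix d assume d: "d \<in> \<A>"
    have "C1_on (overlap d c) (h \<circ> transition d c)"
      by (rule C1_on_compose[OF C1_transition[OF d c(1)] h]) simp
    moreover have "overlap d c = chart_image d \<inter> chart_inv d -` fst c"
    proof (intro set_eqI iffI)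
      show "x \<in> chart_image d \<inter> chart_inv d -` fst c" if "x \<in> overlap d c" for x
        using overlap_props(2,3)[OF d c(1) that] by simp
      show "x \<in> overlap d c" if "x \<in> chart_image d \<inter> chart_inv d -` fst c" for x
        using chart_props(6,7)[OF d, of x] that by (metis IntE IntI image_eqI vimageD)
    qed
    ultimately have "C1_on (chart_image d \<inter> chart_inv d -` fst c) (h \<circ> transition d c)" by (simp only:)
    then show "C1_on (chart_image d \<inter> chart_inv d -` fst c) (\<eta> \<circ> chart_inv d)"
      by (rule C1_on_cong[OF _ open_chart_preimage[OF d chart_props(1)[OF c(1)]]]) (auto simp: \<eta>_def transition_def)
  qed
  moreover have "C1_function_on (- K) \<eta>"
    by (rule C1_function_on_cong[OF C1_function_on_const[of _ 0]])
      (use outside K(1) in \<open>auto simp: compact_imp_closed open_Compl\<close>)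
  ultimately have "C1_function \<eta>"
    by (rule C1_function_Un) (use K chart_props(1)[OF c(1)] in \<open>auto simp: compact_imp_closed open_Compl\<close>)
  moreover have "\<eta> p > 0" using c(2) r(1) by (simp add: \<eta>_def h_def)
  moreover have "\<eta> q \<ge> 0" for q by (simp add: \<eta>_def h_def)
  ultimately show ?thesis using that c(1) K outside by blast
qed

text \<open>Divide finitely many bump functions that cover the support by their sum.\<close>

lemma C1_function_decomposition:
  assumes \<phi>: "C1_function \<phi>" and K: "compact K" "\<And>p. p \<notin> K \<Longrightarrow> \<phi> p = 0"
  shows "\<exists>T \<phi>'. finite (T :: 'p set) \<and> (\<forall>p. \<phi> p = (\<Sum>t\<in>T. \<phi>' t p)) \<and>
    (\<forall>t. C1_function (\<phi>' t) \<and>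
      (\<exists>c\<in>\<A>. \<exists>L. compact L \<and> L \<subseteq> fst c \<and> (\<forall>p. p \<notin> L \<longrightarrow> \<phi>' t p = 0)))"
proof -
  have "\<exists>\<eta>. C1_function \<eta> \<and> (\<forall>q. \<eta> q \<ge> 0) \<and> \<eta> p > 0 \<and>
      (\<exists>c\<in>\<A>. \<exists>L. compact L \<and> L \<subseteq> fst c \<and> (\<forall>q. q \<notin> L \<longrightarrow> \<eta> q = 0))" for p
    by (rule exists_bump[of p]) blast
  then obtain \<eta> where \<eta>: "\<And>p. C1_function (\<eta> p)" "\<And>p q. \<eta> p q \<ge> 0" "\<And>p. \<eta> p p > 0"
    and support: "\<And>p. \<exists>c\<in>\<A>. \<exists>L. compact L \<and> L \<subseteq> fst c \<and> (\<forall>q. q \<notin> L \<longrightarrow> \<eta> p q = 0)"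
    by metis
  have "open {q. \<eta> p q > 0}" for p
    using open_Collect_less[OF continuous_on_const C1_function_continuous[OF \<eta>(1)]] .
  moreover have "K \<subseteq> (\<Union>p\<in>UNIV. {q. \<eta> p q > 0})" using \<eta>(3) by blast
  ultimately obtain T where T: "finite T" "K \<subseteq> (\<Union>p\<in>T. {q. \<eta> p q > 0})"
    using compactE_image[OF K(1), of UNIV "\<lambda>p. {q. \<eta> p q > 0}"] by metis
  define S where "S q = (\<Sum>p\<in>T. \<eta> p q)" for q
  have S: "C1_function S"
    unfolding S_def using C1_function_on_sum[of T UNIV \<eta>] \<eta>(1) by (simp add: C1_function_on_UNIV)
  have S_pos: "S q > 0" if q: "q \<in> K" for q
  proof -
    obtain p where "p \<in> T" "\<eta> p q > 0" using T(2) q by blast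
    then show ?thesis unfolding S_def using T(1) \<eta>(2) by (intro sum_pos2)
  qed
  define N where "N = {q. S q > 0}"
  have N: "open N" "open (- K)" "N \<union> - K = UNIV"
    using open_Collect_less[OF continuous_on_const C1_function_continuous[OF S]] S_pos K(1)
    by (auto simp: N_def compact_imp_closed open_Compl)
  define \<phi>' where "\<phi>' p q = \<eta> p q * \<phi> q / S q" for p q
  have "C1_function (\<phi>' p)" for p
  proof (rule C1_function_Un[OF _ _ N])
    have on: "C1_function_on N u" if "C1_function u" for u
      using that C1_function_on_subset unfolding C1_function_on_UNIV[symmetric] by blast
    show "C1_function_on N (\<phi>' p)"
      unfolding \<phi>'_def by (intro C1_function_on_divide C1_function_on_mult on \<eta>(1) \<phi> S) (simp add: N_def)
    show "C1_function_on (- K) (\<phi>' p)"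
      by (rule C1_function_on_cong[OF C1_function_on_const[of _ 0] N(2)]) (simp add: \<phi>'_def K(2))
  qed
  moreover have "\<phi> q = (\<Sum>p\<in>T. \<phi>' p q)" for q
  proof (cases "q \<in> K")
    case True
    then have "(\<Sum>p\<in>T. \<phi>' p q) = S q * \<phi> q / S q"
      unfolding \<phi>'_def by (simp add: S_def sum_distrib_right sum_divide_distrib)
    then show ?thesis using S_pos[OF True] by simp
  qed (simp add: \<phi>'_def K(2))
  moreover have "\<exists>c\<in>\<A>. \<exists>L. compact L \<and> L \<subseteq> fst c \<and> (\<forall>q. q \<notin> L \<longrightarrow> \<phi>' p q = 0)" for p
  proof -
    obtain c L where "c \<in> \<A>" "compact L" "L \<subseteq> fst c" "\<forall>q. q \<notin> L \<longrightarrow> \<eta> p q = 0"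
      using support[of p] by blast
    then show ?thesis by (intro bexI[of _ c] exI[of _ L]) (simp_all add: \<phi>'_def)
  qed
  ultimately show ?thesis using T(1) by (intro exI[of _ T] exI[of _ \<phi>']) simp
qed

end

section \<open>Integration by parts against the height function\<close>

context minimal_immersion
begin

text \<open>The divergence of the vector field \<open>\<phi> \<nabla>height\<close>, because \<open>\<Delta> height = n height\<close>.\<close>

definition height_divergence :: "('p \<Rightarrow> real) \<Rightarrow> 'p \<Rightarrow> real" where
  "height_divergence \<phi> p = lorentz (gradient \<A> f \<phi> p) (gradient \<A> f height p) + real CARD('n) * height p * \<phi> p"

lemma continuous_height_divergence: "C1_function \<phi> \<Longrightarrow> continuous_on UNIV (height_divergence \<phi>)"
  unfolding height_divergence_def
  by (intro continuous_on_add continuous_on_mult lorentz.continuous_on continuous_on_const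
      continuous_gradient C1_height C1_function_continuous)

lemma height_divergence_eq_0:
  assumes "C1_function \<phi>" "compact K" "\<And>p. p \<notin> K \<Longrightarrow> \<phi> p = 0" "p \<notin> K"
  shows "height_divergence \<phi> p = 0"
  using gradient_eq_0[OF assms(1), of "- K" p] assms
  by (simp add: height_divergence_def open_Compl compact_imp_closed lorentz.zero_left)

text \<open>In coordinates the integrand, multiplied by the volume density, is the divergence of the vector
  field \<open>\<phi> sqrt (det g) \<xi>\<close>, where \<open>\<xi>\<close> represents the gradient of the height function.\<close>

lemma integral_height_divergence_chart:
  assumes \<phi>: "C1_function \<phi>" and c: "c \<in> \<A>" and K: "compact K" "K \<subseteq> fst c" "\<And>p. p \<notin> K \<Longrightarrow> \<phi> p = 0"
  shows "has_bochner_integral volume (height_divergence \<phi>) 0"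
proof -
  let ?U = "chart_image c" and ?s = "\<lambda>y. sqrt (det (metric f c y))" and ?\<xi> = "height_gradient c"
  let ?\<phi> = "\<phi> \<circ> chart_inv c"
  define \<psi> where "\<psi> k y = ?\<phi> y * (?s y * ?\<xi> y $ k)" for k y
  have C1_s\<xi>: "C1_on ?U (\<lambda>y. ?s y * ?\<xi> y $ k)" for k
    using det_metric_pos[OF c] by (intro C1_on_mult C1_on_sqrt C1_det_metric[OF c] C1_height_gradient[OF c])
  have C1_\<phi>: "C1_on ?U ?\<phi>" by (rule C1_functionD[OF \<phi> c])
  have "has_bochner_integral lborel (\<lambda>x. indicator ?U x * frechet_derivative (\<psi> k) (at x) (axis k 1)) 0" for k
  proof (rule integral_derivative_eq_0[OF chart_props(2)[OF c], of _ "snd c ` K"])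
    show "C1_on ?U (\<psi> k)" unfolding \<psi>_def by (rule C1_on_mult[OF C1_\<phi> C1_s\<xi>])
    show "compact (snd c ` K)"
      using K(1) continuous_on_subset[OF chart_props(3)[OF c] K(2)] by (rule compact_continuous_image[rotated])
    show "snd c ` K \<subseteq> ?U" using K(2) by blast
    show "\<psi> k x = 0" if "x \<in> ?U - snd c ` K" for x
    proof -
      have "chart_inv c x \<notin> K" using that chart_props(7)[OF c, of x] by (metis DiffE image_eqI)
      then show ?thesis by (simp add: \<psi>_def K(3))
    qed
  qed
  then have "has_bochner_integral lborel
      (\<lambda>x. \<Sum>k\<in>UNIV. indicator ?U x * frechet_derivative (\<psi> k) (at x) (axis k 1)) (\<Sum>k\<in>(UNIV :: 'n set). 0)"
    by (intro has_bochner_integral_sum)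
  moreover have "(\<Sum>k\<in>UNIV. indicator ?U x * frechet_derivative (\<psi> k) (at x) (axis k 1))
      = volume_density c x * height_divergence \<phi> (chart_inv c x)" for x
  proof (cases "x \<in> ?U")
    case True
    let ?p = "chart_inv c x"
    have p: "?p \<in> fst c" "snd c ?p = x" using chart_props(6,7)[OF c True] by auto
    let ?D = "frechet_derivative ?\<phi> (at x)"
    have D: "(?\<phi> has_derivative ?D) (at x)" by (rule C1_on_has_derivative[OF C1_\<phi> True])
    have "frechet_derivative (\<psi> k) (at x) (axis k 1)
        = ?\<phi> x * partial k (\<lambda>y. ?s y * ?\<xi> y $ k) x + ?D (axis k 1) * (?s x * ?\<xi> x $ k)" for k
      unfolding \<psi>_def partial_def
      by (rule fun_cong[OF frechet_derivative_at[OF has_derivative_mult[OF D C1_on_has_derivative[OF C1_s\<xi> True]], symmetric]])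
    then have "(\<Sum>k\<in>UNIV. frechet_derivative (\<psi> k) (at x) (axis k 1))
        = ?\<phi> x * (\<Sum>k\<in>UNIV. partial k (\<lambda>y. ?s y * ?\<xi> y $ k) x) + ?s x * (\<Sum>k\<in>UNIV. ?\<xi> x $ k *\<^sub>R ?D (axis k 1))"
      by (simp add: sum.distrib sum_distrib_left mult_ac)
    also have "(\<Sum>k\<in>UNIV. ?\<xi> x $ k *\<^sub>R ?D (axis k 1)) = ?D (?\<xi> x)"
      by (rule linear_basis_expansion[OF has_derivative_linear[OF D], symmetric])
    also have "?D (?\<xi> x) = lorentz (gradient \<A> f \<phi> ?p) (gradient \<A> f height ?p)"
      using lorentz_gradient[OF \<phi> c p(1), of "?\<xi> x"] gradient_height[OF c p(1)] p(2) by simp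
    also have "(\<Sum>k\<in>UNIV. partial k (\<lambda>y. ?s y * ?\<xi> y $ k) x) = ?s x * (real CARD('n) * height ?p)"
      by (rule laplacian_height[OF c True])
    finally show ?thesis
      using True by (simp add: volume_density_def height_divergence_def algebra_simps)
  qed (simp add: volume_density_def)
  ultimately have "has_bochner_integral lborel (\<lambda>x. volume_density c x * height_divergence \<phi> (chart_inv c x)) 0"
    by simp
  moreover have "height_divergence \<phi> p = 0" if "p \<notin> fst c" for p
    using height_divergence_eq_0[OF \<phi> K(1,3)] K(2) that by blast
  ultimately show ?thesis
    using has_bochner_integral_chart[OF c borel_measurable_continuous_onI[OF continuous_height_divergence[OF \<phi>]]] by blast
qed

lemma integral_height_divergence:
  assumes \<phi>: "C1_function \<phi>" and K: "compact K" "\<And>p. p \<notin> K \<Longrightarrow> \<phi> p = 0"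
  shows "has_bochner_integral volume (height_divergence \<phi>) 0"
proof -
  have "\<exists>T \<phi>'. finite (T :: 'p set) \<and> (\<forall>p. \<phi> p = (\<Sum>t\<in>T. \<phi>' t p)) \<and>
    (\<forall>t. C1_function (\<phi>' t) \<and> (\<exists>c\<in>\<A>. \<exists>L. compact L \<and> L \<subseteq> fst c \<and> (\<forall>p. p \<notin> L \<longrightarrow> \<phi>' t p = 0)))"
    using \<phi> K by (rule C1_function_decomposition)
  then obtain T :: "'p set" and \<phi>' where T: "\<And>p. \<phi> p = (\<Sum>t\<in>T. \<phi>' t p)" "\<And>t. C1_function (\<phi>' t)"
    "\<And>t. \<exists>c\<in>\<A>. \<exists>L. compact L \<and> L \<subseteq> fst c \<and> (\<forall>p. p \<notin> L \<longrightarrow> \<phi>' t p = 0)"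
    by (elim exE conjE) simp
  have "has_bochner_integral volume (height_divergence (\<phi>' t)) 0" for t
  proof -
    obtain c L where "c \<in> \<A>" "compact L" "L \<subseteq> fst c" "\<forall>p. p \<notin> L \<longrightarrow> \<phi>' t p = 0"
      using T(3)[of t] by blast
    then show ?thesis by (intro integral_height_divergence_chart[OF T(2)]) blast+
  qed
  then have "has_bochner_integral volume (\<lambda>p. \<Sum>t\<in>T. height_divergence (\<phi>' t) p) (\<Sum>t\<in>T. 0)"
    by (intro has_bochner_integral_sum)
  moreover have "(\<Sum>t\<in>T. height_divergence (\<phi>' t) p) = height_divergence \<phi> p" for p
  proof -
    have "\<phi> = (\<lambda>p. \<Sum>t\<in>T. \<phi>' t p)" using T(1) by (rule ext)
    then show ?thesis
      using gradient_sum[of T \<phi>' p] T(2)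
      by (simp add: height_divergence_def lorentz.sum_left sum.distrib sum_distrib_left)
  qed
  ultimately show ?thesis by simp
qed

end

section \<open>The spectral gap of minimal submanifolds\<close>

context immersion
begin

lemma gradient_orthogonal: "C1_function u \<Longrightarrow> lorentz (gradient \<A> f u p) (f p) = 0"
proof -
  assume u: "C1_function u"
  obtain c where c: "c \<in> \<A>" "p \<in> fst c" using exists_chart by blast
  obtain v where v: "gradient \<A> f u p = dparam c (snd c p) v" by (rule gradient_tangent[OF u c])
  have x: "snd c p \<in> chart_image c" using c by auto
  have "param f c (snd c p) = f p" using chart_props(5)[OF c] by simp
  then show "lorentz (gradient \<A> f u p) (f p) = 0"
    unfolding v using dparam_orthogonal[OF c(1) x, of v] by simp
qed

lemma tangent_space_orthogonal:
  assumes "w \<in> tangent_space \<A> f p"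
  shows "lorentz w (f p) = 0"
proof -
  let ?c = "chart_at \<A> p"
  note c = chart_at_props[of p]
  obtain v where v: "w = dparam ?c (snd ?c p) v" using assms unfolding tangent_space_def Let_def by auto
  have x: "snd ?c p \<in> chart_image ?c" using c by auto
  have "param f ?c (snd ?c p) = f p" using chart_props(5)[OF c] by simp
  then show ?thesis unfolding v using dparam_orthogonal[OF c(1) x, of v] by simp
qed

lemma sff_orthogonal:
  assumes c: "c \<in> \<A>" and x: "x \<in> chart_image c"
  shows "lorentz (sff c x v w) (param f c x) = 0"
proof -
  have "lorentz (param f c x) (param f c x) = -1"
    using param_in_hyperbolic_space unfolding hyperbolic_space_def by blast
  then show ?thesis
    by (simp add: sff_def normal_part_frame[OF c x] hyp_proj_def lorentz.diff_left lorentz.add_left lorentz.sum_left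
        lorentz.scaleR_left dparam_orthogonal[OF c x] del: o_apply)
qed

lemma sff_norm_sq_nonneg: "sff_norm_sq \<A> f p \<ge> 0"
proof -
  obtain c where c: "c \<in> \<A>" "p \<in> fst c" using exists_chart by blast
  have x: "snd c p \<in> chart_image c" using c by auto
  show ?thesis
    unfolding sff_norm_sq_frame[OF c] Let_def
    by (intro sum_nonneg lorentz_self_nonneg[OF param_in_hyperbolic_space[of c "snd c p"]] sff_orthogonal[OF c(1) x])
qed

text \<open>The integrand of the stability inequality involves \<open>|A|\<^sup>2\<close>, which must therefore be measurable.\<close>

lemma continuous_sff_norm_sq: "continuous_on UNIV (sff_norm_sq \<A> f)"
proof (rule continuous_on_charts)
  fix c assume c: "c \<in> \<A>"
  let ?U = "chart_image c"
  have frame: "continuous_on ?U (\<lambda>x. frame c x e $ k)" for e k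
    by (rule C1_on_imp_continuous_on[OF C1_frame[OF c]])
  have "continuous_on ?U (\<lambda>x. \<Sum>i\<in>UNIV. \<Sum>j\<in>UNIV. (frame c x e $ i * frame c x e' $ j) *\<^sub>R hess c x (axis i 1) (axis j 1))" for e e'
    by (intro continuous_on_sum continuous_on_scaleR continuous_on_mult frame C1_on_continuous_derivative[OF C1_dparam[OF c]])
  then have hess: "continuous_on ?U (\<lambda>x. hess c x (frame c x e) (frame c x e'))" for e e'
    by (rule continuous_on_eq) (simp add: hess_expansion[OF c] partial_partial)
  have param: "continuous_on ?U (param f c)"
    by (rule C1_on_imp_continuous_on[OF C1_param[OF c]])
  define w where "w e e' x = hyp_proj (param f c x) (hess c x (frame c x e) (frame c x e'))" for e e' x
  have w: "continuous_on ?U (w e e')" for e e'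
    unfolding w_def hyp_proj_def
    by (intro continuous_on_add continuous_on_scaleR lorentz.continuous_on hess param)
  have "continuous_on ?U (\<lambda>x. w e e' x
      - (\<Sum>d\<in>Basis. lorentz (w e e' x) (tangent_frame c x d) *\<^sub>R tangent_frame c x d))" for e e'
    by (intro continuous_on_diff continuous_on_sum continuous_on_scaleR lorentz.continuous_on w continuous_tangent_frame[OF c])
  then have "continuous_on ?U (\<lambda>x. sff c x (frame c x e) (frame c x e'))" for e e'
    by (rule continuous_on_eq) (simp add: sff_def w_def normal_part_frame[OF c] del: o_apply)
  then have "continuous_on ?U (\<lambda>x. \<Sum>e\<in>Basis. \<Sum>e'\<in>Basis.
      let a = sff c x (frame c x e) (frame c x e') in lorentz a a)"
    unfolding Let_def by (intro continuous_on_sum lorentz.continuous_on)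
  then show "continuous_on ?U (\<lambda>x. sff_norm_sq \<A> f (chart_inv c x))"
    by (rule continuous_on_eq) (simp add: sff_norm_sq_frame[OF c] chart_props(6,7)[OF c])
qed

end

context minimal_immersion
begin

lemma C1_square_over_height:
  assumes "C1_function u"
  shows "C1_function (\<lambda>p. (u p)\<^sup>2 / height p)"
  using assms C1_height height_pos
  unfolding C1_function_on_UNIV[symmetric] power2_eq_square
  by (intro C1_function_on_divide C1_function_on_mult) (auto simp: less_imp_neq[symmetric])

lemma height_divergence_square:
  assumes u: "C1_function u"
  shows "height_divergence (\<lambda>p. (u p)\<^sup>2 / height p) p
    = 2 * u p / height p * lorentz (gradient \<A> f u p) (gradient \<A> f height p)
      - (u p)\<^sup>2 / (height p)\<^sup>2 * lorentz (gradient \<A> f height p) (gradient \<A> f height p)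
      + real CARD('n) * (u p)\<^sup>2"
proof -
  obtain c where c: "c \<in> \<A>" "p \<in> fst c" using exists_chart by blast
  let ?x = "snd c p" and ?U = "u \<circ> chart_inv c" and ?B = "height \<circ> chart_inv c"
  have x: "?x \<in> chart_image c" using c by auto
  have inv: "chart_inv c ?x = p" by (rule chart_props(5)[OF c])
  define v where "v = height_gradient c ?x"
  have grad: "lorentz (gradient \<A> f w p) (gradient \<A> f height p) = frechet_derivative (w \<circ> chart_inv c) (at ?x) v"
    if "C1_function w" for w
    unfolding gradient_height[OF c] v_def by (rule lorentz_gradient[OF that c])
  have B: "?B ?x \<noteq> 0" using height_pos[of p] inv by simp
  have dU: "(?U has_derivative frechet_derivative ?U (at ?x)) (at ?x)"
    and dB: "(?B has_derivative frechet_derivative ?B (at ?x)) (at ?x)"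
    using C1_on_has_derivative[OF C1_functionD x] u C1_height c(1) by blast+
  have quotient: "((\<lambda>y. (?U y * ?U y) / ?B y) has_derivative
      (\<lambda>h. - (?U ?x * ?U ?x) * (inverse (?B ?x) * frechet_derivative ?B (at ?x) h * inverse (?B ?x))
        + (?U ?x * frechet_derivative ?U (at ?x) h + frechet_derivative ?U (at ?x) h * ?U ?x) / ?B ?x)) (at ?x)"
    by (rule has_derivative_divide[OF has_derivative_mult[OF dU dU] dB B])
  have "(\<lambda>p. (u p)\<^sup>2 / height p) \<circ> chart_inv c = (\<lambda>y. (?U y * ?U y) / ?B y)"
    by (auto simp: power2_eq_square)
  with frechet_derivative_at[OF quotient]
  have "frechet_derivative ((\<lambda>p. (u p)\<^sup>2 / height p) \<circ> chart_inv c) (at ?x)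
      = (\<lambda>h. - (?U ?x * ?U ?x) * (inverse (?B ?x) * frechet_derivative ?B (at ?x) h * inverse (?B ?x))
        + (?U ?x * frechet_derivative ?U (at ?x) h + frechet_derivative ?U (at ?x) h * ?U ?x) / ?B ?x)"
    by (simp only:)
  then have "lorentz (gradient \<A> f (\<lambda>p. (u p)\<^sup>2 / height p) p) (gradient \<A> f height p)
      = - (u p * u p) * (inverse (height p) * frechet_derivative ?B (at ?x) v * inverse (height p))
        + (u p * frechet_derivative ?U (at ?x) v + frechet_derivative ?U (at ?x) v * u p) / height p"
    using grad[OF C1_square_over_height[OF u]] inv by simp
  then show ?thesis
    unfolding height_divergence_def grad[OF u] grad[OF C1_height]
    using height_pos[of p] by (simp add: field_simps power2_eq_square)
qed

text \<open>Here the positive function \<open>height\<close> raised to the power \<open>- a\<close>, \<open>a = (n - 1) / 2\<close>, acts as a supersolution: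
  the left-hand side is the squared length of \<open>\<nabla>u + a (u / height) \<nabla>height\<close> plus a nonnegative
  multiple of \<open>1 - |\<nabla>height|\<^sup>2 / height\<^sup>2\<close>.\<close>

lemma gradient_gap_pointwise:
  assumes u: "C1_function u"
  shows "lorentz (gradient \<A> f u p) (gradient \<A> f u p) - ((real CARD('n) - 1) / 2)\<^sup>2 * (u p)\<^sup>2
    + ((real CARD('n) - 1) / 2) * height_divergence (\<lambda>p. (u p)\<^sup>2 / height p) p \<ge> 0"
proof -
  define a where "a = ((real CARD('n) - 1) / 2)"
  define b where "b = height p"
  define G H where "G = gradient \<A> f u p" and "H = gradient \<A> f height p"
  define t where "t = u p / b"
  define \<sigma> where "\<sigma> = lorentz H H / b\<^sup>2"
  have "b > 0" unfolding b_def by (rule height_pos)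
  then have HH: "lorentz H H = \<sigma> * b\<^sup>2" and ub: "u p = t * b" by (simp_all add: \<sigma>_def t_def)
  have \<sigma>: "\<sigma> \<le> 1"
    using gradient_height_le[of p] \<open>b > 0\<close> by (simp add: \<sigma>_def H_def b_def divide_le_eq)
  have a: "a \<ge> 0" by (simp add: a_def Suc_le_eq)
  have n: "real CARD('n) = 2 * a + 1" by (simp add: a_def field_simps)
  have "lorentz (G + (a * t) *\<^sub>R H) (f p) = 0"
    using gradient_orthogonal[OF u] gradient_orthogonal[OF C1_height]
    by (simp add: G_def H_def lorentz.add_left lorentz.scaleR_left)
  then have "0 \<le> lorentz (G + (a * t) *\<^sub>R H) (G + (a * t) *\<^sub>R H)"
    by (rule lorentz_self_nonneg[OF in_hyperbolic_space])
  also have "\<dots> = lorentz G G + 2 * (a * t) * lorentz G H + (a * t)\<^sup>2 * (\<sigma> * b\<^sup>2)"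
    using lorentz_commute[of H G]
    by (simp add: lorentz.add_left lorentz.add_right lorentz.scaleR_left lorentz.scaleR_right HH power2_eq_square algebra_simps)
  finally have square: "0 \<le> lorentz G G + 2 * (a * t) * lorentz G H + (a * t)\<^sup>2 * (\<sigma> * b\<^sup>2)" .
  have divergence: "height_divergence (\<lambda>p. (u p)\<^sup>2 / height p) p
      = 2 * t * lorentz G H - t\<^sup>2 * (\<sigma> * b\<^sup>2) + (2 * a + 1) * (t * b)\<^sup>2"
    unfolding height_divergence_square[OF u] n
    by (simp only: b_def[symmetric] G_def[symmetric] H_def[symmetric] HH ub)
      (use \<open>b > 0\<close> in \<open>simp add: field_simps power2_eq_square\<close>)
  have "lorentz G G - a\<^sup>2 * (u p)\<^sup>2 + a * height_divergence (\<lambda>p. (u p)\<^sup>2 / height p) p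
      = (lorentz G G + 2 * (a * t) * lorentz G H + (a * t)\<^sup>2 * (\<sigma> * b\<^sup>2)) + (a + a\<^sup>2) * (t * b)\<^sup>2 * (1 - \<sigma>)"
    unfolding divergence ub by (simp add: algebra_simps power2_eq_square)
  moreover have "(a + a\<^sup>2) * (t * b)\<^sup>2 * (1 - \<sigma>) \<ge> 0"
    using a \<sigma> by (intro mult_nonneg_nonneg add_nonneg_nonneg) auto
  ultimately show ?thesis using square by (simp add: a_def G_def)
qed

lemma spectral_gap_compact_support:
  assumes u: "C1_function u" and K: "compact K" "\<And>p. p \<notin> K \<Longrightarrow> u p = 0"
  shows "integrable volume (\<lambda>p. (u p)\<^sup>2)" "integrable volume (\<lambda>p. lorentz (gradient \<A> f u p) (gradient \<A> f u p))"
    and "((real CARD('n) - 1) / 2)\<^sup>2 * (LINT p|volume. (u p)\<^sup>2) \<le> (LINT p|volume. lorentz (gradient \<A> f u p) (gradient \<A> f u p))"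
proof -
  let ?G = "\<lambda>p. lorentz (gradient \<A> f u p) (gradient \<A> f u p)"
  let ?h = "height_divergence (\<lambda>p. (u p)\<^sup>2 / height p)"
  show int_u: "integrable volume (\<lambda>p. (u p)\<^sup>2)"
    by (rule integrable_compact_support[OF continuous_on_power[OF C1_function_continuous[OF u]] K(1)])
      (simp add: K(2))
  have "?G p = 0" if "p \<notin> K" for p
    using gradient_eq_0[OF u, of "- K" p] that K by (simp add: lorentz.zero_left open_Compl compact_imp_closed)
  then show int_G: "integrable volume ?G"
    by (intro integrable_compact_support[OF _ K(1)] lorentz.continuous_on continuous_gradient u)
  have h: "has_bochner_integral volume ?h 0"
    by (rule integral_height_divergence[OF C1_square_over_height[OF u] K(1)]) (simp add: K(2))
  have "0 \<le> (LINT p|volume. ?G p - ((real CARD('n) - 1) / 2)\<^sup>2 * (u p)\<^sup>2 + ((real CARD('n) - 1) / 2) * ?h p)"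
    by (rule Bochner_Integration.integral_nonneg) (rule gradient_gap_pointwise[OF u])
  also have "\<dots> = (LINT p|volume. ?G p) - ((real CARD('n) - 1) / 2)\<^sup>2 * (LINT p|volume. (u p)\<^sup>2) + ((real CARD('n) - 1) / 2) * (LINT p|volume. ?h p)"
    using int_u int_G h by (simp add: has_bochner_integral_iff)
  finally show "((real CARD('n) - 1) / 2)\<^sup>2 * (LINT p|volume. (u p)\<^sup>2) \<le> (LINT p|volume. ?G p)"
    using h by (simp add: has_bochner_integral_iff)
qed

text \<open>Both inequalities serve the approximation argument: \<open>v\<close> is close to \<open>w\<close>, and \<open>\<epsilon>\<close> is small but fixed
  while the difference tends to zero.\<close>

lemma lorentz_young:
  assumes "\<epsilon> > 0" "lorentz v (f p) = 0" "lorentz w (f p) = 0"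
  shows "lorentz v v \<le> (1 + \<epsilon>) * lorentz w w + (1 + 1 / \<epsilon>) * lorentz (v - w) (v - w)"
proof -
  have "lorentz (\<epsilon> *\<^sub>R w - (v - w)) (f p) = 0"
    using assms by (simp add: lorentz.diff_left lorentz.scaleR_left)
  then have "0 \<le> lorentz (\<epsilon> *\<^sub>R w - (v - w)) (\<epsilon> *\<^sub>R w - (v - w))"
    by (rule lorentz_self_nonneg[OF in_hyperbolic_space])
  also have "\<dots> = \<epsilon> * ((1 + \<epsilon>) * lorentz w w + (1 + 1 / \<epsilon>) * lorentz (v - w) (v - w) - lorentz v v)"
    using assms(1) lorentz_commute[of v w]
    by (simp only: lorentz.diff_left lorentz.diff_right lorentz.scaleR_left lorentz.scaleR_right real_scaleR_def)
      (simp add: algebra_simps)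
  finally show ?thesis using assms(1) by (simp add: zero_le_mult_iff)
qed

lemma real_young:
  fixes s t \<epsilon> :: real
  assumes "\<epsilon> > 0"
  shows "s\<^sup>2 \<le> (1 + \<epsilon>) * t\<^sup>2 + (1 + 1 / \<epsilon>) * (t - s)\<^sup>2"
proof -
  have "0 \<le> (\<epsilon> * t + (t - s))\<^sup>2" by simp
  also have "\<dots> = \<epsilon> * ((1 + \<epsilon>) * t\<^sup>2 + (1 + 1 / \<epsilon>) * (t - s)\<^sup>2 - s\<^sup>2)"
    using assms by (simp add: power2_eq_square algebra_simps)
  finally show ?thesis using assms by (simp add: zero_le_mult_iff)
qed

text \<open>Approximate \<open>\<phi>\<close> by compactly supported functions up to an error \<open>\<delta>\<close> in the squared norm. For fixed
  \<open>\<epsilon>\<close> this costs a multiple of \<open>\<delta>\<close> and a factor \<open>(1 + \<epsilon>)\<^sup>2\<close>; let \<open>\<delta>\<close> and then \<open>\<epsilon>\<close> tend to zero.\<close>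

lemma spectral_gap:
  assumes "(\<phi>, X) \<in> W12_0 \<A> f"
  shows "((real CARD('n) - 1) / 2)\<^sup>2 * (LINT p|volume. (\<phi> p)\<^sup>2) \<le> (LINT p|volume. lorentz (X p) (X p))"
proof -
  have W12: "(\<phi>, X) \<in> W12 \<A> f" using assms unfolding W12_0_def by blast
  have meas: "\<phi> \<in> borel_measurable borel" "X \<in> borel_measurable borel"
    and X: "\<And>p. X p \<in> tangent_space \<A> f p"
    and int: "integrable volume (\<lambda>p. (\<phi> p)\<^sup>2)" "integrable volume (\<lambda>p. lorentz (X p) (X p))"
    using W12 unfolding W12_def has_weak_gradient_def by auto
  have X_orth: "lorentz (X p) (f p) = 0" for p by (rule tangent_space_orthogonal[OF X])
  let ?D = "\<lambda>u p. (u p - \<phi> p)\<^sup>2 + lorentz (gradient \<A> f u p - X p) (gradient \<A> f u p - X p)"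
  obtain u where u: "\<And>k. smooth_function \<A> (u k)" "\<And>k. compactly_supported (u k)"
    and lim: "(\<lambda>k :: nat. \<integral>\<^sup>+p. ennreal (?D (u k) p) \<partial>volume) \<longlonglongrightarrow> 0"
    using assms unfolding W12_0_def by blast
  define P Q where "P = (LINT p|volume. (\<phi> p)\<^sup>2)" and "Q = (LINT p|volume. lorentz (X p) (X p))"
  define a where "a = ((real CARD('n) - 1) / 2)\<^sup>2"
  have a: "a \<ge> 0" by (simp add: a_def)
  have approx: "a * P \<le> (1 + \<epsilon>)\<^sup>2 * Q + ((1 + 1 / \<epsilon>) * (1 + \<epsilon> + a)) * \<delta>" if \<epsilon>: "\<epsilon> > 0" and \<delta>: "\<delta> > 0" for \<epsilon> \<delta> :: real
  proof -
    have "eventually (\<lambda>k. (\<integral>\<^sup>+p. ennreal (?D (u k) p) \<partial>volume) < ennreal \<delta>) sequentially"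
      using order_tendstoD(2)[OF lim] \<delta> by simp
    then obtain k where k: "(\<integral>\<^sup>+p. ennreal (?D (u k) p) \<partial>volume) < ennreal \<delta>"
      unfolding eventually_sequentially by blast
    define w where "w = u k"
    define G where "G = gradient \<A> f w"
    have w: "C1_function w" unfolding w_def by (rule smooth_function_imp_C1_function[OF u(1)])
    have G_orth: "lorentz (G p) (f p) = 0" for p unfolding G_def by (rule gradient_orthogonal[OF w])
    define K where "K = closure {p. w p \<noteq> 0}"
    have K: "compact K" using u(2) unfolding compactly_supported_def K_def w_def by blast
    have outside: "w p = 0" if "p \<notin> K" for p
      using that closure_subset[of "{p. w p \<noteq> 0}"] by (auto simp: K_def)
    note gap = spectral_gap_compact_support[OF w K outside, folded G_def a_def]
    have diff_nonneg: "lorentz (G p - X p) (G p - X p) \<ge> 0" for p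
      using G_orth X_orth by (intro lorentz_self_nonneg[OF in_hyperbolic_space[of p]]) (simp add: lorentz.diff_left)
    have G_meas: "G \<in> borel_measurable borel"
      unfolding G_def by (rule borel_measurable_continuous_onI[OF continuous_gradient[OF w]])
    have w_meas: "w \<in> borel_measurable borel"
      by (rule borel_measurable_continuous_onI[OF C1_function_continuous[OF w]])
    define d where "d p = (w p - \<phi> p)\<^sup>2 + lorentz (G p - X p) (G p - X p)" for p
    have d_nonneg: "d p \<ge> 0" for p using diff_nonneg[of p] by (simp add: d_def)
    have d_meas: "d \<in> borel_measurable borel"
    proof -
      have "(\<lambda>v :: 'h \<times> real. lorentz v v) \<in> borel_measurable borel"
        by (intro borel_measurable_continuous_onI lorentz.continuous_on continuous_on_id)
      from measurable_compose[OF borel_measurable_diff[OF G_meas meas(2)] this] show ?thesis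
        unfolding d_def[abs_def] using w_meas meas(1) by measurable
    qed
    have d_int: "integrable volume d"
      by (rule integrableI_nonneg) (use d_meas d_nonneg k in \<open>auto simp: d_def w_def G_def intro: less_trans\<close>)
    have "ennreal (LINT p|volume. d p) = (\<integral>\<^sup>+p. ennreal (d p) \<partial>volume)"
      by (rule nn_integral_eq_integral[OF d_int, symmetric]) (simp add: d_nonneg)
    also have "\<dots> < ennreal \<delta>" using k by (simp add: d_def w_def G_def)
    finally have d_less: "(LINT p|volume. d p) \<le> \<delta>"
      using d_nonneg \<delta> by (simp add: ennreal_less_iff integral_nonneg)
    have "P \<le> (LINT p|volume. (1 + \<epsilon>) * (w p)\<^sup>2 + (1 + 1 / \<epsilon>) * d p)"
      unfolding P_def
    proof (rule integral_mono)
      show "(\<phi> p)\<^sup>2 \<le> (1 + \<epsilon>) * (w p)\<^sup>2 + (1 + 1 / \<epsilon>) * d p" for p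
      proof -
        have "(1 + 1 / \<epsilon>) * (w p - \<phi> p)\<^sup>2 \<le> (1 + 1 / \<epsilon>) * d p"
          using \<epsilon> diff_nonneg[of p] by (intro mult_left_mono) (auto simp: d_def)
        then show ?thesis using real_young[OF \<epsilon>, of "\<phi> p" "w p"] by linarith
      qed
    qed (use int gap(1) d_int in auto)
    also have "\<dots> = (1 + \<epsilon>) * (LINT p|volume. (w p)\<^sup>2) + (1 + 1 / \<epsilon>) * (LINT p|volume. d p)"
      using gap(1) d_int by simp
    finally have P_le: "P \<le> (1 + \<epsilon>) * (LINT p|volume. (w p)\<^sup>2) + (1 + 1 / \<epsilon>) * (LINT p|volume. d p)" .
    have "(LINT p|volume. lorentz (G p) (G p)) \<le> (LINT p|volume. (1 + \<epsilon>) * lorentz (X p) (X p) + (1 + 1 / \<epsilon>) * d p)"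
    proof (rule integral_mono)
      show "lorentz (G p) (G p) \<le> (1 + \<epsilon>) * lorentz (X p) (X p) + (1 + 1 / \<epsilon>) * d p" for p
      proof -
        have "(1 + 1 / \<epsilon>) * lorentz (G p - X p) (G p - X p) \<le> (1 + 1 / \<epsilon>) * d p"
          using \<epsilon> by (intro mult_left_mono) (auto simp: d_def)
        then show ?thesis using lorentz_young[OF \<epsilon> G_orth X_orth] by (smt (verit))
      qed
    qed (use int gap(2) d_int in auto)
    also have "\<dots> = (1 + \<epsilon>) * Q + (1 + 1 / \<epsilon>) * (LINT p|volume. d p)"
      unfolding Q_def using int d_int by simp
    finally have G_le: "(LINT p|volume. lorentz (G p) (G p)) \<le> (1 + \<epsilon>) * Q + (1 + 1 / \<epsilon>) * (LINT p|volume. d p)" .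
    have "a * P \<le> (1 + \<epsilon>) * (a * (LINT p|volume. (w p)\<^sup>2)) + a * (1 + 1 / \<epsilon>) * (LINT p|volume. d p)"
      using mult_left_mono[OF P_le a] by (simp add: algebra_simps)
    also have "\<dots> \<le> (1 + \<epsilon>) * ((1 + \<epsilon>) * Q + (1 + 1 / \<epsilon>) * (LINT p|volume. d p)) + a * (1 + 1 / \<epsilon>) * (LINT p|volume. d p)"
      using \<epsilon> gap(3) G_le by (intro add_mono mult_left_mono order_refl) auto
    also have "\<dots> = (1 + \<epsilon>)\<^sup>2 * Q + ((1 + 1 / \<epsilon>) * (1 + \<epsilon> + a)) * (LINT p|volume. d p)"
      by (simp add: power2_eq_square distrib_left distrib_right mult_ac)
    also have "\<dots> \<le> (1 + \<epsilon>)\<^sup>2 * Q + ((1 + 1 / \<epsilon>) * (1 + \<epsilon> + a)) * \<delta>"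
      using \<epsilon> a d_less by (intro add_mono mult_left_mono order_refl mult_nonneg_nonneg) auto
    finally show ?thesis .
  qed
  have bound: "a * P \<le> (1 + \<epsilon>)\<^sup>2 * Q" if \<epsilon>: "\<epsilon> > 0" for \<epsilon> :: real
  proof (rule field_le_epsilon)
    fix e :: real assume "e > 0"
    define C where "C = (1 + 1 / \<epsilon>) * (1 + \<epsilon> + a)"
    have "C > 0" unfolding C_def using \<epsilon> a by (intro mult_pos_pos) (auto intro: add_pos_nonneg)
    then show "a * P \<le> (1 + \<epsilon>)\<^sup>2 * Q + e"
      using approx[OF \<epsilon>, of "e / C"] \<open>e > 0\<close> unfolding C_def[symmetric] by simp
  qed
  have "((\<lambda>\<epsilon>. (1 + \<epsilon>)\<^sup>2 * Q) \<longlongrightarrow> (1 + 0)\<^sup>2 * Q) (at_right (0::real))"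
    by (intro tendsto_intros)
  moreover have "eventually (\<lambda>\<epsilon>. a * P \<le> (1 + \<epsilon>)\<^sup>2 * Q) (at_right (0::real))"
    using bound by (simp add: eventually_at_filter)
  ultimately have "a * P \<le> (1 + 0)\<^sup>2 * Q"
    by (intro tendsto_lowerbound[of _ _ "at_right (0::real)"]) auto
  then show ?thesis by (simp add: a_def P_def Q_def)
qed

end

theorem theorem7:
  fixes \<A> :: "('p::{t2_space,second_countable_topology}, 'n::finite) chart set"
    and f :: "'p \<Rightarrow> 'h::euclidean_space \<times> real"
    and n m :: nat
  assumes "CARD('n) = n" and "DIM('h) = n + m"
    and "minimal_submanifold \<A> f"
    and "complete_submanifold \<A> f"
    and "\<And>p. sff_norm_sq \<A> f p \<le> (real n + 1)\<^sup>2 / 4"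
  shows "super_stable \<A> f"
proof -
  interpret minimal_immersion \<A> f
    using assms(3) by unfold_locales (auto simp: minimal_submanifold_def)
  let ?A = "sff_norm_sq \<A> f" and ?a = "((real n - 1) / 2)\<^sup>2"
  have "integrable (volume_measure \<A> f) (\<lambda>p. lorentz (X p) (X p) - (?A p - real n) * (\<phi> p)\<^sup>2) \<and>
      (LINT p|volume_measure \<A> f. lorentz (X p) (X p) - (?A p - real n) * (\<phi> p)\<^sup>2) \<ge> 0"
    if \<phi>: "(\<phi>, X) \<in> W12_0 \<A> f" for \<phi> X
  proof -
    have W12: "(\<phi>, X) \<in> W12 \<A> f" using \<phi> unfolding W12_0_def by blast
    have meas: "\<phi> \<in> borel_measurable borel"
      and int: "integrable volume (\<lambda>p. (\<phi> p)\<^sup>2)" "integrable volume (\<lambda>p. lorentz (X p) (X p))"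
      using W12 unfolding W12_def by auto
    have A_meas: "?A \<in> borel_measurable borel"
      by (rule borel_measurable_continuous_onI[OF continuous_sff_norm_sq])
    have "integrable volume (\<lambda>p. ?A p * (\<phi> p)\<^sup>2)"
    proof (rule Bochner_Integration.integrable_bound)
      show "integrable volume (\<lambda>p. (real n + 1)\<^sup>2 / 4 * (\<phi> p)\<^sup>2)" using int(1) by simp
      show "(\<lambda>p. ?A p * (\<phi> p)\<^sup>2) \<in> borel_measurable volume" using A_meas meas by simp
      have "norm (?A p * (\<phi> p)\<^sup>2) \<le> norm ((real n + 1)\<^sup>2 / 4 * (\<phi> p)\<^sup>2)" for p
        unfolding norm_mult using assms(5)[of p] sff_norm_sq_nonneg[of p] by (intro mult_right_mono) auto
      then show "AE p in volume. norm (?A p * (\<phi> p)\<^sup>2) \<le> norm ((real n + 1)\<^sup>2 / 4 * (\<phi> p)\<^sup>2)"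
        by (intro AE_I2)
    qed
    then have int_q: "integrable volume (\<lambda>p. lorentz (X p) (X p) - (?A p - real n) * (\<phi> p)\<^sup>2)"
      using int by (simp add: left_diff_distrib)
    have "0 \<le> (LINT p|volume. lorentz (X p) (X p)) - ?a * (LINT p|volume. (\<phi> p)\<^sup>2)"
      using spectral_gap[OF \<phi>] assms(1) by simp
    also have "\<dots> = (LINT p|volume. lorentz (X p) (X p) - ?a * (\<phi> p)\<^sup>2)"
      using int by simp
    also have "\<dots> \<le> (LINT p|volume. lorentz (X p) (X p) - (?A p - real n) * (\<phi> p)\<^sup>2)"
    proof (rule integral_mono)
      have "?A p - real n \<le> ?a" for p
        using assms(5)[of p] by (simp add: power2_eq_square field_simps)
      then show "lorentz (X p) (X p) - ?a * (\<phi> p)\<^sup>2 \<le> lorentz (X p) (X p) - (?A p - real n) * (\<phi> p)\<^sup>2" for p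
        by (intro diff_left_mono mult_right_mono) auto
    qed (use int int_q in auto)
    finally show ?thesis using int_q by simp
  qed
  then show ?thesis
    unfolding super_stable_def Let_def using assms(1) by auto
qed

end
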